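(* Let $X$ be a regular diffusion on $[0,1]$ begun in $\Pi_0$, let $X$ have either (instantaneously) reflecting or entrance behavior at each of the boundaries, and let $\Pi$ be the stationary measure for $X$. Let $X^*$ be the strong stationary dual diffusion of $X$, begun in $\Pi_0^*$ satisfying $(\Pi_0,f)=(\Pi_0^*,\Lambda f)$ for all $f\in\mathcal{F}[0,1]$, and let $T_1^*$ be the hitting time of state $1$ for $X^*$. Then for $t>0$ $$\mathrm{sep}(t)=\mathbb{P}_{\Pi_0^*}(T_1^*>t)=1-\mathbb{P}_{\Pi_0^*}(X_t^*=1).$$
   Context: Diffusions. $I=[0,1]$, $I^\circ=(0,1)$; $a,b\in C(I^\circ)$ with $b>0$. $X$ is a time-homogeneous Feller diffusion on $I$ with generator $A=\frac12 b\frac{d^2}{dx^2}+a\frac{d}{dx}$ with domain $\mathcal{D}_A$. Regular means $\mathbb{P}(T_y<\infty\mid X_0=x)>0$ for all $x,y\in I^\circ$. Scale function: $S'(x)=s(x)=\exp\{-\int^x 2a/b\}$; speed measure $M(dx)$ with density $m=1/(sb)$. With $x\in I^\circ$ fixed, $N(0)=\int_{(0,x]}[S(x)-S(\eta)]M(d\eta)$, $\Sigma(0)=\int_{(0,x]}[M(x)-M(\eta)]dS(\eta)$ and analogously at $1$. A boundary is entrance if $N<\infty,\Sigma=\infty$ and regular if $N<\infty,\Sigma<\infty$. A regular boundary $0$ is (instantaneously) reflecting if $\frac{df}{dS}^+(0)=\lim_{x\downarrow0}f'(x)/s(x)=0$ for all $f\in\mathcal{D}_A$ (similarly at $1$). When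 each boundary is reflecting or entrance, $\mathcal{D}_A$ is the set of $f\in C(I)\cap C^2(I^\circ)$ with $Af\in C(I)$ and $\frac{df}{dS}^+(0)=0$ if $0$ is reflecting, $\frac{df}{dS}^-(1)=0$ if $1$ is reflecting. $\Pi$, the unique invariant distribution, is $M$ normalized; it has density $\pi>0$ on $I^\circ$, and $\Pi(x)=\int_0^x\pi(y)dy$. Strong stationary dual. $\mathcal{F}[0,1]$ is the space of bounded measurable real functions on $[0,1]$; $(\mu,f)=\int f\,d\mu$. For $f\in\mathcal{F}[0,1]$ let $(\Lambda f)(x)=\int_0^x\frac{\pi(y)}{\Pi(x)}f(y)dy$ for $x>0$, $(\Lambda f)(0)=f(0)$. A second Feller diffusion $X^*$ on $I$ with initial law $\Pi_0^*$ and generator $A^*$ with domain $\mathcal{D}_{A^*}$ is a strong stationary dual of $X$ if $\Lambda$ maps $\mathcal{D}_A$ into $\mathcal{D}_{A^*}$, $\Lambda A=A^*\Lambda$ on $\mathcal{D}_A$, and $(\Pi_0,f)=(\Pi_0^*,\Lambda f)$ for all $f\in\mathcal{F}[0,1]$. Separation. For $t>0$, let $\Pi_t$ be the law of $X_t$ (one has $\Pi_t\ll\Pi$), $R_t=d\Pi_t/d\Pi$, $a(t)=\operatorname{ess\,inf}R_t=\sup\{r:\Pi(R_t<r)=0\}$ (essential infimum with respect to $\Pi$), and $\mathrm{sep}(t)=1-a(t)$. *)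

theory Defs
  imports "HOL-Probability.Probability"
begin

text \<open>Functions on the state space \<open>I = [0,1]\<close> are represented by functions \<open>real \<Rightarrow> real\<close>
  of which only the values on \<open>{0..1}\<close> matter; laws on \<open>I\<close> are measures on \<open>I_borel\<close>.\<close>

definition I_borel :: "real measure" where
  "I_borel = restrict_space borel {0..1}"

definition C_I :: "(real \<Rightarrow> real) set" where
  "C_I = {f. continuous_on {0..1} f}"

definition F_I :: "(real \<Rightarrow> real) set" where
  "F_I = {f \<in> borel_measurable I_borel. bounded (f ` {0..1})}"

section \<open>Feller diffusions on \<open>[0,1]\<close>\<close>

text \<open>A process is given as a Markov family: \<open>Q x\<close> is the law on the path space \<open>\<Omega>\<close> when the
  process \<open>X\<close> is started in \<open>x\<close>, and \<open>\<mu> \<bind> Q\<close> is its law when it is begun in \<open>\<mu>\<close>.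
  Time is the real half-line, so only \<open>X t\<close> with \<open>t \<ge> 0\<close> matters.\<close>

definition P_op ::
    "(real \<Rightarrow> 'w measure) \<Rightarrow> (real \<Rightarrow> 'w \<Rightarrow> real) \<Rightarrow> real \<Rightarrow> (real \<Rightarrow> real) \<Rightarrow> real \<Rightarrow> real" where
  "P_op Q X t f x = (\<integral>\<omega>. f (X t \<omega>) \<partial>Q x)"

definition nat_filtration ::
    "'w measure \<Rightarrow> (real \<Rightarrow> 'w \<Rightarrow> real) \<Rightarrow> real \<Rightarrow> 'w measure" where
  "nat_filtration \<Omega> X t =
     sigma (space \<Omega>) (\<Union>u\<in>{0..t}. {X u -` B \<inter> space \<Omega> | B. B \<in> sets I_borel})"

locale feller_diffusion =
  fixes \<Omega> :: "'w measure" and Q :: "real \<Rightarrow> 'w measure" and X :: "real \<Rightarrow> 'w \<Rightarrow> real"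
  assumes kernel: "Q \<in> I_borel \<rightarrow>\<^sub>M prob_algebra \<Omega>"
    and X_measurable: "0 \<le> t \<Longrightarrow> X t \<in> \<Omega> \<rightarrow>\<^sub>M I_borel"
    and continuous_paths: "\<omega> \<in> space \<Omega> \<Longrightarrow> continuous_on {0..} (\<lambda>t. X t \<omega>)"
    and start: "x \<in> {0..1} \<Longrightarrow> AE \<omega> in Q x. X 0 \<omega> = x"
    and markov: "\<lbrakk>x \<in> {0..1}; 0 \<le> t; 0 \<le> u; f \<in> F_I\<rbrakk> \<Longrightarrow>
       AE \<omega> in Q x. real_cond_exp (Q x) (nat_filtration \<Omega> X t) (\<lambda>\<omega>. f (X (t + u) \<omega>)) \<omega>
                     = P_op Q X u f (X t \<omega>)"
    and feller: "\<lbrakk>0 \<le> t; f \<in> C_I\<rbrakk> \<Longrightarrow> P_op Q X t f \<in> C_I"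
    and strongly_continuous:
      "f \<in> C_I \<Longrightarrow> uniform_limit {0..1} (\<lambda>t. P_op Q X t f) f (at_right 0)"

text \<open>The infinitesimal generator of the semigroup on \<open>C(I)\<close>, with respect to the supremum norm.\<close>

definition gen_dom ::
    "(real \<Rightarrow> 'w measure) \<Rightarrow> (real \<Rightarrow> 'w \<Rightarrow> real) \<Rightarrow> (real \<Rightarrow> real) set" where
  "gen_dom Q X = {f \<in> C_I. \<exists>g\<in>C_I.
     uniform_limit {0..1} (\<lambda>t x. (P_op Q X t f x - f x) / t) g (at_right 0)}"

definition gen ::
    "(real \<Rightarrow> 'w measure) \<Rightarrow> (real \<Rightarrow> 'w \<Rightarrow> real) \<Rightarrow> (real \<Rightarrow> real) \<Rightarrow> real \<Rightarrow> real" where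
  "gen Q X f x = Lim (at_right 0) (\<lambda>t. (P_op Q X t f x - f x) / t)"

definition hitting_time :: "(real \<Rightarrow> 'w \<Rightarrow> real) \<Rightarrow> real \<Rightarrow> 'w \<Rightarrow> ereal" where
  "hitting_time X y \<omega> = Inf {ereal t | t. 0 \<le> t \<and> X t \<omega> = y}"

definition regular_process ::
    "'w measure \<Rightarrow> (real \<Rightarrow> 'w measure) \<Rightarrow> (real \<Rightarrow> 'w \<Rightarrow> real) \<Rightarrow> bool" where
  "regular_process \<Omega> Q X \<longleftrightarrow>
     (\<forall>x\<in>{0<..<1}. \<forall>y\<in>{0<..<1}. measure (Q x) {\<omega> \<in> space \<Omega>. hitting_time X y \<omega> < \<infinity>} > 0)"

definition law_at ::
    "(real \<Rightarrow> 'w measure) \<Rightarrow> (real \<Rightarrow> 'w \<Rightarrow> real) \<Rightarrow> real measure \<Rightarrow> real \<Rightarrow> real measure" where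
  "law_at Q X \<mu> t = distr (\<mu> \<bind> Q) I_borel (X t)"

definition invariant_distribution ::
    "(real \<Rightarrow> 'w measure) \<Rightarrow> (real \<Rightarrow> 'w \<Rightarrow> real) \<Rightarrow> real measure \<Rightarrow> bool" where
  "invariant_distribution Q X \<mu> \<longleftrightarrow>
     \<mu> \<in> space (prob_algebra I_borel) \<and> (\<forall>t\<ge>0. law_at Q X \<mu> t = \<mu>)"

section \<open>Scale, speed and boundary behavior\<close>

text \<open>The drift is \<open>a\<close>, the squared diffusion coefficient is \<open>b\<close>. The interior point \<open>c\<close> serves as
  the lower limit of the indefinite integrals defining \<open>s\<close>, \<open>S\<close>, \<open>M\<close>, and also as the fixed
  interior point in the boundary integrals \<open>N\<close> and \<open>\<Sigma>\<close>.\<close>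

definition scale_dens :: "(real \<Rightarrow> real) \<Rightarrow> (real \<Rightarrow> real) \<Rightarrow> real \<Rightarrow> real \<Rightarrow> real" where
  "scale_dens a b c x = exp (- (LBINT y=ereal c..ereal x. 2 * a y / b y))"

definition scale_fun :: "(real \<Rightarrow> real) \<Rightarrow> (real \<Rightarrow> real) \<Rightarrow> real \<Rightarrow> real \<Rightarrow> real" where
  "scale_fun a b c x = (LBINT y=ereal c..ereal x. scale_dens a b c y)"

definition speed_dens :: "(real \<Rightarrow> real) \<Rightarrow> (real \<Rightarrow> real) \<Rightarrow> real \<Rightarrow> real \<Rightarrow> real" where
  "speed_dens a b c x = 1 / (scale_dens a b c x * b x)"

definition speed_fun :: "(real \<Rightarrow> real) \<Rightarrow> (real \<Rightarrow> real) \<Rightarrow> real \<Rightarrow> real \<Rightarrow> real" where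
  "speed_fun a b c x = (LBINT y=ereal c..ereal x. speed_dens a b c y)"

definition N0 :: "(real \<Rightarrow> real) \<Rightarrow> (real \<Rightarrow> real) \<Rightarrow> real \<Rightarrow> ennreal" where
  "N0 a b c = (\<integral>\<^sup>+\<eta>\<in>{0<..c}.
     ennreal (scale_fun a b c c - scale_fun a b c \<eta>) * ennreal (speed_dens a b c \<eta>) \<partial>lborel)"

definition Sigma0 :: "(real \<Rightarrow> real) \<Rightarrow> (real \<Rightarrow> real) \<Rightarrow> real \<Rightarrow> ennreal" where
  "Sigma0 a b c = (\<integral>\<^sup>+\<eta>\<in>{0<..c}.
     ennreal (speed_fun a b c c - speed_fun a b c \<eta>) * ennreal (scale_dens a b c \<eta>) \<partial>lborel)"

definition N1 :: "(real \<Rightarrow> real) \<Rightarrow> (real \<Rightarrow> real) \<Rightarrow> real \<Rightarrow> ennreal" where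
  "N1 a b c = (\<integral>\<^sup>+\<eta>\<in>{c..<1}.
     ennreal (scale_fun a b c \<eta> - scale_fun a b c c) * ennreal (speed_dens a b c \<eta>) \<partial>lborel)"

definition Sigma1 :: "(real \<Rightarrow> real) \<Rightarrow> (real \<Rightarrow> real) \<Rightarrow> real \<Rightarrow> ennreal" where
  "Sigma1 a b c = (\<integral>\<^sup>+\<eta>\<in>{c..<1}.
     ennreal (speed_fun a b c \<eta> - speed_fun a b c c) * ennreal (scale_dens a b c \<eta>) \<partial>lborel)"

definition zero_flux0 :: "(real \<Rightarrow> real) \<Rightarrow> (real \<Rightarrow> real) \<Rightarrow> real \<Rightarrow> (real \<Rightarrow> real) \<Rightarrow> bool" where
  "zero_flux0 a b c f \<longleftrightarrow> ((\<lambda>x. deriv f x / scale_dens a b c x) \<longlongrightarrow> 0) (at_right 0)"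

definition zero_flux1 :: "(real \<Rightarrow> real) \<Rightarrow> (real \<Rightarrow> real) \<Rightarrow> real \<Rightarrow> (real \<Rightarrow> real) \<Rightarrow> bool" where
  "zero_flux1 a b c f \<longleftrightarrow> ((\<lambda>x. deriv f x / scale_dens a b c x) \<longlongrightarrow> 0) (at_left 1)"

definition entrance0 :: "(real \<Rightarrow> real) \<Rightarrow> (real \<Rightarrow> real) \<Rightarrow> real \<Rightarrow> bool" where
  "entrance0 a b c \<longleftrightarrow> N0 a b c < \<infinity> \<and> Sigma0 a b c = \<infinity>"

definition entrance1 :: "(real \<Rightarrow> real) \<Rightarrow> (real \<Rightarrow> real) \<Rightarrow> real \<Rightarrow> bool" where
  "entrance1 a b c \<longleftrightarrow> N1 a b c < \<infinity> \<and> Sigma1 a b c = \<infinity>"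

text \<open>In the next two definitions \<open>D\<close> is the domain of the generator.\<close>

definition reflecting0 ::
    "(real \<Rightarrow> real) \<Rightarrow> (real \<Rightarrow> real) \<Rightarrow> real \<Rightarrow> (real \<Rightarrow> real) set \<Rightarrow> bool" where
  "reflecting0 a b c D \<longleftrightarrow>
     N0 a b c < \<infinity> \<and> Sigma0 a b c < \<infinity> \<and> (\<forall>f\<in>D. zero_flux0 a b c f)"

definition reflecting1 ::
    "(real \<Rightarrow> real) \<Rightarrow> (real \<Rightarrow> real) \<Rightarrow> real \<Rightarrow> (real \<Rightarrow> real) set \<Rightarrow> bool" where
  "reflecting1 a b c D \<longleftrightarrow>
     N1 a b c < \<infinity> \<and> Sigma1 a b c < \<infinity> \<and> (\<forall>f\<in>D. zero_flux1 a b c f)"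

definition C2_int :: "(real \<Rightarrow> real) set" where
  "C2_int = {f. f differentiable_on {0<..<1} \<and> deriv f differentiable_on {0<..<1} \<and>
                continuous_on {0<..<1} (deriv (deriv f))}"

definition diff_op :: "(real \<Rightarrow> real) \<Rightarrow> (real \<Rightarrow> real) \<Rightarrow> (real \<Rightarrow> real) \<Rightarrow> real \<Rightarrow> real" where
  "diff_op a b f x = 1/2 * b x * deriv (deriv f) x + a x * deriv f x"

text \<open>The generator of \<open>X\<close> is \<open>diff_op a b\<close> with the domain appropriate to boundaries that are
  reflecting or entrance. That \<open>Af \<in> C(I)\<close> means that \<open>Af\<close>, a priori defined on the interior only,
  extends continuously to \<open>I\<close>; the extension is the value of the generator.\<close>

definition has_diffusion_generator ::
    "(real \<Rightarrow> 'w measure) \<Rightarrow> (real \<Rightarrow> 'w \<Rightarrow> real) \<Rightarrow> (real \<Rightarrow> real) \<Rightarrow> (real \<Rightarrow> real) \<Rightarrow> real \<Rightarrow> bool" where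
  "has_diffusion_generator Q X a b c \<longleftrightarrow>
     gen_dom Q X = {f \<in> C_I \<inter> C2_int.
       (\<exists>g\<in>C_I. \<forall>x\<in>{0<..<1}. g x = diff_op a b f x) \<and>
       (reflecting0 a b c (gen_dom Q X) \<longrightarrow> zero_flux0 a b c f) \<and>
       (reflecting1 a b c (gen_dom Q X) \<longrightarrow> zero_flux1 a b c f)} \<and>
     (\<forall>f\<in>gen_dom Q X. \<forall>x\<in>{0<..<1}. gen Q X f x = diff_op a b f x)"

section \<open>Strong stationary duality and separation\<close>

definition stat_dens :: "(real \<Rightarrow> real) \<Rightarrow> (real \<Rightarrow> real) \<Rightarrow> real \<Rightarrow> real \<Rightarrow> real" where
  "stat_dens a b c x = speed_dens a b c x / (LBINT y=0..1. speed_dens a b c y)"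

definition stat_cdf :: "(real \<Rightarrow> real) \<Rightarrow> (real \<Rightarrow> real) \<Rightarrow> real \<Rightarrow> real \<Rightarrow> real" where
  "stat_cdf a b c x = (LBINT y=0..ereal x. stat_dens a b c y)"

definition Lambda ::
    "(real \<Rightarrow> real) \<Rightarrow> (real \<Rightarrow> real) \<Rightarrow> real \<Rightarrow> (real \<Rightarrow> real) \<Rightarrow> real \<Rightarrow> real" where
  "Lambda a b c f x =
     (if x = 0 then f 0
      else (LBINT y=0..ereal x. stat_dens a b c y / stat_cdf a b c x * f y))"

definition strong_stationary_dual ::
    "(real \<Rightarrow> real) \<Rightarrow> (real \<Rightarrow> real) \<Rightarrow> real \<Rightarrow>
     (real \<Rightarrow> 'w measure) \<Rightarrow> (real \<Rightarrow> 'w \<Rightarrow> real) \<Rightarrow> real measure \<Rightarrow>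
     (real \<Rightarrow> 'v measure) \<Rightarrow> (real \<Rightarrow> 'v \<Rightarrow> real) \<Rightarrow> real measure \<Rightarrow> bool" where
  "strong_stationary_dual a b c Q X \<mu>0 Qs Xs \<mu>0s \<longleftrightarrow>
     (\<forall>f\<in>gen_dom Q X. Lambda a b c f \<in> gen_dom Qs Xs) \<and>
     (\<forall>f\<in>gen_dom Q X. \<forall>x\<in>{0..1}.
        Lambda a b c (gen Q X f) x = gen Qs Xs (Lambda a b c f) x) \<and>
     (\<forall>f\<in>F_I. (\<integral>x. f x \<partial>\<mu>0) = (\<integral>x. Lambda a b c f x \<partial>\<mu>0s))"

definition ess_inf :: "real measure \<Rightarrow> (real \<Rightarrow> ennreal) \<Rightarrow> real" where
  "ess_inf \<mu> R = Sup {r::real. emeasure \<mu> {x \<in> space \<mu>. R x < ennreal r} = 0}"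

text \<open>Here \<open>\<mu>\<close> is the stationary law and \<open>\<nu>\<close> the law at the given time.\<close>

definition separation :: "real measure \<Rightarrow> real measure \<Rightarrow> real" where
  "separation \<mu> \<nu> = 1 - ess_inf \<mu> (RN_deriv \<mu> \<nu>)"

end

(* Feller's analysis of the boundaries enters only through N(0), N(1) < infinity. By Tonelli these
   bounds say that the speed measure M is finite and that s(y) min (M(0,y), M(y,1)) is integrable,
   so for every continuous g with mean zero under M the equation A f = g is solved in the domain of
   A by f = int s h with h = 2 int g dM. Such f make the domain measure determining, they show that
   an invariant law annihilates every centred g and hence equals Pi, and applied to bumps at 0 they
   show that no mass sits at 0 at positive times.

   The intertwining Lambda A = A* Lambda lifts to the semigroups, because
   r |-> P*_{t-r} Lambda P_r f has right derivative zero. Therefore the law of X_t is that of X*_t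
   followed by the kernel Pi( . | <= x), and it has the decreasing density
   R(z) = E [1(z < X*_t) / Pi(X*_t)] with respect to Pi, whose essential infimum is its limit
   P(X*_t = 1) at 1. Started from 1, Lambda makes X*_t reproduce Pi, which forces X*_t = 1. So 1 is
   absorbing, and X*_t = 1 means that 1 has been hit by time t. *)

theory Submission
  imports Defs
begin

section \<open>Functions and measures on the unit interval\<close>

text \<open>The hypotheses describe X* as a Feller process with continuous paths and otherwise only
  through the duality, so no scale, speed or boundary classification of X* is at hand: every fact
  about it has to be read off from X through \<open>Lambda\<close>. This shapes two steps.

  At 0 the operator is point evaluation instead of an average. An atom of X*_t at 0 would be an atom
  of X_t, and the density formula, which divides by the stationary distribution function, would
  break. From a positive starting point a bump of small stationary mass rules the atom out. From 0
  itself that bound degenerates. There, an atom lasting until time t would keep P_r k(0) above a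
  fixed constant for all bumps k at 0 and all r < t; by Dynkin's formula the potentials of the
  centred bumps would stay away from zero, whereas they vanish uniformly as the bumps shrink.

  At 1 the Markov property is given at deterministic times only. The passage from absorption in law
  to absorption along paths therefore runs through finite sets of rational times in place of a
  stopping time.\<close>

lemma lower_right_derivative_bound:
  fixes w :: "real \<Rightarrow> real"
  assumes cont: "continuous_on {0..T} w" and T: "0 \<le> T"
    and right: "\<And>r e. \<lbrakk>0 \<le> r; r < T; 0 < e\<rbrakk> \<Longrightarrow>
      eventually (\<lambda>h. w (r + h) - w r \<ge> (d - e) * h) (at_right 0)"
  shows "w T - w 0 \<ge> d * T"
proof -
  have "w T - w 0 \<ge> (d - e) * T" if e: "0 < e" for e
  proof -
    define \<phi> where "\<phi> r = w r - w 0 - (d - e) * r" for r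
    \<comment> \<open>Only the behaviour as h decreases to 0 is controlled, so the mean value
      theorem does not apply. The supremum of the times at which the slackened bound d - e holds is
      itself such a time by continuity, and the hypothesis would push past it if it lay below
      T.\<close>
    define S where "S = {r \<in> {0..T}. \<phi> r \<ge> 0}"
    have "continuous_on {0..T} \<phi>"
      unfolding \<phi>_def by (intro continuous_intros cont)
    then have "closed S"
      unfolding S_def by (intro continuous_closed_preimage_constant[of "{0..T}" \<phi> 0, simplified]
        continuous_on_closed_Collect_le continuous_intros) auto
    moreover have ne: "S \<noteq> {}" using T by (auto simp: S_def \<phi>_def intro!: exI[of _ 0])
    moreover have bdd: "bdd_above S" by (auto simp: S_def)
    ultimately have Sup: "Sup S \<in> S" by (intro closed_contains_Sup)
    have "Sup S = T"
    proof (rule ccontr)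
      assume "Sup S \<noteq> T"
      with Sup have lt: "Sup S < T" and ge: "0 \<le> Sup S" by (auto simp: S_def)
      have "eventually (\<lambda>h::real. h < T - Sup S) (at_right 0)"
        using lt by (intro order_tendstoD(2)[OF tendsto_ident_at]) auto
      with right[OF ge lt e] eventually_at_right_less[of "0::real"]
      have "eventually (\<lambda>h. 0 < h \<and> Sup S + h \<in> S) (at_right 0)"
      proof eventually_elim
        case (elim h)
        have "0 \<le> \<phi> (Sup S)" using Sup by (auto simp: S_def)
        also have "\<dots> \<le> \<phi> (Sup S + h)" using elim by (simp add: \<phi>_def algebra_simps)
        finally show ?case using elim ge by (auto simp: S_def)
      qed
      then obtain h where "0 < h" "Sup S + h \<in> S"
        using eventually_happens'[OF trivial_limit_at_right_real] by blast
      then show False using cSup_upper[OF _ bdd] by fastforce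
    qed
    then show ?thesis using Sup by (simp add: S_def \<phi>_def)
  qed
  note * = this
  show ?thesis
  proof (rule field_le_epsilon)
    fix \<delta> :: real assume \<delta>: "0 < \<delta>"
    \<comment> \<open>The denominator T + 1 in place of T admits T = 0.\<close>
    have "(d - \<delta> / (T + 1)) * T \<le> w T - w 0" using \<delta> T by (intro *) auto
    moreover have "\<delta> / (T + 1) * T \<le> \<delta>" using \<delta> T by (simp add: field_simps)
    ultimately show "d * T \<le> w T - w 0 + \<delta>" by (simp add: algebra_simps)
  qed
qed

lemma space_I_borel [simp]: "space I_borel = {0..1}"
  by (simp add: I_borel_def space_restrict_space)

lemma measurable_I_borelI:
  assumes "f \<in> borel_measurable borel" shows "f \<in> borel_measurable I_borel"
  using assms by (simp add: I_borel_def measurable_restrict_space1)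

lemma sets_I_borel_iff: "A \<in> sets I_borel \<longleftrightarrow> A \<in> sets borel \<and> A \<subseteq> {0..1}"
  by (auto simp: I_borel_def sets_restrict_space_iff)

lemma F_I_iff: "f \<in> F_I \<longleftrightarrow> f \<in> borel_measurable I_borel \<and> (\<exists>B. \<forall>x\<in>{0..1}. \<bar>f x\<bar> \<le> B)"
  by (auto simp: F_I_def bounded_iff)

lemma F_I_I:
  assumes "f \<in> borel_measurable I_borel" "\<And>x. x \<in> {0..1} \<Longrightarrow> \<bar>f x\<bar> \<le> B"
  shows "f \<in> F_I"
  unfolding F_I_iff using assms by blast

lemma F_I_boundE:
  assumes "f \<in> F_I"
  obtains B where "0 \<le> B" "\<And>x. x \<in> {0..1} \<Longrightarrow> \<bar>f x\<bar> \<le> B"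
proof -
  obtain B where "\<forall>x\<in>{0..1}. \<bar>f x\<bar> \<le> B" using assms by (auto simp: F_I_iff)
  then show thesis by (intro that[of "\<bar>B\<bar>"]) fastforce+
qed

lemma F_I_measurable: "f \<in> F_I \<Longrightarrow> f \<in> borel_measurable I_borel"
  by (simp add: F_I_def)

lemma C_I_F_I: assumes "f \<in> C_I" shows "f \<in> F_I"
proof -
  have "bounded (f ` {0..1})"
    using assms by (auto simp: C_I_def intro!: compact_imp_bounded compact_continuous_image)
  moreover have "f \<in> borel_measurable I_borel"
    using assms unfolding C_I_def I_borel_def by (auto intro: borel_measurable_continuous_on_restrict)
  ultimately show ?thesis by (simp add: F_I_def)
qed

lemma const_C_I [simp]: "(\<lambda>_. k) \<in> C_I"
  by (simp add: C_I_def)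

lemma F_I_diff: assumes "f \<in> F_I" "g \<in> F_I" shows "(\<lambda>x. f x - g x) \<in> F_I"
proof -
  obtain B B' where "\<And>x. x \<in> {0..1} \<Longrightarrow> \<bar>f x\<bar> \<le> B" "\<And>x. x \<in> {0..1} \<Longrightarrow> \<bar>g x\<bar> \<le> B'"
    using F_I_boundE[OF assms(1)] F_I_boundE[OF assms(2)] by metis
  then have "\<bar>f x - g x\<bar> \<le> B + B'" if "x \<in> {0..1}" for x
    using that by (smt (verit))
  then show ?thesis using assms by (intro F_I_I[of _ "B + B'"]) (auto simp: F_I_def)
qed

lemma F_I_scale: assumes "f \<in> F_I" shows "(\<lambda>x. k * f x) \<in> F_I"
proof -
  obtain B where B: "0 \<le> B" "\<And>x. x \<in> {0..1} \<Longrightarrow> \<bar>f x\<bar> \<le> B"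
    using F_I_boundE[OF assms] by metis
  then have "\<bar>k * f x\<bar> \<le> \<bar>k\<bar> * B" if "x \<in> {0..1}" for x
    using that by (simp add: abs_mult mult_left_mono)
  then show ?thesis using assms by (intro F_I_I[of _ "\<bar>k\<bar> * B"]) (auto simp: F_I_def)
qed

lemma F_I_integrable:
  assumes "prob_space \<nu>" "sets \<nu> = sets I_borel" "f \<in> F_I"
  shows "integrable \<nu> f"
proof -
  interpret prob_space \<nu> by fact
  obtain B where B: "0 \<le> B" "\<And>x. x \<in> {0..1} \<Longrightarrow> \<bar>f x\<bar> \<le> B"
    using F_I_boundE[OF assms(3)] by metis
  have [measurable]: "f \<in> borel_measurable \<nu>"
    using F_I_measurable[OF assms(3)] assms(2) by (simp cong: measurable_cong_sets)
  show ?thesis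
    by (rule integrable_const_bound[of _ B])
      (use B sets_eq_imp_space_eq[OF assms(2)] in auto)
qed

lemma F_I_integral_abs_le:
  assumes "prob_space \<nu>" "sets \<nu> = sets I_borel" "f \<in> F_I" "\<And>x. x \<in> {0..1} \<Longrightarrow> \<bar>f x\<bar> \<le> B"
  shows "\<bar>\<integral>x. f x \<partial>\<nu>\<bar> \<le> B"
proof -
  interpret prob_space \<nu> by fact
  have "norm (\<integral>x. f x \<partial>\<nu>) \<le> (\<integral>x. norm (f x) \<partial>\<nu>)" by (rule integral_norm_bound)
  also have "\<dots> \<le> (\<integral>x. B \<partial>\<nu>)"
    using F_I_integrable[OF assms(1-3)] sets_eq_imp_space_eq[OF assms(2)] assms(4)
    by (intro integral_mono) auto
  finally show ?thesis by (simp add: prob_space)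
qed

lemma uniform_limit_eventually_le:
  fixes f :: "real \<Rightarrow> real \<Rightarrow> real"
  assumes "uniform_limit {0..1} f l F" "0 < e"
  shows "eventually (\<lambda>h. \<forall>x\<in>{0..1}. \<bar>f h x - l x\<bar> \<le> e) F"
  using uniform_limitD[OF assms] by eventually_elim (auto simp: dist_real_def less_imp_le)

lemma rational_within:
  fixes r t \<delta> :: real
  assumes "r \<in> {0..t}" "0 < t" "0 < \<delta>"
  obtains q where "q \<in> \<rat> \<inter> {0..t}" "\<bar>q - r\<bar> < \<delta>"
proof -
  have "max 0 (r - \<delta>) < min t (r + \<delta>)" using assms by auto
  then obtain q where "q \<in> \<rat>" "max 0 (r - \<delta>) < q" "q < min t (r + \<delta>)"
    using Rats_dense_in_real by blast
  then show thesis by (intro that[of q]) auto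
qed

text \<open>The differential expression describes the generator in the interior only; density of the
  interior carries identities between continuous functions to the endpoints.\<close>

lemma C_I_eqI:
  assumes "f \<in> C_I" "g \<in> C_I" "\<And>x. x \<in> {0<..<1} \<Longrightarrow> f x = g x" "x \<in> {0..1}"
  shows "f x = g x"
proof -
  have cl: "closure {0<..<1::real} = {0..1}" by simp
  have "continuous_on (closure {0<..<1}) (\<lambda>x. f x - g x)"
    unfolding cl using assms(1,2) by (simp add: C_I_def continuous_on_diff)
  from continuous_constant_on_closure[OF this, of 0 x] assms(3,4) show ?thesis
    unfolding cl by simp
qed

text \<open>The sets \<open>{y..1}\<close> are chosen because the averaging operator has an explicit
  value on their indicators. Increasing unions lead to \<open>{x<..1}\<close>, and the pushforward
  to the whole line is determined by its values on open rays.\<close>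

lemma measure_I_eqI:
  assumes M: "finite_measure M" "sets M = sets I_borel" and N: "sets N = sets I_borel"
    and eq: "\<And>y. y \<in> {0..<1} \<Longrightarrow> emeasure M {y..1} = emeasure N {y..1}"
  shows "M = N"
proof -
  have id: "(\<lambda>x. x) \<in> K \<rightarrow>\<^sub>M borel" if "sets K = sets I_borel" for K
    using measurable_I_borelI[of "\<lambda>x. x"] that by (simp cong: measurable_cong_sets)
  have sp: "space M = {0..1}" "space N = {0..1}"
    using sets_eq_imp_space_eq[OF M(2)] sets_eq_imp_space_eq[OF N] by simp_all
  have Ioc: "emeasure M {x<..1} = emeasure N {x<..1}" if x: "x \<in> {0..<1}" for x
  proof -
    \<comment> \<open>\<open>Suc (Suc n)\<close> makes the factor at most 1/2, so the left ends lie
      strictly between x and 1, where the hypothesis applies.\<close>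
    define A where "A n = {x + (1 - x) * inverse (real (Suc (Suc n)))..1}" for n
    have inv: "inverse (real (Suc (Suc n))) < 1" "0 < inverse (real (Suc (Suc n)))" for n
      by (rule inverse_less_1_iff[THEN iffD2]) simp_all
    have pt: "x < x + (1 - x) * inverse (real (Suc (Suc n)))" "x + (1 - x) * inverse (real (Suc (Suc n))) < 1" for n
    proof -
      show "x < x + (1 - x) * inverse (real (Suc (Suc n)))" using x inv(2)[of n] by simp
      have "(1 - x) * inverse (real (Suc (Suc n))) < (1 - x) * 1" using x inv(1)[of n] by (intro mult_strict_left_mono) auto
      then show "x + (1 - x) * inverse (real (Suc (Suc n))) < 1" by simp
    qed
    have "incseq A"
    proof (rule incseq_SucI)
      fix n
      have "inverse (real (Suc (Suc (Suc n)))) \<le> inverse (real (Suc (Suc n)))" by (rule le_imp_inverse_le) simp_all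
      then have "(1 - x) * inverse (real (Suc (Suc (Suc n)))) \<le> (1 - x) * inverse (real (Suc (Suc n)))"
        using x by (intro mult_left_mono) auto
      then show "A n \<le> A (Suc n)" by (auto simp: A_def)
    qed
    have Un: "(\<Union>n. A n) = {x<..1}"
    proof (intro equalityI subsetI)
      fix z assume "z \<in> (\<Union>n. A n)"
      then obtain n where "x + (1 - x) * inverse (real (Suc (Suc n))) \<le> z" "z \<le> 1" by (auto simp: A_def)
      then show "z \<in> {x<..1}" using pt(1)[of n] by simp
    next
      fix z assume z: "z \<in> {x<..1}"
      have "(\<lambda>n. x + (1 - x) * inverse (real (Suc (Suc n)))) \<longlonglongrightarrow> x + (1 - x) * 0"
        by (intro tendsto_intros LIMSEQ_Suc[OF LIMSEQ_inverse_real_of_nat])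
      then have "eventually (\<lambda>n. x + (1 - x) * inverse (real (Suc (Suc n))) < z) sequentially"
        by (rule order_tendstoD(2)) (use z in simp)
      then obtain n where "x + (1 - x) * inverse (real (Suc (Suc n))) < z"
        using eventually_happens'[OF sequentially_bot] by blast
      then show "z \<in> (\<Union>n. A n)" using z by (auto simp: A_def intro!: exI[of _ n])
    qed
    have A: "A n \<in> sets I_borel" for n
      using pt(1)[of n] x by (auto simp: A_def sets_I_borel_iff)
    have "emeasure M (A n) = emeasure N (A n)" for n
      unfolding A_def using pt[of n] x by (intro eq) simp
    moreover have "(\<lambda>n. emeasure M (A n)) \<longlonglongrightarrow> emeasure M {x<..1}" "(\<lambda>n. emeasure N (A n)) \<longlonglongrightarrow> emeasure N {x<..1}"
      unfolding Un[symmetric] using A \<open>incseq A\<close> M(2) N by (intro Lim_emeasure_incseq; auto)+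
    ultimately show ?thesis by (simp add: LIMSEQ_unique)
  qed
  have em: "emeasure (distr K borel (\<lambda>x. x)) {x<..} = (if x < 0 then emeasure K {0..1} else if x < 1 then emeasure K {x<..1} else 0)"
    if K: "sets K = sets I_borel" "space K = {0..1}" for K x
  proof -
    have "emeasure (distr K borel (\<lambda>x. x)) {x<..} = emeasure K ({x<..} \<inter> {0..1})"
      using emeasure_distr[OF id[OF K(1)], of "{x<..}"] by (simp add: K(2))
    moreover have "{x<..} \<inter> {0..1} = (if x < 0 then {0..1} else if x < 1 then {x<..1} else {})" by auto
    ultimately show ?thesis by simp
  qed
  interpret M: finite_measure M by fact
  have "distr M borel (\<lambda>x. x) = distr N borel (\<lambda>x. x)"
  proof (rule measure_eqI_lessThan)
    show "emeasure (distr M borel (\<lambda>x. x)) {x<..} < \<infinity>" for x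
      by (simp add: em[OF M(2) sp(1)] M.emeasure_finite less_top[symmetric])
    show "emeasure (distr M borel (\<lambda>x. x)) {x<..} = emeasure (distr N borel (\<lambda>x. x)) {x<..}" for x
      using eq[of 0] Ioc[of x] by (simp add: em[OF M(2) sp(1)] em[OF N sp(2)])
  qed simp_all
  then have d: "emeasure (distr M borel (\<lambda>x. x)) A = emeasure (distr N borel (\<lambda>x. x)) A" for A by simp
  show ?thesis
  proof (rule measure_eqI)
    fix A assume "A \<in> sets M"
    then have "A \<in> sets borel" "A \<subseteq> {0..1}" by (simp_all add: M(2) sets_I_borel_iff)
    then show "emeasure M A = emeasure N A"
      using d[of A] emeasure_distr[OF id[OF M(2)], of A] emeasure_distr[OF id[OF N], of A]
      by (simp add: sp Int_absorb2)
  qed (simp add: M(2) N)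
qed

section \<open>Feller semigroups\<close>

context feller_diffusion
begin

lemma kernel_prob_space:
  assumes "x \<in> {0..1}" shows "prob_space (Q x)" "sets (Q x) = sets \<Omega>" "space (Q x) = space \<Omega>"
proof -
  have "Q x \<in> space (prob_algebra \<Omega>)"
    using measurable_space[OF kernel] assms by simp
  then show "prob_space (Q x)" "sets (Q x) = sets \<Omega>" by (auto simp: space_prob_algebra)
  then show "space (Q x) = space \<Omega>" using sets_eq_imp_space_eq by blast
qed

lemma kernel_subprob: "Q \<in> I_borel \<rightarrow>\<^sub>M subprob_algebra \<Omega>"
  by (rule measurable_prob_algebraD[OF kernel])

lemma X_measurable_kernel:
  assumes "x \<in> {0..1}" "0 \<le> t" shows "X t \<in> Q x \<rightarrow>\<^sub>M I_borel"
  using X_measurable[OF assms(2)] kernel_prob_space[OF assms(1)] by (simp cong: measurable_cong_sets)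

lemma X_range: assumes "0 \<le> t" "\<omega> \<in> space \<Omega>" shows "X t \<omega> \<in> {0..1}"
  using measurable_space[OF X_measurable[OF assms(1)] assms(2)] by simp

section \<open>Transition operators\<close>

definition trans_law :: "real \<Rightarrow> real \<Rightarrow> real measure" where
  "trans_law t x = distr (Q x) I_borel (X t)"

lemma trans_law:
  assumes "x \<in> {0..1}" "0 \<le> t"
  shows "prob_space (trans_law t x)" "sets (trans_law t x) = sets I_borel"
  using kernel_prob_space(1)[OF assms(1)] X_measurable_kernel[OF assms]
  by (auto simp: trans_law_def prob_space.prob_space_distr)

lemma P_op_eq:
  assumes "x \<in> {0..1}" "0 \<le> t" "f \<in> borel_measurable I_borel"
  shows "P_op Q X t f x = (\<integral>y. f y \<partial>trans_law t x)"
  unfolding P_op_def trans_law_def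
  by (rule integral_distr[symmetric, OF X_measurable_kernel[OF assms(1,2)] assms(3)])

lemma P_op_abs_le:
  assumes "x \<in> {0..1}" "0 \<le> t" "f \<in> F_I" "\<And>y. y \<in> {0..1} \<Longrightarrow> \<bar>f y\<bar> \<le> B"
  shows "\<bar>P_op Q X t f x\<bar> \<le> B"
  using F_I_integral_abs_le[OF trans_law[OF assms(1,2)] assms(3,4)]
    P_op_eq[OF assms(1,2) F_I_measurable[OF assms(3)]] by simp

lemma P_op_diff:
  assumes "x \<in> {0..1}" "0 \<le> t" "f \<in> F_I" "g \<in> F_I"
  shows "P_op Q X t (\<lambda>y. f y - g y) x = P_op Q X t f x - P_op Q X t g x"
proof -
  note * = F_I_integrable[OF trans_law[OF assms(1,2)]]
  show ?thesis
    using assms(1,2) F_I_measurable[OF assms(3)] F_I_measurable[OF assms(4)] *[OF assms(3)] *[OF assms(4)]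
    by (simp add: P_op_eq)
qed

lemma P_op_scale: "P_op Q X t (\<lambda>y. k * f y) x = k * P_op Q X t f x"
  by (simp add: P_op_def)

lemma P_op_const:
  assumes "x \<in> {0..1}" "0 \<le> t" shows "P_op Q X t (\<lambda>_. k) x = k"
  using prob_space.prob_space[OF kernel_prob_space(1)[OF assms(1)]] by (simp add: P_op_def)

lemma P_op_mono:
  assumes "x \<in> {0..1}" "0 \<le> t" "f \<in> F_I" "g \<in> F_I" "\<And>y. y \<in> {0..1} \<Longrightarrow> f y \<le> g y"
  shows "P_op Q X t f x \<le> P_op Q X t g x"
  unfolding P_op_eq[OF assms(1,2) F_I_measurable[OF assms(3)]]
    P_op_eq[OF assms(1,2) F_I_measurable[OF assms(4)]]
  by (intro integral_mono F_I_integrable[OF trans_law[OF assms(1,2)]] assms)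
    (use sets_eq_imp_space_eq[OF trans_law(2)[OF assms(1,2)]] assms(5) in auto)

lemma P_op_cong:
  assumes "x \<in> {0..1}" "0 \<le> t" "\<And>y. y \<in> {0..1} \<Longrightarrow> f y = g y"
  shows "P_op Q X t f x = P_op Q X t g x"
  unfolding P_op_def
  by (intro Bochner_Integration.integral_cong refl)
    (use assms(3) X_range[OF assms(2)] kernel_prob_space(3)[OF assms(1)] in auto)

lemma P_op_F_I: assumes "0 \<le> t" "f \<in> F_I" shows "P_op Q X t f \<in> F_I"
proof -
  obtain B where B: "0 \<le> B" "\<And>x. x \<in> {0..1} \<Longrightarrow> \<bar>f x\<bar> \<le> B"
    using F_I_boundE[OF assms(2)] by metis
  have "(\<lambda>\<omega>. f (X t \<omega>)) \<in> borel_measurable \<Omega>"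
    by (rule measurable_compose[OF X_measurable[OF assms(1)] F_I_measurable[OF assms(2)]])
  from measurable_compose[OF kernel_subprob integral_measurable_subprob_algebra[OF this]]
  have "P_op Q X t f \<in> borel_measurable I_borel" by (simp add: P_op_def[abs_def])
  then show ?thesis
    by (rule F_I_I[of _ B]) (rule P_op_abs_le[OF _ assms B(2)])
qed

lemma P_op_tendsto:
  assumes "x \<in> {0..1}" "0 \<le> t" "\<And>n. f n \<in> F_I" "g \<in> borel_measurable I_borel"
    and "\<And>n y. y \<in> {0..1} \<Longrightarrow> \<bar>f n y\<bar> \<le> B" "\<And>y. y \<in> {0..1} \<Longrightarrow> (\<lambda>n. f n y) \<longlonglongrightarrow> g y"
  shows "(\<lambda>n. P_op Q X t (f n) x) \<longlonglongrightarrow> P_op Q X t g x"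
proof -
  interpret prob_space "trans_law t x" by (rule trans_law[OF assms(1,2)])
  note sets = trans_law(2)[OF assms(1,2)]
  have sp: "space (trans_law t x) = {0..1}" using sets_eq_imp_space_eq[OF sets] by simp
  have "(\<lambda>n. \<integral>y. f n y \<partial>trans_law t x) \<longlonglongrightarrow> (\<integral>y. g y \<partial>trans_law t x)"
    by (rule integral_dominated_convergence[where w="\<lambda>_. B"])
      (use assms F_I_measurable[OF assms(3)] in \<open>auto simp: sp sets cong: measurable_cong_sets\<close>)
  then show ?thesis
    using P_op_eq[OF assms(1,2)] F_I_measurable[OF assms(3)] assms(4) by simp
qed

lemma P_op_0:
  assumes "x \<in> {0..1}" "f \<in> F_I" shows "P_op Q X 0 f x = f x"
proof -
  interpret prob_space "Q x" by (rule kernel_prob_space[OF assms(1)])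
  have "(\<integral>\<omega>. f (X 0 \<omega>) \<partial>Q x) = (\<integral>\<omega>. f x \<partial>Q x)"
    using start[OF assms(1)] measurable_compose[OF X_measurable_kernel[OF assms(1)] F_I_measurable[OF assms(2)], of 0]
    by (intro integral_cong_AE) auto
  then show ?thesis by (simp add: P_op_def prob_space)
qed

section \<open>Markov property and semigroup law\<close>

lemma nat_filtration_subalgebra:
  assumes "x \<in> {0..1}" shows "subalgebra (Q x) (nat_filtration \<Omega> X t)"
proof -
  have *: "(\<Union>u\<in>{0..t}. {X u -` B \<inter> space \<Omega> | B. B \<in> sets I_borel}) \<subseteq> sets \<Omega>"
    using measurable_sets[OF X_measurable] by auto
  then have "sigma_sets (space \<Omega>) (\<Union>u\<in>{0..t}. {X u -` B \<inter> space \<Omega> | B. B \<in> sets I_borel}) \<subseteq> sets \<Omega>"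
    by (rule sets.sigma_sets_subset)
  moreover have "(\<Union>u\<in>{0..t}. {X u -` B \<inter> space \<Omega> | B. B \<in> sets I_borel}) \<subseteq> Pow (space \<Omega>)"
    by auto
  ultimately show ?thesis
    by (simp add: subalgebra_def nat_filtration_def kernel_prob_space[OF assms])
qed

lemma X_vimage_nat_filtration:
  assumes "0 \<le> u" "u \<le> t" "B \<in> sets I_borel"
  shows "X u -` B \<inter> space \<Omega> \<in> sets (nat_filtration \<Omega> X t)"
proof -
  have "(\<Union>u\<in>{0..t}. {X u -` B \<inter> space \<Omega> | B. B \<in> sets I_borel}) \<subseteq> Pow (space \<Omega>)" by auto
  moreover have "X u -` B \<inter> space \<Omega> \<in> (\<Union>u\<in>{0..t}. {X u -` B \<inter> space \<Omega> | B. B \<in> sets I_borel})"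
    using assms by (intro UN_I[of u]) auto
  ultimately show ?thesis unfolding nat_filtration_def by (rule in_measure_of)
qed

text \<open>The defining property of conditional expectation turns the almost sure Markov identity
  into one between integrals over past events. The semigroup law is the case of the whole space; the
  stopping estimate needs a general A.\<close>

lemma markov_set_integral:
  assumes x: "x \<in> {0..1}" and t: "0 \<le> t" "0 \<le> u" and f: "f \<in> F_I"
    and A: "A \<in> sets (nat_filtration \<Omega> X t)"
  shows "(\<integral>\<omega>\<in>A. f (X (t + u) \<omega>) \<partial>Q x) = (\<integral>\<omega>\<in>A. P_op Q X u f (X t \<omega>) \<partial>Q x)"
proof -
  interpret prob_space "Q x" by (rule kernel_prob_space[OF x])
  note sub = nat_filtration_subalgebra[OF x, of t]
  interpret finite_measure_subalgebra "Q x" "nat_filtration \<Omega> X t"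
    by unfold_locales (rule sub)
  have "A \<in> sets (Q x)" using A sub by (auto simp: subalgebra_def)
  have int: "integrable (Q x) (\<lambda>\<omega>. f (X (t + u) \<omega>))"
    using F_I_integrable[OF trans_law[OF x, of "t + u"] f] t
      integrable_distr[OF X_measurable_kernel[OF x, of "t + u"], of f] by (simp add: trans_law_def)
  have "(\<lambda>\<omega>. P_op Q X u f (X t \<omega>)) \<in> borel_measurable (Q x)"
    by (rule measurable_compose[OF X_measurable_kernel[OF x t(1)] F_I_measurable[OF P_op_F_I[OF t(2) f]]])
  then show ?thesis
    unfolding real_cond_exp_intA[OF int A]
    using markov[OF x t f] \<open>A \<in> sets (Q x)\<close>
    by (intro set_lebesgue_integral_cong_AE) auto
qed

lemma P_op_add:
  assumes "x \<in> {0..1}" "0 \<le> t" "0 \<le> u" "f \<in> F_I"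
  shows "P_op Q X (t + u) f x = P_op Q X t (P_op Q X u f) x"
proof -
  have sp: "space (nat_filtration \<Omega> X t) = space (Q x)"
    using nat_filtration_subalgebra[OF assms(1), of t] by (simp add: subalgebra_def)
  have "space (Q x) \<in> sets (nat_filtration \<Omega> X t)"
    unfolding sp[symmetric] by (rule sets.top)
  from markov_set_integral[OF assms this] show ?thesis
    unfolding P_op_def[of Q X "t + u"] P_op_def[of Q X t] set_lebesgue_integral_def
    by (subst (asm) (1 2) Bochner_Integration.integral_cong[OF refl]) auto
qed

section \<open>The generator and continuity in time\<close>

lemma gen_dom_C_I: "f \<in> gen_dom Q X \<Longrightarrow> f \<in> C_I"
  by (simp add: gen_dom_def)

lemma genI:
  assumes "g \<in> C_I" "uniform_limit {0..1} (\<lambda>t x. (P_op Q X t f x - f x) / t) g (at_right 0)" "x \<in> {0..1}"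
  shows "gen Q X f x = g x"
  unfolding gen_def
  by (intro tendsto_Lim tendsto_uniform_limitI[OF assms(2,3)]) simp

lemma gen_uniform_limit:
  assumes "f \<in> gen_dom Q X"
  shows "gen Q X f \<in> C_I"
    "uniform_limit {0..1} (\<lambda>t x. (P_op Q X t f x - f x) / t) (gen Q X f) (at_right 0)"
proof -
  obtain g where g: "g \<in> C_I" "uniform_limit {0..1} (\<lambda>t x. (P_op Q X t f x - f x) / t) g (at_right 0)"
    using assms by (auto simp: gen_dom_def)
  note * = genI[OF g]
  have "continuous_on {0..1} (gen Q X f) \<longleftrightarrow> continuous_on {0..1} g"
    using * by (intro continuous_on_cong) auto
  then show "gen Q X f \<in> C_I" using g(1) by (simp add: C_I_def)
  show "uniform_limit {0..1} (\<lambda>t x. (P_op Q X t f x - f x) / t) (gen Q X f) (at_right 0)"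
    using g(2) * by (subst uniform_limit_cong') auto
qed

lemma gen_increment_le:
  assumes f: "f \<in> gen_dom Q X" and e: "0 < e"
  shows "eventually (\<lambda>h. \<forall>x\<in>{0..1}. \<bar>P_op Q X h f x - f x - h * gen Q X f x\<bar> \<le> e * h) (at_right 0)"
  using uniform_limit_eventually_le[OF gen_uniform_limit(2)[OF f] e] eventually_at_right_less[of "0::real"]
proof eventually_elim
  case (elim h)
  have "P_op Q X h f x - f x - h * gen Q X f x = h * ((P_op Q X h f x - f x) / h - gen Q X f x)" for x
    using elim by (simp add: field_simps)
  then have "\<bar>P_op Q X h f x - f x - h * gen Q X f x\<bar> = h * \<bar>(P_op Q X h f x - f x) / h - gen Q X f x\<bar>" for x
    using elim by (simp add: abs_mult)
  then show ?case using elim by (simp add: mult.commute)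
qed

text \<open>The operator P_r commutes with the difference quotients and is a contraction in the
  supremum norm, so it carries their uniform limit along.\<close>

lemma gen_dom_P_op:
  assumes f: "f \<in> gen_dom Q X" and r: "0 \<le> r"
  shows "P_op Q X r f \<in> gen_dom Q X"
    "x \<in> {0..1} \<Longrightarrow> gen Q X (P_op Q X r f) x = P_op Q X r (gen Q X f) x"
proof -
  note fF = C_I_F_I[OF gen_dom_C_I[OF f]] and gF = C_I_F_I[OF gen_uniform_limit(1)[OF f]]
  have lim: "uniform_limit {0..1} (\<lambda>t x. (P_op Q X t (P_op Q X r f) x - P_op Q X r f x) / t)
      (P_op Q X r (gen Q X f)) (at_right 0)"
  proof (rule uniform_limitI)
    fix e :: real assume e: "0 < e"
    have "eventually (\<lambda>h. \<forall>x\<in>{0..1}. \<bar>(P_op Q X h f x - f x) / h - gen Q X f x\<bar> \<le> e / 2) (at_right 0)"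
      by (rule uniform_limit_eventually_le[OF gen_uniform_limit(2)[OF f]]) (use e in simp)
    with eventually_at_right_less[of "0::real"]
    show "eventually (\<lambda>h. \<forall>x\<in>{0..1}. dist ((P_op Q X h (P_op Q X r f) x - P_op Q X r f x) / h)
        (P_op Q X r (gen Q X f) x) < e) (at_right 0)"
    proof (eventually_elim, intro ballI)
      fix h x :: real
      assume h: "0 < h" and le: "\<forall>x\<in>{0..1}. \<bar>(P_op Q X h f x - f x) / h - gen Q X f x\<bar> \<le> e / 2"
        and x: "x \<in> {0..1}"
      have hF: "P_op Q X h f \<in> F_I" using h by (intro P_op_F_I fF) auto
      have dF: "(\<lambda>y. inverse h * (P_op Q X h f y - f y)) \<in> F_I" by (intro F_I_scale F_I_diff hF fF)
      have "P_op Q X h (P_op Q X r f) x = P_op Q X r (P_op Q X h f) x"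
        using P_op_add[OF x _ _ fF, of h r] P_op_add[OF x _ _ fF, of r h] h r by (simp add: add.commute)
      then have "(P_op Q X h (P_op Q X r f) x - P_op Q X r f x) / h - P_op Q X r (gen Q X f) x
          = P_op Q X r (\<lambda>y. inverse h * (P_op Q X h f y - f y) - gen Q X f y) x"
        unfolding P_op_diff[OF x r dF gF] P_op_scale P_op_diff[OF x r hF fF]
        by (simp add: divide_inverse mult.commute)
      also have "\<bar>\<dots>\<bar> \<le> e / 2"
        using le by (intro P_op_abs_le[OF x r] F_I_diff[OF dF gF]) (simp add: field_simps)
      finally show "dist ((P_op Q X h (P_op Q X r f) x - P_op Q X r f x) / h) (P_op Q X r (gen Q X f) x) < e"
        using e by (simp add: dist_real_def)
    qed
  qed
  have PC: "P_op Q X r (gen Q X f) \<in> C_I" by (intro feller r gen_uniform_limit f)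
  show "P_op Q X r f \<in> gen_dom Q X"
    unfolding gen_dom_def using lim PC feller[OF r gen_dom_C_I[OF f]] by blast
  show "gen Q X (P_op Q X r f) x = P_op Q X r (gen Q X f) x" if "x \<in> {0..1}"
    by (rule genI[OF PC lim that])
qed

text \<open>By the semigroup law and contractivity the increment from r to r' is no larger than that
  from 0 to r' - r; this makes \<delta> independent of both r and x.\<close>

lemma P_op_time_increment:
  assumes f: "f \<in> C_I" and e: "0 < e"
  obtains \<delta> where "0 < \<delta>"
    "\<And>r r' x. \<lbrakk>0 \<le> r; 0 \<le> r'; \<bar>r - r'\<bar> < \<delta>; x \<in> {0..1}\<rbrakk> \<Longrightarrow> \<bar>P_op Q X r f x - P_op Q X r' f x\<bar> \<le> e"
proof -
  note fF = C_I_F_I[OF f]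
  obtain \<delta> where \<delta>: "0 < \<delta>" and le: "\<And>h x. \<lbrakk>0 < h; h < \<delta>; x \<in> {0..1}\<rbrakk> \<Longrightarrow> \<bar>P_op Q X h f x - f x\<bar> \<le> e"
    using uniform_limit_eventually_le[OF strongly_continuous[OF f] e]
    by (auto simp: eventually_at_right_field)
  have *: "\<bar>P_op Q X r f x - P_op Q X r' f x\<bar> \<le> e" if "0 \<le> r" "r \<le> r'" "r' - r < \<delta>" "x \<in> {0..1}" for r r' x
  proof (cases "r = r'")
    case False
    have hF: "P_op Q X (r' - r) f \<in> F_I" using that by (intro P_op_F_I fF) auto
    have "P_op Q X r' f x - P_op Q X r f x = P_op Q X r (\<lambda>y. P_op Q X (r' - r) f y - f y) x"
      using P_op_add[OF that(4), of r "r' - r" f] P_op_diff[OF that(4,1) hF fF] that fF by simp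
    also have "\<bar>\<dots>\<bar> \<le> e" using that False by (intro P_op_abs_le F_I_diff hF fF le) auto
    finally show ?thesis by (simp add: abs_minus_commute)
  qed (use e in simp)
  show thesis
  proof (rule that[OF \<delta>])
    fix r r' x :: real assume "0 \<le> r" "0 \<le> r'" "\<bar>r - r'\<bar> < \<delta>" "x \<in> {0..1}"
    then show "\<bar>P_op Q X r f x - P_op Q X r' f x\<bar> \<le> e"
      using *[of r r' x] *[of r' r x] by (cases "r \<le> r'") (auto simp: abs_minus_commute)
  qed
qed

lemma P_op_continuous_time:
  assumes "f \<in> C_I" "x \<in> {0..1}"
  shows "continuous_on {0..} (\<lambda>r. P_op Q X r f x)"
  unfolding continuous_on_iff
proof (intro ballI allI impI)
  fix r e :: real assume r: "r \<in> {0..}" and e: "0 < e"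
  obtain \<delta> where \<delta>0: "0 < \<delta>" and \<delta>:
    "\<And>r r' x. \<lbrakk>0 \<le> r; 0 \<le> r'; \<bar>r - r'\<bar> < \<delta>; x \<in> {0..1}\<rbrakk> \<Longrightarrow> \<bar>P_op Q X r f x - P_op Q X r' f x\<bar> \<le> e / 2"
    using P_op_time_increment[OF assms(1), of "e / 2"] e by auto
  then show "\<exists>d>0. \<forall>r'\<in>{0..}. dist r' r < d \<longrightarrow> dist (P_op Q X r' f x) (P_op Q X r f x) < e"
  proof (intro exI[of _ \<delta>] conjI ballI impI)
    fix r' assume "r' \<in> {0..}" "dist r' r < \<delta>"
    then have "\<bar>P_op Q X r' f x - P_op Q X r f x\<bar> \<le> e / 2"
      using r assms(2) by (intro \<delta>) (auto simp: dist_real_def)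
    then show "dist (P_op Q X r' f x) (P_op Q X r f x) < e" using e by (simp add: dist_real_def)
  qed (rule \<delta>0)
qed

text \<open>An inequality form of Dynkin's formula, P_t f - f being the integral of P_r A f over r
  in [0,t]. It follows from the bound on right derivatives, without integrating in time.\<close>

lemma P_op_increment_ge:
  assumes f: "f \<in> gen_dom Q X" and x: "x \<in> {0..1}" and t: "0 \<le> t"
    and d: "\<And>r. \<lbrakk>0 \<le> r; r < t\<rbrakk> \<Longrightarrow> P_op Q X r (gen Q X f) x \<ge> d"
  shows "P_op Q X t f x - f x \<ge> d * t"
proof -
  have "P_op Q X t f x - P_op Q X 0 f x \<ge> d * t"
  proof (rule lower_right_derivative_bound)
    show "continuous_on {0..t} (\<lambda>r. P_op Q X r f x)"
      by (rule continuous_on_subset[OF P_op_continuous_time[OF gen_dom_C_I[OF f] x]]) auto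
    fix r e :: real assume r: "0 \<le> r" "r < t" and e: "0 < e"
    note fF = C_I_F_I[OF gen_dom_C_I[OF f]]
    show "eventually (\<lambda>h. P_op Q X (r + h) f x - P_op Q X r f x \<ge> (d - e) * h) (at_right 0)"
      using gen_increment_le[OF gen_dom_P_op(1)[OF f r(1)] e] eventually_at_right_less[of "0::real"]
    proof eventually_elim
      case (elim h)
      have "P_op Q X (r + h) f x = P_op Q X h (P_op Q X r f) x"
        using P_op_add[OF x, of h r f] elim r fF by (simp add: add.commute)
      moreover have "d * h \<le> gen Q X (P_op Q X r f) x * h"
        using d[OF r] elim gen_dom_P_op(2)[OF f r(1) x] by (intro mult_right_mono) auto
      ultimately show ?case using elim(1)[rule_format, OF x] by (simp add: algebra_simps abs_le_iff)
    qed
  qed (rule t)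
  then show ?thesis by (simp add: P_op_0[OF x C_I_F_I[OF gen_dom_C_I[OF f]]])
qed

lemma gen_dom_scale:
  assumes "f \<in> gen_dom Q X" shows "(\<lambda>x. k * f x) \<in> gen_dom Q X"
proof -
  have "uniform_limit {0..1} (\<lambda>t x. k * ((P_op Q X t f x - f x) / t)) (\<lambda>x. k * gen Q X f x) (at_right 0)"
    by (rule bounded_linear.uniform_limit[OF bounded_linear_mult_right gen_uniform_limit(2)[OF assms]])
  then have "uniform_limit {0..1} (\<lambda>t x. (P_op Q X t (\<lambda>x. k * f x) x - k * f x) / t) (\<lambda>x. k * gen Q X f x) (at_right 0)"
    by (simp only: P_op_scale times_divide_eq_right right_diff_distrib)
  moreover have "(\<lambda>x. k * gen Q X f x) \<in> C_I" "(\<lambda>x. k * f x) \<in> C_I"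
    using gen_uniform_limit(1)[OF assms] gen_dom_C_I[OF assms] by (simp_all add: C_I_def continuous_on_mult_left)
  ultimately show ?thesis unfolding gen_dom_def by blast
qed

text \<open>Constants are invariant under the semigroup, so complements of step functions stay in
  the domain; they become the bumps at 0.\<close>

lemma gen_dom_one_minus:
  assumes "f \<in> gen_dom Q X" shows "(\<lambda>x. 1 - f x) \<in> gen_dom Q X"
proof -
  note fF = C_I_F_I[OF gen_dom_C_I[OF assms]]
  have "uniform_limit {0..1} (\<lambda>t x. (-1) * ((P_op Q X t f x - f x) / t)) (\<lambda>x. (-1) * gen Q X f x) (at_right 0)"
    by (rule bounded_linear.uniform_limit[OF bounded_linear_mult_right gen_uniform_limit(2)[OF assms]])
  moreover have "eventually (\<lambda>t. \<forall>x\<in>{0..1}. (-1) * ((P_op Q X t f x - f x) / t)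
      = (P_op Q X t (\<lambda>x. 1 - f x) x - (1 - f x)) / t) (at_right 0)"
    using eventually_at_right_less[of "0::real"]
  proof (eventually_elim, intro ballI)
    fix t x :: real assume t: "0 < t" and x: "x \<in> {0..1}"
    show "(-1) * ((P_op Q X t f x - f x) / t) = (P_op Q X t (\<lambda>x. 1 - f x) x - (1 - f x)) / t"
      using t by (simp add: P_op_diff[OF x less_imp_le[OF t] C_I_F_I[OF const_C_I] fF] P_op_const[OF x less_imp_le[OF t]]
          diff_divide_distrib)
  qed
  ultimately have "uniform_limit {0..1} (\<lambda>t x. (P_op Q X t (\<lambda>x. 1 - f x) x - (1 - f x)) / t) (\<lambda>x. (-1) * gen Q X f x) (at_right 0)"
    by (subst (asm) uniform_limit_cong) auto
  moreover have "(\<lambda>x. (-1) * gen Q X f x) \<in> C_I" "(\<lambda>x. 1 - f x) \<in> C_I"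
    using gen_uniform_limit(1)[OF assms] gen_dom_C_I[OF assms]
    by (simp_all add: C_I_def continuous_on_minus continuous_on_diff)
  ultimately show ?thesis unfolding gen_dom_def by blast
qed

subsection \<open>Hitting an absorbing endpoint\<close>

lemma bind_prob_space:
  assumes "\<mu> \<in> space (prob_algebra I_borel)"
  shows "prob_space (\<mu> \<bind> Q)" "sets (\<mu> \<bind> Q) = sets \<Omega>" "space (\<mu> \<bind> Q) = space \<Omega>"
proof -
  show "prob_space (\<mu> \<bind> Q)" by (rule prob_space_bind'[OF assms kernel])
  show "sets (\<mu> \<bind> Q) = sets \<Omega>" by (rule sets_bind'[OF assms kernel])
  then show "space (\<mu> \<bind> Q) = space \<Omega>" by (rule sets_eq_imp_space_eq)
qed

lemma law_at:
  assumes "\<mu> \<in> space (prob_algebra I_borel)" "0 \<le> t"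
  shows "prob_space (law_at Q X \<mu> t)" "sets (law_at Q X \<mu> t) = sets I_borel"
    "space (law_at Q X \<mu> t) = {0..1}"
proof -
  have "X t \<in> (\<mu> \<bind> Q) \<rightarrow>\<^sub>M I_borel"
    using X_measurable[OF assms(2)] bind_prob_space[OF assms(1)] by (simp cong: measurable_cong_sets)
  then show "prob_space (law_at Q X \<mu> t)"
    unfolding law_at_def by (rule prob_space.prob_space_distr[OF bind_prob_space(1)[OF assms(1)]])
qed (simp_all add: law_at_def)

lemma integral_law_at:
  assumes \<mu>: "\<mu> \<in> space (prob_algebra I_borel)" and t: "0 \<le> t" and f: "f \<in> F_I"
  shows "(\<integral>x. f x \<partial>law_at Q X \<mu> t) = (\<integral>x. P_op Q X t f x \<partial>\<mu>)"
proof -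
  interpret \<mu>: prob_space \<mu> using \<mu> by (simp add: space_prob_algebra)
  have sets: "sets \<mu> = sets I_borel" using \<mu> by (simp add: space_prob_algebra)
  have [measurable]: "f \<in> borel_measurable I_borel" by (rule F_I_measurable[OF f])
  obtain B where B: "0 \<le> B" "\<And>x. x \<in> {0..1} \<Longrightarrow> \<bar>f x\<bar> \<le> B"
    using F_I_boundE[OF f] by metis
  have X: "X t \<in> (\<mu> \<bind> Q) \<rightarrow>\<^sub>M I_borel"
    using X_measurable[OF t] bind_prob_space[OF \<mu>] by (simp cong: measurable_cong_sets)
  have fX: "(\<lambda>\<omega>. f (X t \<omega>)) \<in> borel_measurable \<Omega>"
    by (rule measurable_compose[OF X_measurable[OF t]]) simp
  have Q: "Q \<in> \<mu> \<rightarrow>\<^sub>M subprob_algebra \<Omega>"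
    using kernel_subprob sets by (simp cong: measurable_cong_sets)
  have "(\<integral>x. f x \<partial>law_at Q X \<mu> t) = (\<integral>\<omega>. f (X t \<omega>) \<partial>(\<mu> \<bind> Q))"
    unfolding law_at_def by (rule integral_distr[OF X]) simp
  also have "\<dots> = (\<integral>x. (\<integral>\<omega>. f (X t \<omega>) \<partial>Q x) \<partial>\<mu>)"
  proof (rule integral_bind[OF fX _ Q])
    show "\<bar>f (X t \<omega>)\<bar> \<le> B" if "\<omega> \<in> space \<Omega>" for \<omega>
      using B(2) X_range[OF t that] by simp
    show "finite_measure \<mu>" by unfold_locales
    show "AE x in \<mu>. emeasure (Q x) (space (Q x)) \<le> ennreal 1"
      using kernel_prob_space(1) sets_eq_imp_space_eq[OF sets]
      by (intro AE_I2) (simp add: prob_space.emeasure_space_1)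
  qed
  finally show ?thesis by (simp add: P_op_def)
qed

lemma integrable_X:
  assumes "x \<in> {0..1}" "0 \<le> t" "f \<in> F_I"
  shows "integrable (Q x) (\<lambda>\<omega>. f (X t \<omega>))"
  using F_I_integrable[OF trans_law[OF assms(1,2)] assms(3)] unfolding trans_law_def
  by (rule integrable_distr[OF X_measurable_kernel[OF assms(1,2)]])

text \<open>Continuity of the path closes the set of times at which y is visited, so its infimum is
  attained if the set is nonempty. Attainment is what makes the inequality strict when there is no
  visit in [0,t].\<close>

lemma hitting_time_gt_iff:
  assumes \<omega>: "\<omega> \<in> space \<Omega>" and t: "0 \<le> t"
  shows "hitting_time X y \<omega> > ereal t \<longleftrightarrow> (\<forall>r\<in>{0..t}. X r \<omega> \<noteq> y)"
proof
  assume "hitting_time X y \<omega> > ereal t"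
  then show "\<forall>r\<in>{0..t}. X r \<omega> \<noteq> y"
  proof (intro ballI notI)
    fix r assume gt: "ereal t < hitting_time X y \<omega>" and r: "r \<in> {0..t}" "X r \<omega> = y"
    then have "hitting_time X y \<omega> \<le> ereal r"
      unfolding hitting_time_def by (intro Inf_lower) auto
    also have "\<dots> \<le> ereal t" using r by simp
    finally show False using gt by simp
  qed
next
  assume none: "\<forall>r\<in>{0..t}. X r \<omega> \<noteq> y"
  define A where "A = {r. 0 \<le> r \<and> X r \<omega> = y}"
  have A: "A = {0..} \<inter> (\<lambda>r. X r \<omega>) -` {y}" by (auto simp: A_def)
  have "closed A"
    unfolding A by (intro continuous_closed_preimage continuous_paths \<omega>) auto
  show "hitting_time X y \<omega> > ereal t"
  proof (cases "A = {}")
    case True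
    \<comment> \<open>A path that never visits y receives the value \<open>Inf {}\<close>, the top
      element.\<close>
    then have "{ereal r | r. 0 \<le> r \<and> X r \<omega> = y} = {}" by (auto simp: A_def)
    then show ?thesis unfolding hitting_time_def by (simp only: Inf_empty) (simp add: top_ereal_def)
  next
    case False
    have "Inf A \<in> A"
      by (intro closed_contains_Inf False \<open>closed A\<close>) (auto simp: A_def intro: bdd_belowI[of _ 0])
    then have "t < Inf A" using none by (fastforce simp: A_def)
    also have "ereal (Inf A) \<le> hitting_time X y \<omega>"
      unfolding hitting_time_def
      by (rule Inf_greatest) (auto simp: A_def intro!: cInf_lower bdd_belowI[of _ 0])
    finally show ?thesis by simp
  qed
qed

text \<open>The uncountable union over times becomes countable because 1 is the largest state: a
  continuous path visits 1 in [0,t] exactly if it exceeds each level 1 - 1/(k+1) at some rational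
  time. One direction is continuity, the other takes the maximum over the compact interval.\<close>

lemma hit_set_measurable:
  assumes t: "0 < t"
  shows "{\<omega> \<in> space \<Omega>. \<exists>r\<in>{0..t}. X r \<omega> = 1} \<in> sets \<Omega>"
proof -
  have "{\<omega> \<in> space \<Omega>. \<exists>r\<in>{0..t}. X r \<omega> = 1}
      = (\<Inter>k. \<Union>q\<in>\<rat> \<inter> {0..t}. {\<omega> \<in> space \<Omega>. X q \<omega> > 1 - inverse (real (Suc k))})" (is "?L = ?R")
  proof (intro equalityI subsetI)
    fix \<omega> assume "\<omega> \<in> ?L"
    then obtain r where \<omega>: "\<omega> \<in> space \<Omega>" and r: "r \<in> {0..t}" "X r \<omega> = 1" by auto
    show "\<omega> \<in> ?R"
    proof
      fix k
      have "0 < inverse (real (Suc k))" by simp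
      then obtain \<delta> where \<delta>: "0 < \<delta>"
        "\<And>q. \<lbrakk>q \<in> {0..}; dist q r < \<delta>\<rbrakk> \<Longrightarrow> dist (X q \<omega>) (X r \<omega>) < inverse (real (Suc k))"
        using continuous_paths[OF \<omega>] r(1) unfolding continuous_on_iff by (metis atLeastAtMost_iff atLeast_iff)
      obtain q where q: "q \<in> \<rat> \<inter> {0..t}" "\<bar>q - r\<bar> < \<delta>" by (rule rational_within[OF r(1) t \<delta>(1)])
      then have "dist (X q \<omega>) (X r \<omega>) < inverse (real (Suc k))"
        by (intro \<delta>(2)) (auto simp: dist_real_def)
      then have "X q \<omega> > 1 - inverse (real (Suc k))"
        using r(2) by (simp add: dist_real_def abs_less_iff)
      with q(1) \<omega> show "\<omega> \<in> (\<Union>q\<in>\<rat> \<inter> {0..t}. {\<omega> \<in> space \<Omega>. X q \<omega> > 1 - inverse (real (Suc k))})"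
        by blast
    qed
  next
    fix \<omega> assume R: "\<omega> \<in> ?R"
    then have \<omega>: "\<omega> \<in> space \<Omega>" by auto
    have "continuous_on {0..t} (\<lambda>r. X r \<omega>)"
      by (rule continuous_on_subset[OF continuous_paths[OF \<omega>]]) auto
    then obtain r where r: "r \<in> {0..t}" and max: "\<And>q. q \<in> {0..t} \<Longrightarrow> X q \<omega> \<le> X r \<omega>"
      using continuous_attains_sup[of "{0..t}" "\<lambda>r. X r \<omega>"] t by auto
    have "1 - inverse (real (Suc k)) \<le> X r \<omega>" for k
    proof -
      obtain q where "q \<in> {0..t}" "X q \<omega> > 1 - inverse (real (Suc k))" using R by fastforce
      then show ?thesis using max[of q] by simp
    qed
    moreover have "(\<lambda>k. 1 - inverse (real (Suc k))) \<longlonglongrightarrow> 1 - 0"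
      by (intro tendsto_intros LIMSEQ_inverse_real_of_nat)
    ultimately have "1 - 0 \<le> X r \<omega>" by (intro LIMSEQ_le_const2) auto
    moreover have "X r \<omega> \<le> 1" using X_range[OF _ \<omega>, of r] r by simp
    ultimately show "\<omega> \<in> ?L" using r \<omega> by auto
  qed
  moreover have "?R \<in> sets \<Omega>"
  proof -
    have "X q \<in> borel_measurable \<Omega>" if "q \<in> \<rat> \<inter> {0..t}" for q
    proof -
      have "(\<lambda>x::real. x) \<in> borel_measurable I_borel" by (intro measurable_I_borelI) simp
      from measurable_compose[OF X_measurable this, of q] that show ?thesis by simp
    qed
    then have "(\<Union>q\<in>\<rat> \<inter> {0..t}. {\<omega> \<in> space \<Omega>. X q \<omega> > 1 - inverse (real (Suc k))}) \<in> sets \<Omega>" for k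
      by (intro sets.countable_UN' countable_Int1 countable_rat) auto
    then show ?thesis by (intro sets.countable_INT) auto
  qed
  ultimately show ?thesis by simp
qed

text \<open>If \<open>1\<close> is absorbing, the nonnegative martingale \<open>r \<mapsto> E[1 - X t | X r]\<close>
  vanishes when \<open>X\<close> hits \<open>1\<close>. Stopping it when it first falls below \<open>\<epsilon>\<close> bounds the expectation
  of \<open>1 - X t\<close> on the event of having hit \<open>1\<close> by \<open>\<epsilon>\<close>.\<close>

definition gap :: "real \<Rightarrow> real \<Rightarrow> real" where
  "gap u = P_op Q X u (\<lambda>y. 1 - y)"

lemma one_minus_C_I: "(\<lambda>y. 1 - y) \<in> C_I"
  by (auto simp: C_I_def intro!: continuous_intros)

definition gap_low :: "real \<Rightarrow> real \<Rightarrow> real set \<Rightarrow> 'w set" where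
  "gap_low t \<epsilon> F = {\<omega> \<in> space \<Omega>. \<exists>r\<in>F. gap (t - r) (X r \<omega>) \<le> \<epsilon>}"

lemma gap_low_single:
  assumes "0 \<le> r" "r \<le> t" "r \<le> u"
  shows "gap_low t \<epsilon> {r} \<in> sets (nat_filtration \<Omega> X u)"
proof -
  have "gap (t - r) \<in> borel_measurable I_borel"
    unfolding gap_def using assms by (intro F_I_measurable P_op_F_I C_I_F_I one_minus_C_I) auto
  from measurable_sets[OF this, of "{..\<epsilon>}"]
  have "X r -` (gap (t - r) -` {..\<epsilon>} \<inter> {0..1}) \<inter> space \<Omega> \<in> sets (nat_filtration \<Omega> X u)"
    using assms by (intro X_vimage_nat_filtration) auto
  also have "X r -` (gap (t - r) -` {..\<epsilon>} \<inter> {0..1}) \<inter> space \<Omega> = gap_low t \<epsilon> {r}"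
    using X_range[OF assms(1)] by (auto simp: gap_low_def)
  finally show ?thesis .
qed

lemma gap_low_measurable:
  assumes "finite F" "F \<subseteq> {0..t}" "\<And>r. r \<in> F \<Longrightarrow> r \<le> u"
  shows "gap_low t \<epsilon> F \<in> sets (nat_filtration \<Omega> X u)"
proof -
  have "gap_low t \<epsilon> F = (\<Union>r\<in>F. gap_low t \<epsilon> {r})" by (auto simp: gap_low_def)
  also have "\<dots> \<in> sets (nat_filtration \<Omega> X u)"
    using assms by (intro sets.finite_UN gap_low_single) auto
  finally show ?thesis .
qed

text \<open>Induction by appending a latest time m. The new part of the event consists of the paths
  that are low at m but at no earlier time of F, an event of the past of m; the Markov property at
  the deterministic time m replaces 1 - X t there by the gap, which is at most \<epsilon>.\<close>

lemma gap_low_bound: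
  assumes x: "x \<in> {0..1}" and F: "finite F" "F \<subseteq> {0..t}"
  shows "(\<integral>\<omega>\<in>gap_low t \<epsilon> F. (1 - X t \<omega>) \<partial>Q x) \<le> \<epsilon> * measure (Q x) (gap_low t \<epsilon> F)"
  using F
proof (induction F rule: finite_linorder_max_induct)
  case empty
  have "gap_low t \<epsilon> {} = {}" by (simp add: gap_low_def)
  then show ?case by (simp add: set_lebesgue_integral_def)
next
  case (insert m F)
  interpret prob_space "Q x" by (rule kernel_prob_space[OF x])
  have m: "0 \<le> m" "m \<le> t" and F: "F \<subseteq> {0..t}" using insert.prems by auto
  have sub: "A \<in> sets (Q x)" if "A \<in> sets (nat_filtration \<Omega> X m)" for A
    using nat_filtration_subalgebra[OF x, of m] that by (auto simp: subalgebra_def)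
  define A where "A = gap_low t \<epsilon> F"
  define B where "B = gap_low t \<epsilon> {m} - A"
  have A: "A \<in> sets (nat_filtration \<Omega> X m)"
    unfolding A_def using insert.hyps F by (intro gap_low_measurable) auto
  have B: "B \<in> sets (nat_filtration \<Omega> X m)"
    unfolding B_def using A m by (intro sets.Diff gap_low_single) auto
  have split: "gap_low t \<epsilon> (insert m F) = A \<union> B" and disj: "A \<inter> B = {}"
    by (auto simp: A_def B_def gap_low_def)
  note gF = C_I_F_I[OF one_minus_C_I]
  have t: "0 \<le> t" using m by simp
  note int = integrable_X[OF x t gF]
  have gapF: "gap (t - m) \<in> F_I" unfolding gap_def using m by (intro P_op_F_I gF) auto
  note gap_int = integrable_X[OF x m(1) gapF]
  have "(\<integral>\<omega>\<in>B. (1 - X t \<omega>) \<partial>Q x) = (\<integral>\<omega>\<in>B. gap (t - m) (X m \<omega>) \<partial>Q x)"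
    using markov_set_integral[OF x m(1) _ gF B, of "t - m"] m by (simp add: gap_def)
  also have "\<dots> \<le> (\<integral>\<omega>\<in>B. \<epsilon> \<partial>Q x)"
  proof (rule set_integral_mono)
    show "set_integrable (Q x) B (\<lambda>\<omega>. gap (t - m) (X m \<omega>))"
      unfolding set_integrable_def by (rule integrable_mult_indicator[OF sub[OF B] gap_int])
    show "set_integrable (Q x) B (\<lambda>\<omega>. \<epsilon>)"
      unfolding set_integrable_def by (rule integrable_mult_indicator[OF sub[OF B]]) simp
  qed (simp add: B_def gap_low_def)
  also have "\<dots> = \<epsilon> * measure (Q x) B"
    using sub[OF B] by (simp add: set_lebesgue_integral_def)
  finally have Ble: "(\<integral>\<omega>\<in>B. (1 - X t \<omega>) \<partial>Q x) \<le> \<epsilon> * measure (Q x) B" .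
  have "(\<integral>\<omega>\<in>A \<union> B. (1 - X t \<omega>) \<partial>Q x) = (\<integral>\<omega>\<in>A. (1 - X t \<omega>) \<partial>Q x) + (\<integral>\<omega>\<in>B. (1 - X t \<omega>) \<partial>Q x)"
    unfolding set_integrable_def using integrable_mult_indicator[OF sub[OF A] int]
      integrable_mult_indicator[OF sub[OF B] int]
    by (intro set_integral_Un disj) (simp_all add: set_integrable_def)
  also have "\<dots> \<le> \<epsilon> * measure (Q x) A + \<epsilon> * measure (Q x) B"
    using insert.IH[OF F] Ble unfolding A_def by simp
  also have "\<dots> = \<epsilon> * measure (Q x) (A \<union> B)"
    using finite_measure_Union[OF sub[OF A] sub[OF B] disj] by (simp add: distrib_left)
  finally show ?case unfolding split .
qed

text \<open>The gap is zero at the hit, and a nearby rational time is reached in two moves: the time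
  argument moves uniformly in the state, and the state moves along the path with the time argument
  fixed, where the Feller property gives continuity. Each move costs \<epsilon>/2.\<close>

lemma gap_small_near_hit:
  assumes abs: "\<And>u. 0 \<le> u \<Longrightarrow> gap u 1 = 0"
    and \<omega>: "\<omega> \<in> space \<Omega>" and r: "r \<in> {0..t}" "X r \<omega> = 1" and t: "0 < t" and \<epsilon>: "0 < \<epsilon>"
  obtains q where "q \<in> \<rat> \<inter> {0..t}" "gap (t - q) (X q \<omega>) \<le> \<epsilon>"
proof -
  obtain \<delta>1 where \<delta>1: "0 < \<delta>1" "\<And>u u' x. \<lbrakk>0 \<le> u; 0 \<le> u'; \<bar>u - u'\<bar> < \<delta>1; x \<in> {0..1}\<rbrakk> \<Longrightarrow> \<bar>gap u x - gap u' x\<bar> \<le> \<epsilon> / 2"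
    unfolding gap_def using P_op_time_increment[OF one_minus_C_I half_gt_zero[OF \<epsilon>]] by blast
  have "(\<lambda>q. X q \<omega>) ` {0..t} \<subseteq> {0..1}"
    by (intro image_subsetI X_range[OF _ \<omega>]) simp
  moreover have "continuous_on {0..1} (gap (t - r))"
    using feller[OF _ one_minus_C_I, of "t - r"] r by (simp add: gap_def C_I_def)
  moreover have "continuous_on {0..t} (\<lambda>q. X q \<omega>)"
    by (rule continuous_on_subset[OF continuous_paths[OF \<omega>]]) auto
  ultimately have gc: "continuous_on {0..t} (\<lambda>q. gap (t - r) (X q \<omega>))"
    by (rule continuous_on_compose2[rotated 2])
  have "0 < \<epsilon> / 2" using \<epsilon> by simp
  then obtain \<delta>2 where \<delta>2: "0 < \<delta>2"
    "\<And>q. \<lbrakk>q \<in> {0..t}; dist q r < \<delta>2\<rbrakk> \<Longrightarrow> dist (gap (t - r) (X q \<omega>)) (gap (t - r) (X r \<omega>)) < \<epsilon> / 2"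
    using gc[unfolded continuous_on_iff, THEN bspec, OF r(1), THEN spec, THEN mp, OF \<open>0 < \<epsilon> / 2\<close>]
    by blast
  have "0 < min \<delta>1 \<delta>2" using \<delta>1(1) \<delta>2(1) by simp
  then obtain q where q: "q \<in> \<rat> \<inter> {0..t}" "\<bar>q - r\<bar> < min \<delta>1 \<delta>2"
    by (rule rational_within[OF r(1) t])
  then have q': "q \<in> {0..t}" "\<bar>q - r\<bar> < \<delta>1" "\<bar>q - r\<bar> < \<delta>2" by simp_all
  have "gap (t - r) (X r \<omega>) = 0" using abs[of "t - r"] r by simp
  then have "\<bar>gap (t - r) (X q \<omega>)\<bar> < \<epsilon> / 2" using \<delta>2(2)[OF q'(1)] q'(3) by (simp add: dist_real_def)
  moreover have "\<bar>gap (t - q) (X q \<omega>) - gap (t - r) (X q \<omega>)\<bar> \<le> \<epsilon> / 2"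
  proof (rule \<delta>1(2))
    show "X q \<omega> \<in> {0..1}" using q'(1) by (intro X_range \<omega>) simp
    show "0 \<le> t - q" "0 \<le> t - r" "\<bar>(t - q) - (t - r)\<bar> < \<delta>1" using q' r(1) by simp_all
  qed
  ultimately have "gap (t - q) (X q \<omega>) \<le> \<epsilon>" by linarith
  with q(1) show thesis by (rule that)
qed

text \<open>Mean value 1 when started from 1 makes the gap at 1 vanish. For each \<epsilon> the
  hitting event is then covered by an increasing union of finite-time events, so the expectation of
  1 - X t on it is at most \<epsilon>. Being nonnegative, 1 - X t vanishes there almost
  surely.\<close>

lemma absorbed_after_hit:
  assumes abs: "\<And>u. 0 \<le> u \<Longrightarrow> P_op Q X u (\<lambda>y. y) 1 = 1" and x: "x \<in> {0..1}" and t: "0 < t"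
  shows "AE \<omega> in Q x. (\<exists>r\<in>{0..t}. X r \<omega> = 1) \<longrightarrow> X t \<omega> = 1"
proof -
  interpret prob_space "Q x" by (rule kernel_prob_space[OF x])
  note sp = kernel_prob_space(2,3)[OF x]
  have t0: "0 \<le> t" using t by simp
  note gF = C_I_F_I[OF one_minus_C_I]
  have id: "(\<lambda>y. y) \<in> F_I" by (intro C_I_F_I) (simp add: C_I_def)
  have gap1: "gap u 1 = 0" if "0 \<le> u" for u
    using P_op_diff[OF _ that C_I_F_I[OF const_C_I] id, of 1 1] P_op_const[OF _ that, of 1 1] abs[OF that]
    by (simp add: gap_def)
  define H where "H = {\<omega> \<in> space \<Omega>. \<exists>r\<in>{0..t}. X r \<omega> = 1}"
  have H: "H \<in> sets (Q x)" unfolding H_def sp(1) by (rule hit_set_measurable[OF t])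
  note int = integrable_X[OF x t0 gF]
  have intA: "integrable (Q x) (\<lambda>\<omega>. indicator A \<omega> * (1 - X t \<omega>))" if "A \<in> sets (Q x)" for A
    using integrable_mult_indicator[OF that int] by simp
  have ge: "0 \<le> 1 - X t \<omega>" "1 - X t \<omega> \<le> 1" if "\<omega> \<in> space \<Omega>" for \<omega> using X_range[OF t0 that] by auto
  have le: "(\<integral>\<omega>. indicator H \<omega> * (1 - X t \<omega>) \<partial>Q x) \<le> \<epsilon>" if \<epsilon>: "0 < \<epsilon>" for \<epsilon>
  proof -
    \<comment> \<open>An enumeration of the rational times presents the countable union as an
      increasing limit of unions over finite sets of times, to which the bound applies.\<close>
    define e where "e = from_nat_into (\<rat> \<inter> {0..t})"
    have "0 \<in> \<rat> \<inter> {0..t}" using t0 by simp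
    then have ne: "\<rat> \<inter> {0..t} \<noteq> {}" by blast
    have cnt: "countable (\<rat> \<inter> {0..t})" by (intro countable_Int1 countable_rat)
    have e: "e n \<in> {0..t}" for n using from_nat_into[OF ne, of n] by (simp add: e_def)
    define E where "E n = gap_low t \<epsilon> (e ` {..n})" for n
    have En: "E n \<in> sets (Q x)" for n
    proof -
      have "E n \<in> sets (nat_filtration \<Omega> X t)"
        unfolding E_def using e by (intro gap_low_measurable) (auto simp del: atLeastAtMost_iff, simp)
      then show ?thesis using nat_filtration_subalgebra[OF x, of t] by (auto simp: subalgebra_def)
    qed
    have HE: "H \<subseteq> (\<Union>n. E n)"
    proof
      fix \<omega> assume "\<omega> \<in> H"
      then obtain r where \<omega>: "\<omega> \<in> space \<Omega>" and r: "r \<in> {0..t}" "X r \<omega> = 1" by (auto simp: H_def)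
      obtain q where q: "q \<in> \<rat> \<inter> {0..t}" "gap (t - q) (X q \<omega>) \<le> \<epsilon>"
        using gap_small_near_hit[OF gap1 \<omega> r t \<epsilon>] by blast
      obtain n where "q = e n" using from_nat_into_surj[OF cnt q(1)] by (auto simp: e_def)
      then have "\<omega> \<in> E n" using q(2) \<omega> by (auto simp: E_def gap_low_def)
      then show "\<omega> \<in> (\<Union>n. E n)" by blast
    qed
    have "(\<lambda>n. \<integral>\<omega>. indicator (E n) \<omega> * (1 - X t \<omega>) \<partial>Q x)
        \<longlonglongrightarrow> (\<integral>\<omega>. indicator (\<Union>n. E n) \<omega> * (1 - X t \<omega>) \<partial>Q x)"
    proof (rule integral_dominated_convergence[where w="\<lambda>_. 1"])
      have "incseq E" by (auto simp: incseq_def E_def gap_low_def)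
      then show "AE \<omega> in Q x. (\<lambda>n. indicator (E n) \<omega> * (1 - X t \<omega>)) \<longlonglongrightarrow> indicator (\<Union>n. E n) \<omega> * (1 - X t \<omega>)"
        by (intro AE_I2 tendsto_intros LIMSEQ_indicator_incseq)
      show "AE \<omega> in Q x. norm (indicator (E n) \<omega> * (1 - X t \<omega>)) \<le> 1" for n
        using ge by (intro AE_I2) (auto simp: sp indicator_def)
    qed (use intA En in auto)
    moreover have "(\<integral>\<omega>. indicator (E n) \<omega> * (1 - X t \<omega>) \<partial>Q x) \<le> \<epsilon>" for n
    proof -
      have "(\<integral>\<omega>. indicator (E n) \<omega> * (1 - X t \<omega>) \<partial>Q x) \<le> \<epsilon> * measure (Q x) (E n)"
        using gap_low_bound[OF x, of "e ` {..n}" t \<epsilon>] e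
        by (simp add: E_def set_lebesgue_integral_def image_subset_iff del: atLeastAtMost_iff)
      also have "\<dots> \<le> \<epsilon>" using \<epsilon> by (simp add: mult_left_le)
      finally show ?thesis .
    qed
    ultimately have "(\<integral>\<omega>. indicator (\<Union>n. E n) \<omega> * (1 - X t \<omega>) \<partial>Q x) \<le> \<epsilon>"
      by (intro LIMSEQ_le_const2) auto
    moreover have "(\<integral>\<omega>. indicator H \<omega> * (1 - X t \<omega>) \<partial>Q x) \<le> (\<integral>\<omega>. indicator (\<Union>n. E n) \<omega> * (1 - X t \<omega>) \<partial>Q x)"
    proof (intro integral_mono intA H)
      show "(\<Union>n. E n) \<in> sets (Q x)" using En by (intro sets.countable_UN) auto
      fix \<omega> assume "\<omega> \<in> space (Q x)"
      then have "0 \<le> 1 - X t \<omega>" using ge(1) sp by simp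
      moreover have "indicator H \<omega> \<le> (indicator (\<Union>n. E n) \<omega> :: real)"
        using HE by (auto simp: indicator_def)
      ultimately show "indicator H \<omega> * (1 - X t \<omega>) \<le> indicator (\<Union>n. E n) \<omega> * (1 - X t \<omega>)"
        by (intro mult_right_mono)
    qed
    ultimately show ?thesis by simp
  qed
  have nonneg: "AE \<omega> in Q x. 0 \<le> indicator H \<omega> * (1 - X t \<omega>)"
    using ge by (intro AE_I2) (auto simp: sp indicator_def)
  have "(\<integral>\<omega>. indicator H \<omega> * (1 - X t \<omega>) \<partial>Q x) \<le> 0"
  proof (rule field_le_epsilon)
    fix \<epsilon> :: real assume "0 < \<epsilon>"
    from le[OF this] show "(\<integral>\<omega>. indicator H \<omega> * (1 - X t \<omega>) \<partial>Q x) \<le> 0 + \<epsilon>" by (simp only: add_0)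
  qed
  from order.antisym[OF this integral_nonneg_AE[OF nonneg]]
  have "AE \<omega> in Q x. indicator H \<omega> * (1 - X t \<omega>) = 0"
    by (rule integral_nonneg_eq_0_iff_AE[OF intA[OF H] nonneg, THEN iffD1])
  then show ?thesis
  proof (rule AE_mp, intro AE_I2 impI)
    fix \<omega> assume \<omega>: "\<omega> \<in> space (Q x)" and eq: "indicator H \<omega> * (1 - X t \<omega>) = 0"
      and hit: "\<exists>r\<in>{0..t}. X r \<omega> = 1"
    have "\<omega> \<in> H" unfolding H_def using \<omega> hit sp by blast
    then show "X t \<omega> = 1" using eq by simp
  qed
qed

text \<open>Absorption makes the events of a visit to 1 by time t and of being at 1 at time t equal
  up to a null set, first under each \<open>Q x\<close> and then under their mixture. The easy
  inclusion takes t itself as the time of the visit.\<close>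

lemma measure_hitting_time_gt:
  assumes abs: "\<And>u. 0 \<le> u \<Longrightarrow> P_op Q X u (\<lambda>y. y) 1 = 1"
    and \<mu>: "\<mu> \<in> space (prob_algebra I_borel)" and t: "0 < t"
  shows "measure (\<mu> \<bind> Q) {\<omega> \<in> space \<Omega>. hitting_time X 1 \<omega> > ereal t}
      = 1 - measure (\<mu> \<bind> Q) {\<omega> \<in> space \<Omega>. X t \<omega> = 1}"
proof -
  interpret prob_space "\<mu> \<bind> Q" by (rule bind_prob_space[OF \<mu>])
  note sp = bind_prob_space(2,3)[OF \<mu>]
  have "{1} \<in> sets I_borel" by (simp add: sets_I_borel_iff)
  moreover have "0 \<le> t" using t by simp
  ultimately have "X t -` {1} \<inter> space \<Omega> \<in> sets \<Omega>" using measurable_sets[OF X_measurable] by blast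
  moreover have "X t -` {1} \<inter> space \<Omega> = {\<omega> \<in> space \<Omega>. X t \<omega> = 1}" by blast
  ultimately have X1: "{\<omega> \<in> space \<Omega>. X t \<omega> = 1} \<in> sets \<Omega>" by simp
  note H = hit_set_measurable[OF t]
  have pm: "Measurable.pred \<Omega> (\<lambda>\<omega>. X t \<omega> = 1)" "Measurable.pred \<Omega> (\<lambda>\<omega>. \<exists>r\<in>{0..t}. X r \<omega> = 1)"
    using X1 H by (simp_all add: pred_def)
  have sets: "sets \<mu> = sets I_borel" using \<mu> by (simp add: space_prob_algebra)
  then have s\<mu>: "space \<mu> = {0..1}" using sets_eq_imp_space_eq[of \<mu> I_borel] by simp
  have Q: "Q \<in> \<mu> \<rightarrow>\<^sub>M subprob_algebra \<Omega>"
    using kernel_subprob sets by (simp cong: measurable_cong_sets)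
  have "AE \<omega> in \<mu> \<bind> Q. (\<exists>r\<in>{0..t}. X r \<omega> = 1) \<longrightarrow> X t \<omega> = 1"
  proof (rule iffD2[OF AE_bind[OF Q]])
    show "Measurable.pred \<Omega> (\<lambda>\<omega>. (\<exists>r\<in>{0..t}. X r \<omega> = 1) \<longrightarrow> X t \<omega> = 1)" by (intro pred_intros_logic pm)
    show "AE x in \<mu>. AE \<omega> in Q x. (\<exists>r\<in>{0..t}. X r \<omega> = 1) \<longrightarrow> X t \<omega> = 1"
      by (intro AE_I2 absorbed_after_hit[OF abs _ t]) (simp_all only: s\<mu>)
  qed
  then have "AE \<omega> in \<mu> \<bind> Q. \<omega> \<in> {\<omega> \<in> space \<Omega>. \<exists>r\<in>{0..t}. X r \<omega> = 1} \<longleftrightarrow> \<omega> \<in> {\<omega> \<in> space \<Omega>. X t \<omega> = 1}"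
  proof (rule AE_mp, intro AE_I2 impI)
    fix \<omega> assume imp: "(\<exists>r\<in>{0..t}. X r \<omega> = 1) \<longrightarrow> X t \<omega> = 1"
    have "\<exists>r\<in>{0..t}. X r \<omega> = 1" if "X t \<omega> = 1" using that t by (intro bexI[of _ t]) auto
    with imp show "\<omega> \<in> {\<omega> \<in> space \<Omega>. \<exists>r\<in>{0..t}. X r \<omega> = 1} \<longleftrightarrow> \<omega> \<in> {\<omega> \<in> space \<Omega>. X t \<omega> = 1}"
      by blast
  qed
  from finite_measure_eq_AE[OF this, unfolded sp, OF H X1]
  have eq: "measure (\<mu> \<bind> Q) {\<omega> \<in> space \<Omega>. \<exists>r\<in>{0..t}. X r \<omega> = 1} = measure (\<mu> \<bind> Q) {\<omega> \<in> space \<Omega>. X t \<omega> = 1}" .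
  have seteq: "{\<omega> \<in> space \<Omega>. hitting_time X 1 \<omega> > ereal t} = space (\<mu> \<bind> Q) - {\<omega> \<in> space \<Omega>. \<exists>r\<in>{0..t}. X r \<omega> = 1}"
  proof (rule set_eqI)
    fix \<omega>
    show "\<omega> \<in> {\<omega> \<in> space \<Omega>. hitting_time X 1 \<omega> > ereal t}
        \<longleftrightarrow> \<omega> \<in> space (\<mu> \<bind> Q) - {\<omega> \<in> space \<Omega>. \<exists>r\<in>{0..t}. X r \<omega> = 1}"
    proof (cases "\<omega> \<in> space \<Omega>")
      case True
      note iff = hitting_time_gt_iff[OF True less_imp_le[OF t], of 1]
      show ?thesis unfolding mem_Collect_eq Diff_iff sp(2) iff using True by blast
    next
      case False
      then show ?thesis unfolding mem_Collect_eq Diff_iff sp(2) by blast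
    qed
  qed
  show ?thesis
    by (simp only: seteq prob_compl[unfolded sp(1), OF H] eq)
qed

end

section \<open>Indefinite integrals\<close>

lemma lbint_at_0_eq:
  fixes f :: "real \<Rightarrow> real"
  assumes "0 \<le> x" shows "(LBINT y=0..ereal x. f y) = (LINT y:{0<..<x}|lborel. f y)"
  using assms unfolding zero_ereal_def by (simp add: interval_lebesgue_integral_def)

text \<open>The open interval of integration keeps out the endpoints 0 and 1, where nothing is known
  about the coefficients.\<close>

definition cum :: "(real \<Rightarrow> real) \<Rightarrow> real \<Rightarrow> real" where
  "cum f x = (LINT y:{0<..<x}|lborel. f y)"

lemma cum_0 [simp]: "cum f 0 = 0"
  by (simp add: cum_def set_lebesgue_integral_def)

lemma set_integrable_Ioo_subset:
  fixes f :: "real \<Rightarrow> real"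
  assumes "set_integrable lborel {0<..<1} f" "0 \<le> l" "u \<le> 1"
  shows "set_integrable lborel {l<..<u} f"
  by (rule set_integrable_subset[OF assms(1)]) (use assms(2,3) in auto)

lemma cum_eq_integral:
  assumes "set_integrable lborel {0<..<1} f" "x \<in> {0..1}"
  shows "cum f x = integral {0..x} f"
proof -
  have "set_integrable lborel {0<..<x} f"
    by (rule set_integrable_Ioo_subset[OF assms(1)]) (use assms(2) in auto)
  from set_borel_integral_eq_integral(2)[OF this] show ?thesis
    by (simp add: cum_def integral_open_interval_real)
qed

lemma integrable_on_Icc01:
  assumes "set_integrable lborel {0<..<1::real} (f :: real \<Rightarrow> real)"
  shows "f integrable_on {0..1}"
  using set_borel_integral_eq_integral(1)[OF assms] by (simp add: integrable_on_open_interval_real)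

lemma continuous_on_cum:
  assumes "set_integrable lborel {0<..<1} f"
  shows "continuous_on {0..1} (cum f)"
proof -
  have "continuous_on {0..1} (\<lambda>x. integral {0..x} f)"
    by (rule indefinite_integral_continuous_1[OF integrable_on_Icc01[OF assms]])
  then show ?thesis
    by (rule continuous_on_eq) (simp only: cum_eq_integral[OF assms])
qed

lemma DERIV_cum:
  assumes "set_integrable lborel {0<..<1} f" "continuous_on {0<..<1} f" "x \<in> {0<..<1}"
  shows "(cum f has_real_derivative f x) (at x)"
proof -
  have "isCont f x"
    using assms(2,3) by (simp add: continuous_on_eq_continuous_at)
  then have "continuous (at x within ({0..1} - {})) f"
    by (rule continuous_at_imp_continuous_at_within)
  then have "((\<lambda>u. integral {0..u} f) has_vector_derivative f x) (at x within ({0..1} - {}))"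
    using assms(3) by (intro integral_has_vector_derivative_continuous_at integrable_on_Icc01 assms(1)) auto
  moreover have "at x within ({0..1} - {}) = at x"
    using assms(3) by (simp add: at_within_Icc_at)
  ultimately have "((\<lambda>u. integral {0..u} f) has_real_derivative f x) (at x)"
    by (simp add: has_real_derivative_iff_has_vector_derivative)
  then show ?thesis
    by (rule has_field_derivative_transform_within_open[of _ _ _ "{0<..<1}"])
      (use assms(3) in \<open>simp_all add: cum_eq_integral[OF assms(1)]\<close>)
qed

text \<open>The integrand may be unbounded at the ends, so the fundamental theorem is used as a
  statement of constancy: the difference of the two sides is continuous on the closed interval and
  has derivative zero inside.\<close>

lemma eq_cum:
  assumes f: "set_integrable lborel {0<..<1} f" "continuous_on {0<..<1} f"
    and F: "continuous_on {0..1} F" "F 0 = 0"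
    and D: "\<And>x. x \<in> {0<..<1} \<Longrightarrow> (F has_real_derivative f x) (at x)"
    and x: "x \<in> {0..1}"
  shows "cum f x = F x"
proof -
  have "cum f x - F x = cum f 0 - F 0"
  proof (rule DERIV_isconst2[of 0 1 "\<lambda>x. cum f x - F x"])
    show "continuous_on {0..1} (\<lambda>x. cum f x - F x)"
      by (intro continuous_intros continuous_on_cum f F)
    fix x :: real assume "0 < x" "x < 1"
    then show "((\<lambda>x. cum f x - F x) has_real_derivative 0) (at x)"
      using DERIV_diff[OF DERIV_cum[OF f] D, of x] by simp
  qed (use x in auto)
  then show ?thesis by (simp add: F)
qed

lemma cum_mono:
  assumes "set_integrable lborel {0<..<1} f" "\<And>y. y \<in> {0<..<1} \<Longrightarrow> 0 \<le> f y" "0 \<le> x" "x \<le> y" "y \<le> 1"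
  shows "cum f x \<le> cum f y"
  unfolding cum_def set_lebesgue_integral_def
proof (rule integral_mono)
  show "integrable lborel (\<lambda>z. indicator {0<..<x} z *\<^sub>R f z)" "integrable lborel (\<lambda>z. indicator {0<..<y} z *\<^sub>R f z)"
    using set_integrable_Ioo_subset[OF assms(1)] assms unfolding set_integrable_def by simp_all
  show "indicator {0<..<x} z *\<^sub>R f z \<le> indicator {0<..<y} z *\<^sub>R f z" for z
    using assms by (auto simp: indicator_def)
qed

lemma cum_pos:
  assumes "set_integrable lborel {0<..<1} f" "continuous_on {0<..<1} f"
    "\<And>y. y \<in> {0<..<1} \<Longrightarrow> 0 < f y" "0 \<le> x" "x < y" "y \<le> 1"
  shows "cum f x < cum f y"
proof (rule DERIV_pos_imp_increasing_open[OF assms(5)])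
  show "\<exists>d. (cum f has_real_derivative d) (at z) \<and> 0 < d" if "x < z" "z < y" for z
    using that assms DERIV_cum[OF assms(1,2), of z] by (intro exI[of _ "f z"]) auto
  show "continuous_on {x..y} (cum f)"
    by (rule continuous_on_subset[OF continuous_on_cum[OF assms(1)]]) (use assms in auto)
qed

lemma abs_cum_le:
  assumes "set_integrable lborel {0<..<1} f" "set_integrable lborel {0<..<1} g"
    "\<And>y. y \<in> {0<..<1} \<Longrightarrow> \<bar>f y\<bar> \<le> g y" "x \<in> {0..1}"
  shows "\<bar>cum f x\<bar> \<le> cum g x"
proof -
  have i: "set_integrable lborel {0<..<x} f" "set_integrable lborel {0<..<x} g"
    by (rule set_integrable_Ioo_subset[OF _ order.refl]; use assms in simp)+
  have "norm (LINT y:{0<..<x}|lborel. f y) \<le> (LINT y:{0<..<x}|lborel. norm (f y))"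
    by (rule set_integral_norm_bound[OF i(1)])
  also have "\<dots> \<le> (LINT y:{0<..<x}|lborel. g y)"
    by (rule set_integral_mono[OF set_integrable_norm[OF i(1)] i(2)]) (use assms(3,4) in auto)
  finally show ?thesis by (simp add: cum_def)
qed

lemma cum_scale: "cum (\<lambda>y. k * f y) x = k * cum f x"
  by (simp add: cum_def)

lemma cum_add:
  assumes "set_integrable lborel {0<..<1} f" "set_integrable lborel {0<..<1} g" "x \<in> {0..1}"
  shows "cum (\<lambda>y. f y + g y) x = cum f x + cum g x"
  unfolding cum_def
  by (rule set_integral_add; rule set_integrable_Ioo_subset[OF _ order.refl])
    (use assms in simp_all)

lemma cum_diff:
  assumes "set_integrable lborel {0<..<1} f" "set_integrable lborel {0<..<1} g" "x \<in> {0..1}"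
  shows "cum (\<lambda>y. f y - g y) x = cum f x - cum g x"
  unfolding cum_def
  by (rule set_integral_diff; rule set_integrable_Ioo_subset[OF _ order.refl])
    (use assms in simp_all)

lemma set_integrable_continuous_bound:
  fixes f g :: "real \<Rightarrow> real"
  assumes "set_integrable lborel {0<..<1} g" "continuous_on {0<..<1} f"
    "\<And>y. y \<in> {0<..<1} \<Longrightarrow> \<bar>f y\<bar> \<le> g y"
  shows "set_integrable lborel {0<..<1} f"
proof (rule set_integrable_bound[OF assms(1)])
  show "set_borel_measurable lborel {0<..<1} f"
    using borel_measurable_continuous_on_indicator[OF _ assms(2)]
    by (simp add: set_borel_measurable_def)
  show "AE y in lborel. y \<in> {0<..<1} \<longrightarrow> norm (f y) \<le> norm (g y)"
    using assms(3) by (intro AE_I2) fastforce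
qed

lemma set_integrable_bounded_mult:
  fixes f g :: "real \<Rightarrow> real"
  assumes "set_integrable lborel {0<..<1} g" "\<And>y. y \<in> {0<..<1} \<Longrightarrow> 0 \<le> g y" "f \<in> F_I"
  shows "set_integrable lborel {0<..<1} (\<lambda>y. g y * f y)"
proof -
  obtain B where B: "0 \<le> B" "\<And>x. x \<in> {0..1} \<Longrightarrow> \<bar>f x\<bar> \<le> B"
    using F_I_boundE[OF assms(3)] by metis
  have "(\<lambda>x. indicator {0..1} x * f x) \<in> borel_measurable borel"
    using F_I_measurable[OF assms(3)] by (simp add: I_borel_def borel_measurable_restrict_space_iff)
  moreover have "(\<lambda>x. indicator {0<..<1} x * g x) \<in> borel_measurable borel"
    using borel_measurable_integrable[OF assms(1)[unfolded set_integrable_def]] by simp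
  ultimately have "(\<lambda>x. (indicator {0<..<1} x * g x) * (indicator {0..1} x * f x)) \<in> borel_measurable borel"
    by (rule borel_measurable_times[rotated])
  also have "(\<lambda>x. (indicator {0<..<1} x * g x) * (indicator {0..1} x * f x))
      = (\<lambda>x. indicator {0<..<1::real} x * (g x * f x))"
    by (auto simp: indicator_def fun_eq_iff)
  finally have meas: "set_borel_measurable lborel {0<..<1} (\<lambda>y. g y * f y)"
    by (simp add: set_borel_measurable_def)
  show ?thesis
  proof (rule set_integrable_bound[OF set_integrable_mult_right[of B, OF assms(1)] meas])
    show "AE y in lborel. y \<in> {0<..<1} \<longrightarrow> norm (g y * f y) \<le> norm (B * g y)"
    proof (intro AE_I2 impI)
      fix y :: real assume y: "y \<in> {0<..<1}"
      then have "\<bar>g y\<bar> * \<bar>f y\<bar> \<le> \<bar>g y\<bar> * B" by (intro mult_left_mono B(2)) auto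
      then show "norm (g y * f y) \<le> norm (B * g y)" using B(1) by (simp add: abs_mult mult.commute)
    qed
  qed
qed

lemma LINT_Ioo_eq_cum_diff:
  assumes "set_integrable lborel {0<..<1} f" "0 \<le> l" "l \<le> x" "x \<le> 1"
  shows "(LINT y:{l<..<x}|lborel. f y) = cum f x - cum f l"
proof -
  have "set_integrable lborel {l<..<x} f"
    by (rule set_integrable_Ioo_subset[OF assms(1)]) (use assms in auto)
  from set_borel_integral_eq_integral(2)[OF this]
  have "(LINT y:{l<..<x}|lborel. f y) = integral {l..x} f" by (simp add: integral_open_interval_real)
  moreover have "integral {0..l} f + integral {l..x} f = integral {0..x} f"
    using assms by (intro Henstock_Kurzweil_Integration.integral_combine integrable_on_subinterval[OF integrable_on_Icc01[OF assms(1)]]) auto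
  ultimately show ?thesis using assms by (simp add: cum_eq_integral[OF assms(1)])
qed

lemma C_I_cont_J: "g \<in> C_I \<Longrightarrow> continuous_on {0<..<1} g"
  unfolding C_I_def by (auto elim: continuous_on_subset)

lemma differentiable_onI:
  assumes "\<And>x. x \<in> S \<Longrightarrow> (f has_real_derivative f' x) (at x)"
  shows "f differentiable_on S"
  unfolding differentiable_on_def real_differentiable_def
  using assms has_field_derivative_at_within by blast

text \<open>Squaring removes the corner of the positive part. A flux of this shape is continuously
  differentiable, which makes the right-hand side of the equation behind the step functions
  continuous.\<close>

lemma DERIV_pos_part_square:
  "((\<lambda>u. (max 0 u)\<^sup>2) has_real_derivative 2 * max 0 u) (at u)" for u :: real
proof -
  consider "u > 0" | "u < 0" | "u = 0" by linarith
  then show ?thesis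
  proof cases
    case 1
    have "((\<lambda>u. u\<^sup>2) has_real_derivative 2 * max 0 u) (at u)"
      using 1 by (auto intro!: derivative_eq_intros)
    then show ?thesis
      by (rule has_field_derivative_transform_within_open[of _ _ _ "{0<..}"]) (use 1 in auto)
  next
    case 2
    have "((\<lambda>u. 0) has_real_derivative 2 * max 0 u) (at u)" using 2 by simp
    then show ?thesis
      by (rule has_field_derivative_transform_within_open[of _ _ _ "{..<0}"]) (use 2 in auto)
  next
    case 3
    have "((\<lambda>h. (max 0 h)\<^sup>2 / h) \<longlongrightarrow> (0::real)) (at 0)"
    proof (rule Lim_null_comparison)
      show "eventually (\<lambda>h. norm ((max 0 h)\<^sup>2 / h) \<le> \<bar>h::real\<bar>) (at 0)"
        by (intro always_eventually allI) (simp add: max_def power2_eq_square)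
      show "((\<lambda>h. \<bar>h::real\<bar>) \<longlongrightarrow> 0) (at 0)" by (rule tendsto_rabs_zero[OF tendsto_ident_at])
    qed
    then show ?thesis using 3 by (simp add: DERIV_def)
  qed
qed

section \<open>Scale, speed and the potential operator\<close>

locale diffusion_coefficients =
  fixes a b :: "real \<Rightarrow> real" and c :: real
  assumes a_cont: "continuous_on {0<..<1} a"
    and b_cont: "continuous_on {0<..<1} b"
    and b_pos: "\<And>x. x \<in> {0<..<1} \<Longrightarrow> b x > 0"
    and c: "c \<in> {0<..<1}"
    and N0_fin: "N0 a b c < \<infinity>"
    and N1_fin: "N1 a b c < \<infinity>"
begin

abbreviation "s \<equiv> scale_dens a b c"
abbreviation "m \<equiv> speed_dens a b c"
abbreviation "p \<equiv> stat_dens a b c"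
abbreviation "J \<equiv> {0<..<1::real}"

lemma s_pos: "0 < s x"
  by (simp add: scale_dens_def)

lemma DERIV_s:
  assumes x: "x \<in> J"
  shows "(s has_real_derivative (- 2 * a x / b x * s x)) (at x)"
proof -
  \<comment> \<open>A compact interval inside (0,1) with both c and x in its interior: the integrand
    is continuous there although it may blow up at 0 and 1.\<close>
  define l u where "l = min c x / 2" and "u = (1 + max c x) / 2"
  have lu: "0 < l" "l < c" "c < u" "u < 1" "l < x" "x < u"
    using x c by (auto simp: l_def u_def)
  have "continuous_on J (\<lambda>y. 2 * a y / b y)"
    using b_pos by (intro continuous_intros a_cont b_cont) force
  then have "continuous_on {l..u} (\<lambda>y. 2 * a y / b y)"
    by (rule continuous_on_subset) (use lu in auto)
  then have "((\<lambda>v. LBINT y=ereal c..ereal v. 2 * a y / b y) has_vector_derivative (2 * a x / b x)) (at x within {l..u})"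
    using lu by (intro interval_integral_FTC2) auto
  then have "((\<lambda>v. LBINT y=ereal c..ereal v. 2 * a y / b y) has_real_derivative (2 * a x / b x)) (at x)"
    using lu by (simp add: has_real_derivative_iff_has_vector_derivative at_within_Icc_at)
  then have "((\<lambda>v. exp (- (LBINT y=ereal c..ereal v. 2 * a y / b y)))
      has_real_derivative (exp (- (LBINT y=ereal c..ereal x. 2 * a y / b y)) * - (2 * a x / b x))) (at x)"
    by (rule DERIV_fun_exp[OF DERIV_minus])
  moreover have "s = (\<lambda>v. exp (- (LBINT y=ereal c..ereal v. 2 * a y / b y)))"
    by (simp add: scale_dens_def fun_eq_iff)
  ultimately show ?thesis by (simp add: mult.commute)
qed

lemma s_cont: "continuous_on J s"
  by (meson DERIV_s DERIV_isCont continuous_at_imp_continuous_on)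

lemma m_pos: "x \<in> J \<Longrightarrow> 0 < m x"
  by (simp add: speed_dens_def s_pos b_pos)

lemma m_cont: "continuous_on J m"
proof -
  have "continuous_on J (\<lambda>x. 1 / (s x * b x))"
    using b_pos s_pos by (intro continuous_intros s_cont b_cont) (metis less_irrefl mult_eq_0_iff)
  then show ?thesis by (simp add: speed_dens_def[abs_def])
qed

lemma sm: "x \<in> J \<Longrightarrow> s x * m x = 1 / b x"
  using s_pos[of x] by (simp add: speed_dens_def)

lemma scale_fun_c [simp]: "scale_fun a b c c = 0"
  by (simp add: scale_fun_def)

lemma nn_integral_scale:
  assumes "x \<in> J" "y \<in> J" "x \<le> y"
  shows "(\<integral>\<^sup>+z. ennreal (s z) * indicator {x<..<y} z \<partial>lborel) = ennreal (LBINT z=ereal x..ereal y. s z)"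
proof -
  have "continuous_on {x..y} s"
    by (rule continuous_on_subset[OF s_cont]) (use assms in auto)
  then have i: "set_integrable lborel {x<..<y} s"
    by (intro set_integrable_subset[OF borel_integrable_atLeastAtMost']) auto
  have "(\<integral>\<^sup>+z. ennreal (s z) * indicator {x<..<y} z \<partial>lborel) = (\<integral>\<^sup>+z. ennreal (indicator {x<..<y} z *\<^sub>R s z) \<partial>lborel)"
    by (intro nn_integral_cong) (simp add: indicator_def)
  also have "\<dots> = ennreal (LINT z:{x<..<y}|lborel. s z)"
    unfolding set_lebesgue_integral_def
    using i s_pos by (intro nn_integral_eq_integral AE_I2) (auto simp: set_integrable_def indicator_def less_imp_le)
  also have "(LINT z:{x<..<y}|lborel. s z) = (LBINT z=ereal x..ereal y. s z)"
    using assms(3) by (simp add: interval_lebesgue_integral_def)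
  finally show ?thesis .
qed

section \<open>Tonelli's theorem and finiteness of the speed measure\<close>

definition s_ext :: "real \<Rightarrow> ennreal" where "s_ext x = ennreal (indicator J x * s x)"
definition m_ext :: "real \<Rightarrow> ennreal" where "m_ext x = ennreal (indicator J x * m x)"

lemma ext_measurable [measurable]: "s_ext \<in> borel_measurable borel" "m_ext \<in> borel_measurable borel"
  using borel_measurable_continuous_on_indicator[OF _ s_cont] borel_measurable_continuous_on_indicator[OF _ m_cont]
  by (simp_all add: s_ext_def[abs_def] m_ext_def[abs_def])

text \<open>The pairs \<open>(\<eta>, y)\<close> with \<open>y\<close> between \<open>\<eta>\<close> and \<open>c\<close>: one application of Tonelli's theorem
  on this set treats \<open>N(0)\<close> and \<open>N(1)\<close> together. Below, \<open>S_dist \<eta> = \<bar>S \<eta> - S c\<bar>\<close>.\<close>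

definition beyond :: "(real \<times> real) set" where
  "beyond = {(\<eta>, y). 0 < \<eta> \<and> \<eta> < y \<and> y < c \<or> c < y \<and> y < \<eta> \<and> \<eta> < 1}"

lemma beyond_measurable [measurable]: "beyond \<in> sets (lborel \<Otimes>\<^sub>M lborel)"
proof -
  have "beyond = {z \<in> space (lborel \<Otimes>\<^sub>M lborel). 0 < fst z \<and> fst z < snd z \<and> snd z < c \<or> c < snd z \<and> snd z < fst z \<and> fst z < 1}"
    by (auto simp: beyond_def space_pair_measure)
  also have "\<dots> \<in> sets (lborel \<Otimes>\<^sub>M lborel)" by measurable
  finally show ?thesis .
qed

definition S_dist :: "real \<Rightarrow> ennreal" where
  "S_dist \<eta> = (\<integral>\<^sup>+y. s_ext y * indicator beyond (\<eta>, y) \<partial>lborel)"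

lemma S_dist_measurable [measurable]: "S_dist \<in> borel_measurable lborel"
  unfolding S_dist_def by measurable

lemma S_dist_low:
  assumes "\<eta> \<in> {0<..c}" shows "S_dist \<eta> = ennreal (scale_fun a b c c - scale_fun a b c \<eta>)"
proof -
  have "S_dist \<eta> = (\<integral>\<^sup>+z. ennreal (s z) * indicator {\<eta><..<c} z \<partial>lborel)"
    unfolding S_dist_def
  proof (rule nn_integral_cong)
    fix y show "s_ext y * indicator beyond (\<eta>, y) = ennreal (s y) * indicator {\<eta><..<c} y"
    proof (cases "\<eta> < y \<and> y < c")
      case True
      then have "(\<eta>, y) \<in> beyond" "y \<in> J" using assms c by (auto simp: beyond_def)
      then show ?thesis using True by (simp add: s_ext_def)
    next
      case False
      then have "(\<eta>, y) \<notin> beyond" using assms by (auto simp: beyond_def)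
      then show ?thesis using False by (simp add: indicator_def)
    qed
  qed
  also have "\<dots> = ennreal (LBINT z=ereal \<eta>..ereal c. s z)"
    by (rule nn_integral_scale) (use assms c in auto)
  also have "(LBINT z=ereal \<eta>..ereal c. s z) = scale_fun a b c c - scale_fun a b c \<eta>"
    by (subst interval_integral_endpoints_reverse) (simp add: scale_fun_def)
  finally show ?thesis .
qed

lemma S_dist_high:
  assumes "\<eta> \<in> {c..<1}" shows "S_dist \<eta> = ennreal (scale_fun a b c \<eta> - scale_fun a b c c)"
proof -
  have "S_dist \<eta> = (\<integral>\<^sup>+z. ennreal (s z) * indicator {c<..<\<eta>} z \<partial>lborel)"
    unfolding S_dist_def
  proof (rule nn_integral_cong)
    fix y show "s_ext y * indicator beyond (\<eta>, y) = ennreal (s y) * indicator {c<..<\<eta>} y"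
    proof (cases "c < y \<and> y < \<eta>")
      case True
      then have "(\<eta>, y) \<in> beyond" "y \<in> J" using assms c by (auto simp: beyond_def)
      then show ?thesis using True by (simp add: s_ext_def)
    next
      case False
      then have "(\<eta>, y) \<notin> beyond" using assms by (auto simp: beyond_def)
      then show ?thesis using False by (simp add: indicator_def)
    qed
  qed
  also have "\<dots> = ennreal (LBINT z=ereal c..ereal \<eta>. s z)"
    by (rule nn_integral_scale) (use assms c in auto)
  finally show ?thesis by (simp add: scale_fun_def)
qed

text \<open>N(0) and N(1) are the integrals of the scale distance to c against M over the two sides
  of c. Both sides contain c, hence an inequality in the first step.\<close>

lemma N_fin: "(\<integral>\<^sup>+\<eta>. m_ext \<eta> * S_dist \<eta> \<partial>lborel) < \<infinity>"
proof -
  let ?l = "\<lambda>\<eta>. m_ext \<eta> * S_dist \<eta> * indicator {0<..c} \<eta>"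
  let ?r = "\<lambda>\<eta>. m_ext \<eta> * S_dist \<eta> * indicator {c..<1} \<eta>"
  have "(\<integral>\<^sup>+\<eta>. m_ext \<eta> * S_dist \<eta> \<partial>lborel) \<le> (\<integral>\<^sup>+\<eta>. ?l \<eta> + ?r \<eta> \<partial>lborel)"
  proof (rule nn_integral_mono)
    fix \<eta> :: real
    show "m_ext \<eta> * S_dist \<eta> \<le> ?l \<eta> + ?r \<eta>"
    proof (cases "\<eta> \<in> J")
      case False then show ?thesis by (simp add: m_ext_def)
    next
      case True then have "\<eta> \<in> {0<..c} \<or> \<eta> \<in> {c..<1}" using c by auto
      then show ?thesis
      proof
        assume "\<eta> \<in> {0<..c}" then have "m_ext \<eta> * S_dist \<eta> = ?l \<eta>" by simp
        then show ?thesis by simp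
      next
        assume "\<eta> \<in> {c..<1}" then have "m_ext \<eta> * S_dist \<eta> = ?r \<eta>" by simp
        then show ?thesis by simp
      qed
    qed
  qed
  also have "\<dots> = (\<integral>\<^sup>+\<eta>. ?l \<eta> \<partial>lborel) + (\<integral>\<^sup>+\<eta>. ?r \<eta> \<partial>lborel)"
    by (rule nn_integral_add) measurable
  also have "(\<integral>\<^sup>+\<eta>. ?l \<eta> \<partial>lborel) = N0 a b c"
    unfolding N0_def
  proof (rule nn_integral_cong)
    fix \<eta> show "?l \<eta> = ennreal (scale_fun a b c c - scale_fun a b c \<eta>) * ennreal (m \<eta>) * indicator {0<..c} \<eta>"
      using S_dist_low[of \<eta>] c by (cases "\<eta> \<in> {0<..c}") (auto simp: m_ext_def mult.commute)
  qed
  also have "(\<integral>\<^sup>+\<eta>. ?r \<eta> \<partial>lborel) = N1 a b c"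
    unfolding N1_def
  proof (rule nn_integral_cong)
    fix \<eta> show "?r \<eta> = ennreal (scale_fun a b c \<eta> - scale_fun a b c c) * ennreal (m \<eta>) * indicator {c..<1} \<eta>"
      using S_dist_high[of \<eta>] c by (cases "\<eta> \<in> {c..<1}") (auto simp: m_ext_def mult.commute)
  qed
  also have "N0 a b c + N1 a b c < \<infinity>" using N0_fin N1_fin by simp
  finally show ?thesis .
qed

text \<open>A positive minimum of s on the compact interval between \<eta> and c bounds the integral
  from below. Positivity permits the division in Markov's inequality.\<close>

lemma S_dist_pos:
  assumes "\<eta> \<in> J" "\<eta> \<noteq> c" shows "S_dist \<eta> \<noteq> 0"
proof -
  define l u where "l = min \<eta> c" and "u = max \<eta> c"
  have lu: "0 < l" "l < u" "u < 1" using assms c by (auto simp: l_def u_def)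
  have "S_dist \<eta> = (\<integral>\<^sup>+z. ennreal (s z) * indicator {l<..<u} z \<partial>lborel)"
  proof (cases "\<eta> < c")
    case True
    then have "S_dist \<eta> = ennreal (scale_fun a b c c - scale_fun a b c \<eta>)" using assms by (intro S_dist_low) auto
    also have "scale_fun a b c c - scale_fun a b c \<eta> = (LBINT z=ereal l..ereal u. s z)"
      unfolding l_def u_def using True by (subst interval_integral_endpoints_reverse) (simp add: scale_fun_def)
    also have "ennreal \<dots> = (\<integral>\<^sup>+z. ennreal (s z) * indicator {l<..<u} z \<partial>lborel)"
      by (rule nn_integral_scale[symmetric]) (use lu in auto)
    finally show ?thesis .
  next
    case False
    then have "S_dist \<eta> = ennreal (scale_fun a b c \<eta> - scale_fun a b c c)" using assms by (intro S_dist_high) auto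
    also have "scale_fun a b c \<eta> - scale_fun a b c c = (LBINT z=ereal l..ereal u. s z)"
      unfolding l_def u_def using False by (simp add: scale_fun_def)
    also have "ennreal \<dots> = (\<integral>\<^sup>+z. ennreal (s z) * indicator {l<..<u} z \<partial>lborel)"
      by (rule nn_integral_scale[symmetric]) (use lu in auto)
    finally show ?thesis .
  qed
  moreover obtain k where k: "k \<in> {l..u}" "\<And>z. z \<in> {l..u} \<Longrightarrow> s k \<le> s z"
  proof -
    have "continuous_on {l..u} s" by (rule continuous_on_subset[OF s_cont]) (use lu in auto)
    with continuous_attains_inf[of "{l..u}" s] lu obtain k where "k \<in> {l..u}" "\<forall>z\<in>{l..u}. s k \<le> s z"
      by auto
    then show thesis using that by blast
  qed
  have "ennreal (s k) * emeasure lborel {l<..<u} \<le> (\<integral>\<^sup>+z. ennreal (s z) * indicator {l<..<u} z \<partial>lborel)"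
    by (subst nn_integral_cmult_indicator[symmetric], simp)
      (intro nn_integral_mono, use k(2) in \<open>simp add: indicator_def ennreal_leI\<close>)
  moreover have "0 < ennreal (s k) * emeasure lborel {l<..<u}"
    using lu s_pos by (simp add: ennreal_zero_less_mult_iff)
  ultimately show ?thesis by (metis leD)
qed

lemma S_dist_mono_low:
  assumes "0 < \<eta>" "\<eta> \<le> \<eta>'" "\<eta>' \<le> c" shows "S_dist \<eta>' \<le> S_dist \<eta>"
  unfolding S_dist_def using assms by (intro nn_integral_mono mult_left_mono) (auto simp: indicator_def beyond_def)

lemma S_dist_mono_high:
  assumes "c < \<eta>" "\<eta> \<le> \<eta>'" "\<eta>' < 1" shows "S_dist \<eta> \<le> S_dist \<eta>'"
  unfolding S_dist_def using assms by (intro nn_integral_mono mult_left_mono) (auto simp: indicator_def beyond_def)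

text \<open>Markov's inequality for the scale distance under M: its integral is finite and on A it
  is at least the positive value at \<eta>.\<close>

lemma nn_integral_m_part:
  assumes \<eta>: "\<eta> \<in> J" "\<eta> \<noteq> c" and A: "A \<in> sets borel" and le: "\<And>z. \<lbrakk>z \<in> A; z \<in> J\<rbrakk> \<Longrightarrow> S_dist \<eta> \<le> S_dist z"
  shows "(\<integral>\<^sup>+z. m_ext z * indicator A z \<partial>lborel) < \<infinity>"
proof -
  note [measurable] = A
  have "S_dist \<eta> * (\<integral>\<^sup>+z. m_ext z * indicator A z \<partial>lborel) = (\<integral>\<^sup>+z. S_dist \<eta> * (m_ext z * indicator A z) \<partial>lborel)"
    by (intro nn_integral_cmult[symmetric]) measurable
  also have "\<dots> \<le> (\<integral>\<^sup>+z. m_ext z * S_dist z \<partial>lborel)"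
  proof (rule nn_integral_mono)
    fix z show "S_dist \<eta> * (m_ext z * indicator A z) \<le> m_ext z * S_dist z"
    proof (cases "z \<in> A \<and> z \<in> J")
      case True
      then show ?thesis using mult_left_mono[OF le, of z "m_ext z"] by (simp add: mult.commute)
    next
      case False then show ?thesis by (auto simp: m_ext_def)
    qed
  qed
  also have "\<dots> < \<infinity>" by (rule N_fin)
  finally have "S_dist \<eta> * (\<integral>\<^sup>+z. m_ext z * indicator A z \<partial>lborel) < \<infinity>" .
  then show ?thesis using S_dist_pos[OF \<eta>] by (auto simp: ennreal_mult_less_top)
qed

text \<open>The scale distance grows away from c, so Markov's inequality bounds the speed mass near
  either end. It vanishes at c, so the middle piece is treated apart, by continuity of m on a
  compact interval.\<close>

lemma m_integrable: "set_integrable lborel J m"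
proof -
  define l u where "l = c / 2" and "u = (1 + c) / 2"
  have lu: "0 < l" "l < c" "c < u" "u < 1" using c by (auto simp: l_def u_def)
  have 1: "(\<integral>\<^sup>+z. m_ext z * indicator {0<..l} z \<partial>lborel) < \<infinity>"
    by (rule nn_integral_m_part[of l]) (use lu in \<open>auto intro: S_dist_mono_low\<close>)
  have 2: "(\<integral>\<^sup>+z. m_ext z * indicator {u..<1} z \<partial>lborel) < \<infinity>"
    by (rule nn_integral_m_part[of u]) (use lu in \<open>auto intro: S_dist_mono_high\<close>)
  have "set_integrable lborel {l..u} m"
    by (intro borel_integrable_atLeastAtMost' continuous_on_subset[OF m_cont]) (use lu in auto)
  then have "(\<integral>\<^sup>+z. ennreal (norm (indicator {l..u} z *\<^sub>R m z)) \<partial>lborel) < \<infinity>"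
    unfolding set_integrable_def by (simp add: integrable_iff_bounded)
  also have "(\<integral>\<^sup>+z. ennreal (norm (indicator {l..u} z *\<^sub>R m z)) \<partial>lborel) = (\<integral>\<^sup>+z. m_ext z * indicator {l..u} z \<partial>lborel)"
  proof (rule nn_integral_cong)
    fix z show "ennreal (norm (indicator {l..u} z *\<^sub>R m z)) = m_ext z * indicator {l..u} z"
    proof (cases "z \<in> {l..u}")
      case True
      then have "z \<in> J" using lu by auto
      then show ?thesis using True m_pos[of z] by (simp add: m_ext_def)
    qed simp
  qed
  finally have 3: "(\<integral>\<^sup>+z. m_ext z * indicator {l..u} z \<partial>lborel) < \<infinity>" .
  have "(\<integral>\<^sup>+z. m_ext z \<partial>lborel) \<le> (\<integral>\<^sup>+z. (m_ext z * indicator {0<..l} z + m_ext z * indicator {u..<1} z) + m_ext z * indicator {l..u} z \<partial>lborel)"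
    using lu by (intro nn_integral_mono) (auto simp: m_ext_def indicator_def)
  also have "\<dots> = (\<integral>\<^sup>+z. m_ext z * indicator {0<..l} z \<partial>lborel) + (\<integral>\<^sup>+z. m_ext z * indicator {u..<1} z \<partial>lborel)
      + (\<integral>\<^sup>+z. m_ext z * indicator {l..u} z \<partial>lborel)"
    by (subst nn_integral_add; (subst nn_integral_add)?) measurable
  also have "\<dots> < \<infinity>" using 1 2 3 by simp
  finally have fin: "(\<integral>\<^sup>+z. m_ext z \<partial>lborel) < \<infinity>" .
  have "(\<integral>\<^sup>+z. ennreal (norm (indicator J z *\<^sub>R m z)) \<partial>lborel) = (\<integral>\<^sup>+z. m_ext z \<partial>lborel)"
    using m_pos by (intro nn_integral_cong) (simp add: m_ext_def indicator_def less_imp_le)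
  with fin show ?thesis
    unfolding set_integrable_def integrable_iff_bounded
    using borel_measurable_continuous_on_indicator[OF _ m_cont] by simp
qed

lemma nn_integral_m_Ioo:
  assumes "0 \<le> l" "l \<le> x" "x \<le> 1"
  shows "(\<integral>\<^sup>+z. m_ext z * indicator {l<..<x} z \<partial>lborel) = ennreal (cum m x - cum m l)"
proof -
  have "(\<integral>\<^sup>+z. m_ext z * indicator {l<..<x} z \<partial>lborel) = (\<integral>\<^sup>+z. ennreal (indicator {l<..<x} z *\<^sub>R m z) \<partial>lborel)"
    using assms by (intro nn_integral_cong) (simp add: m_ext_def indicator_def)
  also have "\<dots> = ennreal (LINT z:{l<..<x}|lborel. m z)"
    unfolding set_lebesgue_integral_def
    using set_integrable_Ioo_subset[OF m_integrable assms(1,3)] m_pos assms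
    by (intro nn_integral_eq_integral AE_I2) (auto simp: set_integrable_def indicator_def less_imp_le)
  finally show ?thesis by (simp add: LINT_Ioo_eq_cum_diff[OF m_integrable assms])
qed

section \<open>The integrable envelope of scale density times flux\<close>

definition envelope :: "real \<Rightarrow> real" where
  "envelope y = s y * min (cum m y) (cum m 1 - cum m y)"

lemma cum_m_mono: "0 \<le> x \<Longrightarrow> x \<le> y \<Longrightarrow> y \<le> 1 \<Longrightarrow> cum m x \<le> cum m y"
  by (rule cum_mono[OF m_integrable]) (simp_all add: m_pos less_imp_le)

lemma envelope_nonneg: "y \<in> J \<Longrightarrow> 0 \<le> envelope y"
  using cum_m_mono[of 0 y] cum_m_mono[of y 1] s_pos[of y] by (simp add: envelope_def)

lemma cum_cont_J:
  assumes "set_integrable lborel J f" shows "continuous_on J (cum f)"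
  by (rule continuous_on_subset[OF continuous_on_cum[OF assms]]) auto

lemma envelope_cont: "continuous_on J envelope"
  unfolding envelope_def by (intro continuous_intros continuous_on_min s_cont cum_cont_J m_integrable)

text \<open>Tonelli rewrites the finite integral of \<open>S_dist\<close> against M as the integral
  of s(y) times the speed mass beyond y as seen from c. This mass is M(0,y) or M(y,1) according to
  the side of c, and either one dominates the minimum in the envelope.\<close>

lemma envelope_integrable: "set_integrable lborel J envelope"
proof -
  have "(\<integral>\<^sup>+y. ennreal (norm (indicator J y *\<^sub>R envelope y)) \<partial>lborel)
      \<le> (\<integral>\<^sup>+y. (\<integral>\<^sup>+\<eta>. m_ext \<eta> * (s_ext y * indicator beyond (\<eta>, y)) \<partial>lborel) \<partial>lborel)"
  proof (rule nn_integral_mono_AE)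
    \<comment> \<open>At y = c the slice of \<open>beyond\<close> is empty while the envelope is
      positive, so this single point is discarded.\<close>
    have "AE y in lborel. y \<noteq> c" by (rule AE_lborel_singleton)
    then show "AE y in lborel. ennreal (norm (indicator J y *\<^sub>R envelope y))
        \<le> (\<integral>\<^sup>+\<eta>. m_ext \<eta> * (s_ext y * indicator beyond (\<eta>, y)) \<partial>lborel)"
    proof (rule AE_mp, intro AE_I2 impI)
      fix y assume yc: "y \<noteq> c"
      show "ennreal (norm (indicator J y *\<^sub>R envelope y)) \<le> (\<integral>\<^sup>+\<eta>. m_ext \<eta> * (s_ext y * indicator beyond (\<eta>, y)) \<partial>lborel)"
      proof (cases "y \<in> J")
        case True
        define l x where "l = (if y < c then 0 else y)" and "x = (if y < c then y else 1)"
        have lx: "0 \<le> l" "l \<le> x" "x \<le> 1" using True c by (auto simp: l_def x_def)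
        have "ennreal (norm (indicator J y *\<^sub>R envelope y)) = ennreal (s y * min (cum m y) (cum m 1 - cum m y))"
          using envelope_nonneg[OF True] True by (simp add: envelope_def)
        also have "\<dots> \<le> ennreal (s y * (cum m x - cum m l))"
          using s_pos[of y] by (intro ennreal_leI mult_left_mono) (auto simp: l_def x_def)
        also have "\<dots> = s_ext y * (\<integral>\<^sup>+\<eta>. m_ext \<eta> * indicator {l<..<x} \<eta> \<partial>lborel)"
          using True s_pos[of y] cum_m_mono[OF lx] by (simp add: nn_integral_m_Ioo[OF lx] s_ext_def ennreal_mult)
        also have "\<dots> = (\<integral>\<^sup>+\<eta>. s_ext y * (m_ext \<eta> * indicator {l<..<x} \<eta>) \<partial>lborel)"
          by (intro nn_integral_cmult[symmetric]) measurable
        also have "\<dots> = (\<integral>\<^sup>+\<eta>. m_ext \<eta> * (s_ext y * indicator beyond (\<eta>, y)) \<partial>lborel)"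
        proof (rule nn_integral_cong)
          fix \<eta> :: real
          have "\<eta> \<in> {l<..<x} \<longleftrightarrow> (\<eta>, y) \<in> beyond" using yc by (auto simp: l_def x_def beyond_def)
          then show "s_ext y * (m_ext \<eta> * indicator {l<..<x} \<eta>) = m_ext \<eta> * (s_ext y * indicator beyond (\<eta>, y))"
            by (simp add: indicator_def mult.commute)
        qed
        finally show ?thesis .
      qed simp
    qed
  qed
  also have "\<dots> = (\<integral>\<^sup>+\<eta>. (\<integral>\<^sup>+y. m_ext \<eta> * (s_ext y * indicator beyond (\<eta>, y)) \<partial>lborel) \<partial>lborel)"
    by (rule lborel_pair.Fubini') measurable
  also have "\<dots> = (\<integral>\<^sup>+\<eta>. m_ext \<eta> * S_dist \<eta> \<partial>lborel)"
    unfolding S_dist_def by (intro nn_integral_cong nn_integral_cmult) measurable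
  also have "\<dots> < \<infinity>" by (rule N_fin)
  finally show ?thesis
    unfolding set_integrable_def integrable_iff_bounded
    using borel_measurable_continuous_on_indicator[OF _ envelope_cont] by simp
qed

section \<open>The potential operator\<close>

definition flux :: "(real \<Rightarrow> real) \<Rightarrow> real \<Rightarrow> real" where
  "flux g y = 2 * cum (\<lambda>z. m z * g z) y"

text \<open>In the form A = (1/2) d/dM d/dS, the equation A f = g with zero flux at 0 integrates to
  df/dS = \<open>flux g\<close> and then, with f(0) = 0, to this function. The factor 2 in the flux
  answers the 1/2 in A.\<close>

definition pot :: "(real \<Rightarrow> real) \<Rightarrow> real \<Rightarrow> real" where
  "pot g = cum (\<lambda>y. s y * flux g y)"

lemma mg_integrable: "g \<in> F_I \<Longrightarrow> set_integrable lborel J (\<lambda>z. m z * g z)"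
  by (rule set_integrable_bounded_mult[OF m_integrable]) (simp_all add: m_pos less_imp_le)

text \<open>For centred g the integral of g over (0,y) against M is minus that over (y,1), so it is
  at most G times the mass of the lighter side.\<close>

lemma flux_bound:
  assumes g: "g \<in> F_I" "\<And>y. y \<in> {0..1} \<Longrightarrow> \<bar>g y\<bar> \<le> G" and zero: "flux g 1 = 0" and y: "y \<in> J"
  shows "\<bar>s y * flux g y\<bar> \<le> 2 * G * envelope y"
proof -
  note i = mg_integrable[OF g(1)] and Gi = set_integrable_mult_right[of G, OF m_integrable]
  have le: "- (G * m z) \<le> m z * g z" "m z * g z \<le> G * m z" if "z \<in> J" for z
  proof -
    have "\<bar>m z * g z\<bar> \<le> G * m z"
      using m_pos[OF that] g(2)[of z] that by (simp add: abs_mult mult.commute mult_right_mono)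
    then show "- (G * m z) \<le> m z * g z" "m z * g z \<le> G * m z" by linarith+
  qed
  have c0: "cum (\<lambda>z. m z * g z) 1 = 0" using zero by (simp add: flux_def)
  \<comment> \<open>Both G m + m g and G m - m g are nonnegative, so their indefinite integrals
    increase. Comparing y with 0 and with 1 yields the four bounds; those on the right side use that
    g is centred.\<close>
  have "cum (\<lambda>z. G * m z + m z * g z) 0 \<le> cum (\<lambda>z. G * m z + m z * g z) y"
    "cum (\<lambda>z. G * m z + m z * g z) y \<le> cum (\<lambda>z. G * m z + m z * g z) 1"
    using le y by (intro cum_mono set_integral_add(1)[OF Gi i]; force)+
  then have "- (G * cum m y) \<le> cum (\<lambda>z. m z * g z) y"
    "cum (\<lambda>z. m z * g z) y \<le> G * (cum m 1 - cum m y)"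
    using y c0 by (simp_all add: cum_add[OF Gi i] cum_scale right_diff_distrib)
  moreover have "cum (\<lambda>z. G * m z - m z * g z) 0 \<le> cum (\<lambda>z. G * m z - m z * g z) y"
    "cum (\<lambda>z. G * m z - m z * g z) y \<le> cum (\<lambda>z. G * m z - m z * g z) 1"
    using le y by (intro cum_mono set_integral_diff(1)[OF Gi i]; force)+
  then have "cum (\<lambda>z. m z * g z) y \<le> G * cum m y"
    "- (G * (cum m 1 - cum m y)) \<le> cum (\<lambda>z. m z * g z) y"
    using y c0 by (simp_all add: cum_diff[OF Gi i] cum_scale right_diff_distrib)
  ultimately have "\<bar>cum (\<lambda>z. m z * g z) y\<bar> \<le> G * min (cum m y) (cum m 1 - cum m y)"
    by (simp add: min_def abs_le_iff)
  then have "2 * s y * \<bar>cum (\<lambda>z. m z * g z) y\<bar> \<le> 2 * s y * (G * min (cum m y) (cum m 1 - cum m y))"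
    using s_pos[of y] by (intro mult_left_mono) auto
  then show ?thesis using s_pos[of y] by (simp add: flux_def envelope_def abs_mult mult_ac)
qed

lemma flux_cont: "g \<in> F_I \<Longrightarrow> continuous_on {0..1} (flux g)"
  unfolding flux_def by (intro continuous_intros continuous_on_cum mg_integrable)

lemma flux_cont_J: assumes "g \<in> F_I" shows "continuous_on J (flux g)"
  by (rule continuous_on_subset[OF flux_cont[OF assms]]) auto

lemma s_flux_cont: assumes "g \<in> F_I" shows "continuous_on J (\<lambda>y. s y * flux g y)"
  by (intro continuous_intros s_cont flux_cont_J[OF assms])

lemma s_flux_integrable:
  assumes g: "g \<in> F_I" and zero: "flux g 1 = 0"
  shows "set_integrable lborel J (\<lambda>y. s y * flux g y)"
proof -
  obtain G where G: "0 \<le> G" "\<And>y. y \<in> {0..1} \<Longrightarrow> \<bar>g y\<bar> \<le> G" using F_I_boundE[OF g] by metis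
  show ?thesis
    by (rule set_integrable_continuous_bound[OF set_integrable_mult_right[of "2 * G", OF envelope_integrable]
          s_flux_cont[OF g] flux_bound[OF g G(2) zero]])
qed

lemma pot_C_I: "\<lbrakk>g \<in> F_I; flux g 1 = 0\<rbrakk> \<Longrightarrow> pot g \<in> C_I"
  unfolding C_I_def pot_def by (simp add: continuous_on_cum s_flux_integrable)

lemma DERIV_flux:
  assumes "g \<in> C_I" "x \<in> J"
  shows "(flux g has_real_derivative 2 * (m x * g x)) (at x)"
proof -
  have "continuous_on J (\<lambda>z. m z * g z)"
    by (intro continuous_intros m_cont C_I_cont_J[OF assms(1)])
  from DERIV_cmult[OF DERIV_cum[OF mg_integrable[OF C_I_F_I[OF assms(1)]] this assms(2)], of 2]
  show ?thesis by (simp add: flux_def[abs_def])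
qed

lemma DERIV_pot:
  assumes "g \<in> F_I" "flux g 1 = 0" "x \<in> J"
  shows "(pot g has_real_derivative s x * flux g x) (at x)"
  unfolding pot_def by (rule DERIV_cum[OF s_flux_integrable[OF assms(1,2)] s_flux_cont[OF assms(1)] assms(3)])

text \<open>The flux is continuous up to the ends, zero at 0 by construction and zero at 1 by
  centring, so both boundary conditions hold together.\<close>

lemma pot_generator:
  assumes g: "g \<in> C_I" and zero: "flux g 1 = 0"
  shows "pot g \<in> C2_int" "\<And>x. x \<in> J \<Longrightarrow> diff_op a b (pot g) x = g x"
    "zero_flux0 a b c (pot g)" "zero_flux1 a b c (pot g)"
proof -
  note gF = C_I_F_I[OF g]
  \<comment> \<open>The second derivative that A f = g prescribes once f' = s * flux.\<close>
  define g2 where "g2 x = (2 * g x - 2 * a x * (s x * flux g x)) / b x" for x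
  have d1: "deriv (pot g) x = s x * flux g x" if "x \<in> J" for x
    by (rule DERIV_imp_deriv[OF DERIV_pot[OF gF zero that]])
  have D2: "(deriv (pot g) has_real_derivative g2 x) (at x)" if x: "x \<in> J" for x
  proof -
    have "((\<lambda>x. s x * flux g x) has_real_derivative
        (- 2 * a x / b x * s x) * flux g x + (2 * (m x * g x)) * s x) (at x)"
      by (rule DERIV_mult'[OF DERIV_s[OF x] DERIV_flux[OF g x], THEN DERIV_cong]) simp
    moreover have "(- 2 * a x / b x * s x) * flux g x + (2 * (m x * g x)) * s x = g2 x"
    proof -
      have "(2 * (m x * g x)) * s x = 2 * g x * (s x * m x)" by simp
      also have "\<dots> = 2 * g x / b x" by (simp add: sm[OF x])
      finally show ?thesis by (simp add: g2_def diff_divide_distrib)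
    qed
    ultimately have "((\<lambda>x. s x * flux g x) has_real_derivative g2 x) (at x)" by simp
    then show ?thesis
      by (rule has_field_derivative_transform_within_open[of _ _ _ J]) (use x d1 in simp_all)
  qed
  have d2: "deriv (deriv (pot g)) x = g2 x" if "x \<in> J" for x
    by (rule DERIV_imp_deriv[OF D2[OF that]])
  have "continuous_on J g2"
    unfolding g2_def using b_pos
    by (intro continuous_intros C_I_cont_J[OF g] a_cont b_cont s_cont flux_cont_J[OF gF]) force
  then have "continuous_on J (deriv (deriv (pot g)))"
    by (rule continuous_on_eq) (simp add: d2)
  moreover have "pot g differentiable_on J" by (rule differentiable_onI[OF DERIV_pot[OF gF zero]])
  moreover have "deriv (pot g) differentiable_on J" by (rule differentiable_onI[OF D2])
  ultimately show "pot g \<in> C2_int" by (simp add: C2_int_def)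
  show "diff_op a b (pot g) x = g x" if x: "x \<in> J" for x
    using b_pos[OF x] by (simp add: diff_op_def d1[OF x] d2[OF x] g2_def field_simps)
  have q: "deriv (pot g) x / s x = flux g x" if "x \<in> J" for x
    using d1[OF that] s_pos[of x] by simp
  have lims: "(flux g \<longlongrightarrow> flux g 0) (at 0 within {0..1})" "(flux g \<longlongrightarrow> flux g 1) (at 1 within {0..1})"
    using flux_cont[OF gF] by (simp_all add: continuous_on_def)
  have "(flux g \<longlongrightarrow> 0) (at_right 0)"
    using lims(1) by (simp add: at_within_Icc_at_right flux_def)
  moreover have "eventually (\<lambda>x. flux g x = deriv (pot g) x / s x) (at_right 0)"
    by (rule eventually_mono[OF eventually_at_right_real[of 0 1]]) (simp_all add: q)
  ultimately show "zero_flux0 a b c (pot g)"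
    unfolding zero_flux0_def by (rule Lim_transform_eventually)
  have "(flux g \<longlongrightarrow> 0) (at_left 1)"
    using lims(2) zero by (simp add: at_within_Icc_at_left)
  moreover have "eventually (\<lambda>x. flux g x = deriv (pot g) x / s x) (at_left 1)"
    by (rule eventually_mono[OF eventually_at_left_real[of 0 1]]) (simp_all add: q)
  ultimately show "zero_flux1 a b c (pot g)"
    unfolding zero_flux1_def by (rule Lim_transform_eventually)
qed

text \<open>The bound is uniform in x and is an integral that the envelope dominates for bounded
  centred g, so it tends to zero along suitable sequences.\<close>

lemma pot_abs_le:
  assumes g: "g \<in> F_I" and zero: "flux g 1 = 0" and x: "x \<in> {0..1}"
  shows "\<bar>pot g x\<bar> \<le> (LINT y:J|lborel. \<bar>s y * flux g y\<bar>)"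
proof -
  have i: "set_integrable lborel J (\<lambda>y. \<bar>s y * flux g y\<bar>)"
    using set_integrable_abs[OF s_flux_integrable[OF g zero]] .
  have "\<bar>pot g x\<bar> \<le> cum (\<lambda>y. \<bar>s y * flux g y\<bar>) x"
    unfolding pot_def by (rule abs_cum_le[OF s_flux_integrable[OF g zero] i _ x]) simp
  also have "\<dots> \<le> cum (\<lambda>y. \<bar>s y * flux g y\<bar>) 1"
    by (rule cum_mono[OF i]) (use x in auto)
  finally show ?thesis by (simp add: cum_def)
qed

section \<open>Stationary density and distribution function\<close>

lemma cum_m_pos: "0 < cum m 1"
  using cum_pos[OF m_integrable m_cont m_pos, of 0 1] by simp

lemma p_eq: "p x = m x / cum m 1"
  using lbint_at_0_eq[of 1 m] by (simp add: stat_dens_def cum_def one_ereal_def)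

lemma p_pos: "x \<in> J \<Longrightarrow> 0 < p x"
  by (simp add: p_eq m_pos cum_m_pos)

lemma p_cont: "continuous_on J p"
  unfolding p_eq using cum_m_pos by (intro continuous_intros m_cont) auto

lemma p_integrable: "set_integrable lborel J p"
  unfolding p_eq using m_integrable by simp

lemma pf_integrable: "f \<in> F_I \<Longrightarrow> set_integrable lborel J (\<lambda>y. p y * f y)"
  by (rule set_integrable_bounded_mult[OF p_integrable]) (simp_all add: p_pos less_imp_le)

lemma cum_pf: "cum (\<lambda>y. p y * f y) x = cum (\<lambda>y. m y * f y) x / cum m 1"
  using cum_scale[of "inverse (cum m 1)" "\<lambda>y. m y * f y" x] by (simp add: p_eq divide_inverse mult_ac)

abbreviation "F \<equiv> cum p"

lemma F_1 [simp]: "F 1 = 1"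
  using cum_pf[of "\<lambda>_. 1" 1] cum_m_pos by simp

lemma F_strict_mono: "0 \<le> x \<Longrightarrow> x < y \<Longrightarrow> y \<le> 1 \<Longrightarrow> F x < F y"
  by (rule cum_pos[OF p_integrable p_cont]) (simp_all add: p_pos)

lemma F_mono: "0 \<le> x \<Longrightarrow> x \<le> y \<Longrightarrow> y \<le> 1 \<Longrightarrow> F x \<le> F y"
  using F_strict_mono[of x y] by (cases "x = y") auto

lemma F_pos: "0 < x \<Longrightarrow> x \<le> 1 \<Longrightarrow> 0 < F x"
  using F_strict_mono[of 0 x] by simp

lemma F_nonneg: "x \<in> {0..1} \<Longrightarrow> 0 \<le> F x"
  using F_mono[of 0 x] by simp

lemma F_le_1: "x \<in> {0..1} \<Longrightarrow> F x \<le> 1"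
  using F_mono[of x 1] by simp

lemma F_cont: "continuous_on {0..1} F"
  by (rule continuous_on_cum[OF p_integrable])

lemma F_F_I: "F \<in> F_I"
  by (rule C_I_F_I) (simp add: C_I_def F_cont)

section \<open>Averages over initial segments\<close>

lemma Lambda_0 [simp]: "Lambda a b c f 0 = f 0"
  by (simp add: Lambda_def)

lemma Lambda_eq:
  assumes "0 < x" "x \<le> 1"
  shows "Lambda a b c f x = cum (\<lambda>y. p y * f y) x / F x"
proof -
  have cdf: "stat_cdf a b c x = F x"
    using lbint_at_0_eq[of x p] assms by (simp add: stat_cdf_def cum_def)
  have "Lambda a b c f x = cum (\<lambda>y. inverse (F x) * (p y * f y)) x"
    using lbint_at_0_eq[of x "\<lambda>y. p y / F x * f y"] assms
    by (simp add: Lambda_def cdf cum_def divide_inverse mult_ac)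
  then show ?thesis by (simp only: cum_scale) (simp add: divide_inverse mult.commute)
qed

lemma cum_p_mono:
  assumes "f \<in> F_I" "g \<in> F_I" "\<And>y. y \<in> J \<Longrightarrow> f y \<le> g y" "x \<in> {0..1}"
  shows "cum (\<lambda>y. p y * f y) x \<le> cum (\<lambda>y. p y * g y) x"
  unfolding cum_def
proof (rule set_integral_mono)
  show "set_integrable lborel {0<..<x} (\<lambda>y. p y * f y)" "set_integrable lborel {0<..<x} (\<lambda>y. p y * g y)"
    by (rule set_integrable_Ioo_subset[OF pf_integrable]; use assms in simp)+
  show "p y * f y \<le> p y * g y" if "y \<in> {0<..<x}" for y
    using that assms(3)[of y] assms(4) p_pos[of y] by (intro mult_left_mono) auto
qed

lemma cum_p_tendsto:
  assumes f: "\<And>n. f n \<in> F_I" and g: "g \<in> F_I"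
    and bd: "\<And>n y. y \<in> J \<Longrightarrow> \<bar>f n y\<bar> \<le> B" and lim: "\<And>y. y \<in> J \<Longrightarrow> (\<lambda>n. f n y) \<longlonglongrightarrow> g y" and x: "x \<in> {0..1}"
  shows "(\<lambda>n. cum (\<lambda>y. p y * f n y) x) \<longlonglongrightarrow> cum (\<lambda>y. p y * g y) x"
  unfolding cum_def set_lebesgue_integral_def
proof (rule integral_dominated_convergence[where w = "\<lambda>y. indicator {0<..<x} y *\<^sub>R (B * p y)"])
  have sub: "set_integrable lborel {0<..<x} (\<lambda>y. p y * h y)" if "h \<in> F_I" for h
    using x by (intro set_integrable_Ioo_subset[OF pf_integrable[OF that]]) auto
  show "(\<lambda>y. indicator {0<..<x} y *\<^sub>R (p y * g y)) \<in> borel_measurable lborel"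
    using sub[OF g] unfolding set_integrable_def by (rule borel_measurable_integrable)
  show "(\<lambda>y. indicator {0<..<x} y *\<^sub>R (p y * f n y)) \<in> borel_measurable lborel" for n
    using sub[OF f] unfolding set_integrable_def by (rule borel_measurable_integrable)
  show "integrable lborel (\<lambda>y. indicator {0<..<x} y *\<^sub>R (B * p y))"
    using sub[of "\<lambda>_. B"] C_I_F_I[OF const_C_I[of B]] unfolding set_integrable_def by (simp add: mult.commute)
  show "AE y in lborel. (\<lambda>n. indicator {0<..<x} y *\<^sub>R (p y * f n y)) \<longlonglongrightarrow> indicator {0<..<x} y *\<^sub>R (p y * g y)"
    using lim x by (intro AE_I2) (auto simp: indicator_def intro!: tendsto_mult)
  show "AE y in lborel. norm (indicator {0<..<x} y *\<^sub>R (p y * f n y)) \<le> indicator {0<..<x} y *\<^sub>R (B * p y)" for n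
  proof (rule AE_I2)
    fix y show "norm (indicator {0<..<x} y *\<^sub>R (p y * f n y)) \<le> indicator {0<..<x} y *\<^sub>R (B * p y)"
    proof (cases "y \<in> {0<..<x}")
      case True
      then have "y \<in> J" using x by auto
      then show ?thesis using True bd[of y n] p_pos[of y] by (simp add: abs_mult mult.commute)
    qed simp
  qed
qed

lemma Lambda_abs_le:
  assumes f: "f \<in> F_I" "\<And>y. y \<in> {0..1} \<Longrightarrow> \<bar>f y\<bar> \<le> B" and x: "x \<in> {0..1}"
  shows "\<bar>Lambda a b c f x\<bar> \<le> B"
proof (cases "x = 0")
  case True then show ?thesis using f(2)[of 0] by simp
next
  case False
  then have Fx: "0 < F x" using x F_pos[of x] by auto
  have "\<bar>cum (\<lambda>y. p y * f y) x\<bar> \<le> cum (\<lambda>y. B * p y) x"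
  proof (rule abs_cum_le[OF pf_integrable[OF f(1)] set_integrable_mult_right[OF p_integrable] _ x])
    show "\<bar>p y * f y\<bar> \<le> B * p y" if "y \<in> J" for y
      using that f(2)[of y] p_pos[OF that] by (simp add: abs_mult mult.commute)
  qed
  then have "\<bar>cum (\<lambda>y. p y * f y) x\<bar> \<le> B * F x" by (simp only: cum_scale)
  then show ?thesis using Fx False x by (simp add: Lambda_eq abs_divide pos_divide_le_eq)
qed

lemma Lambda_diff:
  assumes "f \<in> F_I" "g \<in> F_I" "x \<in> {0..1}"
  shows "Lambda a b c (\<lambda>y. f y - g y) x = Lambda a b c f x - Lambda a b c g x"
proof (cases "x = 0")
  case False
  then show ?thesis
    using cum_diff[OF pf_integrable[OF assms(1)] pf_integrable[OF assms(2)] assms(3)] assms(3)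
    by (simp add: Lambda_eq right_diff_distrib diff_divide_distrib)
qed simp

lemma Lambda_scale:
  assumes "x \<in> {0..1}" shows "Lambda a b c (\<lambda>y. k * f y) x = k * Lambda a b c f x"
proof (cases "x = 0")
  case False
  have "cum (\<lambda>y. p y * (k * f y)) x = k * cum (\<lambda>y. p y * f y) x"
    unfolding cum_scale[symmetric] by (simp add: mult.left_commute)
  then show ?thesis using False assms by (simp add: Lambda_eq)
qed simp

lemma Lambda_cong:
  assumes "\<And>y. y \<in> {0..1} \<Longrightarrow> f y = g y" "x \<in> {0..1}"
  shows "Lambda a b c f x = Lambda a b c g x"
proof (cases "x = 0")
  case False
  have "cum (\<lambda>y. p y * f y) x = cum (\<lambda>y. p y * g y) x"
    unfolding cum_def using assms by (intro set_lebesgue_integral_cong) auto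
  then show ?thesis using False assms by (simp add: Lambda_eq)
qed (use assms in simp)

lemma Lambda_const: "x \<in> {0..1} \<Longrightarrow> Lambda a b c (\<lambda>_. k) x = k"
proof (cases "x = 0")
  case False
  moreover assume "x \<in> {0..1}"
  ultimately have x: "0 < x" "x \<le> 1" by auto
  have "cum (\<lambda>y. p y * k) x = k * F x" by (subst mult.commute) (rule cum_scale)
  then show ?thesis using F_pos[OF x] by (simp add: Lambda_eq[OF x])
qed simp

lemma Lambda_mono:
  assumes "f \<in> F_I" "g \<in> F_I" "\<And>y. y \<in> {0..1} \<Longrightarrow> f y \<le> g y" "x \<in> {0..1}"
  shows "Lambda a b c f x \<le> Lambda a b c g x"
proof (cases "x = 0")
  case False
  then show ?thesis using cum_p_mono[OF assms(1,2) _ assms(4)] assms(3,4) F_pos[of x]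
    by (simp add: Lambda_eq divide_right_mono)
qed (use assms(3)[of 0] in simp)

lemma cum_p_indicator:
  assumes y: "y \<in> J" and x: "x \<in> {0..1}"
  shows "cum (\<lambda>z. p z * indicator {y..1} z) x = max 0 (F x - F y)"
proof (cases "x \<le> y")
  case True
  have "cum (\<lambda>z. p z * indicator {y..1} z) x = cum (\<lambda>z. 0) x"
    unfolding cum_def using True by (intro set_lebesgue_integral_cong) auto
  then show ?thesis using True F_mono[of x y] x y by (simp add: cum_def set_lebesgue_integral_def)
next
  case False
  have "cum (\<lambda>z. p z * indicator {y..1} z) x = (LINT z:{y<..<x}|lborel. p z)"
    unfolding cum_def set_lebesgue_integral_def
  proof (rule integral_cong_AE)
    have ind: "indicator {y..1} \<in> F_I"
      by (rule F_I_I[of _ 1]) (auto intro!: measurable_I_borelI simp: indicator_def)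
    have "set_integrable lborel {0<..<x} (\<lambda>z. p z * indicator {y..1} z)"
      by (rule set_integrable_Ioo_subset[OF pf_integrable[OF ind]]) (use x in auto)
    then show "(\<lambda>z. indicator {0<..<x} z *\<^sub>R (p z * indicator {y..1} z)) \<in> borel_measurable lborel"
      unfolding set_integrable_def by (rule borel_measurable_integrable)
    have "set_integrable lborel {y<..<x} p"
      by (rule set_integrable_Ioo_subset[OF p_integrable]) (use x y in auto)
    then show "(\<lambda>z. indicator {y<..<x} z *\<^sub>R p z) \<in> borel_measurable lborel"
      unfolding set_integrable_def by (rule borel_measurable_integrable)
    show "AE z in lborel. indicator {0<..<x} z *\<^sub>R (p z * indicator {y..1} z) = indicator {y<..<x} z *\<^sub>R p z"
      using AE_lborel_singleton[of y]
      by eventually_elim (use x y in \<open>auto simp: indicator_def\<close>)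
  qed
  also have "\<dots> = F x - F y" by (rule LINT_Ioo_eq_cum_diff[OF p_integrable]) (use False x y in auto)
  finally show ?thesis using F_mono[of y x] False x y by simp
qed

text \<open>The point 0 stands apart: \<open>F 0 = 0\<close> and division by zero would give 1,
  whereas evaluation at 0 gives 0. Beyond y the value grows strictly up to 1 - F y at x = 1, which
  later singles out the state 1.\<close>

lemma Lambda_indicator:
  assumes y: "y \<in> J" and x: "x \<in> {0..1}"
  shows "Lambda a b c (indicator {y..1}) x = (if x = 0 then 0 else max 0 (1 - F y / F x))"
proof (cases "x = 0")
  case True then show ?thesis using y by simp
next
  case False
  then have x': "0 < x" "x \<le> 1" using x by auto
  show ?thesis
    using F_pos[OF x'] False by (simp add: Lambda_eq[OF x'] cum_p_indicator[OF y x] max_def field_simps)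
qed

end

locale diffusion = diffusion_coefficients a b c + feller_diffusion \<Omega> Q X
  for a b c and \<Omega> :: "'w measure" and Q X +
  assumes generator: "has_diffusion_generator Q X a b c"
begin

text \<open>The description of the domain refers to the domain itself through the conditions at
  reflecting ends. Potentials have zero flux at both ends and so belong to it in every case. The
  generator is found in the interior first and then extended by continuity.\<close>

lemma pot_gen_dom:
  assumes g: "g \<in> C_I" and zero: "flux g 1 = 0"
  shows "pot g \<in> gen_dom Q X" "x \<in> {0..1} \<Longrightarrow> gen Q X (pot g) x = g x"
proof -
  have "pot g \<in> {f \<in> C_I \<inter> C2_int. (\<exists>g\<in>C_I. \<forall>x\<in>{0<..<1}. g x = diff_op a b f x) \<and>
       (reflecting0 a b c (gen_dom Q X) \<longrightarrow> zero_flux0 a b c f) \<and>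
       (reflecting1 a b c (gen_dom Q X) \<longrightarrow> zero_flux1 a b c f)}"
    using pot_C_I[OF C_I_F_I[OF g] zero] pot_generator[OF g zero] g by force
  then show dom: "pot g \<in> gen_dom Q X"
    using generator unfolding has_diffusion_generator_def by blast
  have "gen Q X (pot g) x = g x" if "x \<in> J" for x
    using generator dom pot_generator(2)[OF g zero that] that unfolding has_diffusion_generator_def by simp
  then show "gen Q X (pot g) x = g x" if "x \<in> {0..1}"
    by (rule C_I_eqI[OF gen_uniform_limit(1)[OF dom] g _ that])
qed

section \<open>Test functions in the domain\<close>

lemma step_approx:
  assumes l: "0 < l" "l < u" "u < 1"
  obtains f where "f \<in> gen_dom Q X" "\<And>x. x \<in> {0..1} \<Longrightarrow> 0 \<le> f x" "\<And>x. x \<in> {0..1} \<Longrightarrow> f x \<le> 1"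
    "\<And>x. x \<in> {0..l} \<Longrightarrow> f x = 0" "\<And>x. x \<in> {u..1} \<Longrightarrow> f x = 1"
proof -
  \<comment> \<open>The flux is prescribed and g computed from it. With flux q^2, where q is the
    positive part of (z - l)(u - z), the potential is constant outside [l,u] and increasing inside,
    and 2 m g = (q^2)' determines g.\<close>
  define q where "q z = max 0 ((z - l) * (u - z))" for z
  define g where "g z = q z * (l + u - 2 * z) / m (max l (min u z))" for z
  have clamp: "max l (min u z) \<in> J" for z using l by auto
  have q_pos: "0 < q z" if "l < z" "z < u" for z using that by (simp add: q_def)
  have q_0: "q z = 0" if "z \<le> l \<or> u \<le> z" for z
  proof -
    have "(z - l) * (u - z) \<le> 0" using that l by (auto simp: mult_le_0_iff)
    then show ?thesis by (simp add: q_def)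
  qed
  have "continuous_on {0..1} (\<lambda>z. m (max l (min u z)))"
  proof (rule continuous_on_compose2[OF m_cont])
    show "continuous_on {0..1} (\<lambda>z. max l (min u z))"
      by (intro continuous_on_max continuous_on_min continuous_on_const continuous_on_id)
  qed (intro image_subsetI clamp)
  note mc = this
  have "m (max l (min u z)) \<noteq> 0" for z using m_pos[OF clamp[of z]] by simp
  then have "continuous_on {0..1} g"
    unfolding g_def q_def by (intro continuous_intros continuous_on_max mc) auto
  then have g: "g \<in> C_I" by (simp add: C_I_def)
  note gF = C_I_F_I[OF g]
  have mg: "m z * g z = q z * (l + u - 2 * z)" if "z \<in> J" for z
  proof (cases "l < z \<and> z < u")
    case True
    then have "max l (min u z) = z" by auto
    then show ?thesis using m_pos[OF that] by (simp add: g_def)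
  next
    case False then show ?thesis using q_0[of z] by (auto simp: g_def)
  qed
  have flux: "flux g z = (q z)\<^sup>2" if z: "z \<in> {0..1}" for z
  proof -
    have "cum (\<lambda>z. m z * g z) z = (q z)\<^sup>2 / 2"
    proof (rule eq_cum[OF mg_integrable[OF gF] _ _ _ _ z])
      show "continuous_on J (\<lambda>z. m z * g z)" by (intro continuous_intros m_cont C_I_cont_J[OF g])
      show "continuous_on {0..1} (\<lambda>z. (q z)\<^sup>2 / 2)" unfolding q_def by (intro continuous_intros continuous_on_max) auto
      show "(q 0)\<^sup>2 / 2 = 0" using q_0[of 0] l by simp
      fix x assume x: "x \<in> J"
      have "((\<lambda>z. (z - l) * (u - z)) has_real_derivative (l + u - 2 * x)) (at x)"
        by (auto intro!: derivative_eq_intros)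
      from DERIV_cdivide[OF DERIV_chain2[OF DERIV_pos_part_square this], of 2]
      show "((\<lambda>z. (q z)\<^sup>2 / 2) has_real_derivative m x * g x) (at x)"
        by (simp add: q_def[abs_def] mg[OF x])
    qed
    then show ?thesis by (simp add: flux_def)
  qed
  have zero: "flux g 1 = 0" using flux[of 1] q_0[of 1] l by simp
  define f where "f = pot g"
  have nonneg: "0 \<le> s z * flux g z" if "z \<in> J" for z
    using flux[of z] that s_pos[of z] by simp
  have mono: "f x \<le> f y" if "0 \<le> x" "x \<le> y" "y \<le> 1" for x y
    unfolding f_def pot_def using that by (intro cum_mono s_flux_integrable gF zero nonneg)
  have low: "f x = 0" if "x \<in> {0..l}" for x
  proof -
    have "f x = cum (\<lambda>_. 0) x"
      unfolding f_def pot_def cum_def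
      by (rule set_lebesgue_integral_cong) (use that l flux q_0 in auto)
    then show ?thesis by (simp add: cum_def set_lebesgue_integral_def)
  qed
  have high: "f x = f u" if "x \<in> {u..1}" for x
  proof -
    have "cum (\<lambda>y. s y * flux g y) x - cum (\<lambda>y. s y * flux g y) u = (LINT y:{u<..<x}|lborel. s y * flux g y)"
      by (rule LINT_Ioo_eq_cum_diff[symmetric, OF s_flux_integrable[OF gF zero]]) (use that l in auto)
    also have "\<dots> = (LINT y:{u<..<x}|lborel. 0)"
      by (rule set_lebesgue_integral_cong) (use that l flux q_0 in auto)
    finally show ?thesis by (simp add: f_def pot_def set_lebesgue_integral_def)
  qed
  have "f l < f u"
  proof (rule DERIV_pos_imp_increasing_open[OF l(2)])
    show "\<exists>d. (f has_real_derivative d) (at z) \<and> 0 < d" if "l < z" "z < u" for z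
      using that l DERIV_pot[OF gF zero, of z] q_pos[OF that] s_pos[of z] flux[of z]
      by (intro exI[of _ "s z * flux g z"]) (auto simp: f_def)
    show "continuous_on {l..u} f"
      using pot_C_I[OF gF zero] l unfolding f_def C_I_def by (auto elim: continuous_on_subset)
  qed
  then have fu: "0 < f u" using low[of l] l by simp
  show thesis
  proof (rule that[of "\<lambda>x. inverse (f u) * f x"])
    show "(\<lambda>x. inverse (f u) * f x) \<in> gen_dom Q X"
      unfolding f_def by (rule gen_dom_scale[OF pot_gen_dom(1)[OF g zero]])
    fix x :: real assume x: "x \<in> {0..1}"
    have "f 0 \<le> f x" using mono[of 0 x] x by simp
    then have "0 \<le> f x" using low[of 0] l by simp
    moreover have "f x \<le> f u"
    proof (cases "x \<le> u")
      case True then show ?thesis using mono[of x u] x l by simp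
    next
      case False then have "x \<in> {u..1}" using x by simp
      from high[OF this] show ?thesis by simp
    qed
    ultimately show "0 \<le> inverse (f u) * f x" "inverse (f u) * f x \<le> 1"
      using fu by (simp_all add: field_simps)
  next
    show "inverse (f u) * f x = 0" if "x \<in> {0..l}" for x using low[OF that] by simp
    show "inverse (f u) * f x = 1" if "x \<in> {u..1}" for x using high[OF that] fu by simp
  qed
qed

text \<open>The rise is placed on [l n, y], to the left of y, with l n tending to y. Convergence
  then holds at every point including y, so limits may be taken under laws that could have
  atoms.\<close>

lemma indicator_approx:
  assumes y: "y \<in> J"
  obtains f where "\<And>n. f n \<in> gen_dom Q X" "\<And>n x. x \<in> {0..1} \<Longrightarrow> \<bar>f n x\<bar> \<le> 1"
    "\<And>x. x \<in> {0..1} \<Longrightarrow> (\<lambda>n. f n x) \<longlonglongrightarrow> indicator {y..1} x"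
proof -
  define l where "l n = y - y * inverse (real (Suc (Suc n)))" for n
  have "\<exists>f. f \<in> gen_dom Q X \<and> (\<forall>x\<in>{0..1}. \<bar>f x\<bar> \<le> 1) \<and> (\<forall>x\<in>{0..l n}. f x = 0) \<and> (\<forall>x\<in>{y..1}. f x = 1)" for n
  proof -
    have "inverse (real (Suc (Suc n))) < 1" by (rule inverse_less_1_iff[THEN iffD2]) simp
    then have "y * inverse (real (Suc (Suc n))) < y * 1" using y by (intro mult_strict_left_mono) auto
    moreover have "0 < y * inverse (real (Suc (Suc n)))" using y by simp
    ultimately have ln: "0 < l n" "l n < y" by (simp_all add: l_def)
    have y1: "y < 1" using y by simp
    obtain f where "f \<in> gen_dom Q X" "\<And>x. x \<in> {0..1} \<Longrightarrow> 0 \<le> f x" "\<And>x. x \<in> {0..1} \<Longrightarrow> f x \<le> 1"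
      "\<And>x. x \<in> {0..l n} \<Longrightarrow> f x = 0" "\<And>x. x \<in> {y..1} \<Longrightarrow> f x = 1"
      by (rule step_approx[OF ln y1]) (rule that)
    then show ?thesis by (intro exI[of _ f] conjI ballI) simp_all
  qed
  then obtain f where f: "\<And>n. f n \<in> gen_dom Q X" "\<And>n x. x \<in> {0..1} \<Longrightarrow> \<bar>f n x\<bar> \<le> 1"
    "\<And>n x. x \<in> {0..l n} \<Longrightarrow> f n x = 0" "\<And>n x. x \<in> {y..1} \<Longrightarrow> f n x = 1" by metis
  have "(\<lambda>n. f n x) \<longlonglongrightarrow> indicator {y..1} x" if x: "x \<in> {0..1}" for x
  proof (cases "y \<le> x")
    case True
    then show ?thesis using f(4)[of x] x by simp
  next
    case False
    have "l \<longlonglongrightarrow> y - y * 0"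
      unfolding l_def using LIMSEQ_Suc[OF LIMSEQ_inverse_real_of_nat] by (intro tendsto_intros)
    then have "eventually (\<lambda>n. x < l n) sequentially"
      using False by (intro order_tendstoD(1)) auto
    then have "eventually (\<lambda>n. f n x = 0) sequentially"
      by (rule eventually_mono) (use x f(3) in simp)
    then show ?thesis using False by (simp add: tendsto_eventually)
  qed
  with f(1,2) show thesis by (rule that)
qed

section \<open>Identification of the invariant law\<close>

lemma integral_gen_invariant:
  assumes inv: "invariant_distribution Q X \<mu>" and f: "f \<in> gen_dom Q X"
  shows "(\<integral>x. gen Q X f x \<partial>\<mu>) = 0"
proof -
  have \<mu>: "\<mu> \<in> space (prob_algebra I_borel)" and law: "\<And>t. 0 \<le> t \<Longrightarrow> law_at Q X \<mu> t = \<mu>"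
    using inv by (auto simp: invariant_distribution_def)
  have pr: "prob_space \<mu>" "sets \<mu> = sets I_borel" using \<mu> by (auto simp: space_prob_algebra)
  note fF = C_I_F_I[OF gen_dom_C_I[OF f]] and gF = C_I_F_I[OF gen_uniform_limit(1)[OF f]]
  \<comment> \<open>Invariance makes P_h f - f integrate to zero for every h, and h A f differs from
    it by at most e h uniformly; one small h suffices for each e.\<close>
  have "\<bar>\<integral>x. gen Q X f x \<partial>\<mu>\<bar> \<le> e" if e: "0 < e" for e
  proof -
    have "\<exists>h. 0 < h \<and> (\<forall>x\<in>{0..1}. \<bar>P_op Q X h f x - f x - h * gen Q X f x\<bar> \<le> e * h)"
      by (rule eventually_happens'[OF trivial_limit_at_right_real
          eventually_conj[OF eventually_at_right_less[of "0::real"] gen_increment_le[OF f e]]])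
    then obtain h where h: "0 < h" and le: "\<And>x. x \<in> {0..1} \<Longrightarrow> \<bar>P_op Q X h f x - f x - h * gen Q X f x\<bar> \<le> e * h"
      by metis
    have PF: "P_op Q X h f \<in> F_I" using h by (intro P_op_F_I fF) simp
    have "(\<integral>x. P_op Q X h f x - f x - h * gen Q X f x \<partial>\<mu>)
        = (\<integral>x. P_op Q X h f x \<partial>\<mu>) - (\<integral>x. f x \<partial>\<mu>) - h * (\<integral>x. gen Q X f x \<partial>\<mu>)"
      using F_I_integrable[OF pr PF] F_I_integrable[OF pr fF] F_I_integrable[OF pr gF] by simp
    also have "(\<integral>x. P_op Q X h f x \<partial>\<mu>) = (\<integral>x. f x \<partial>\<mu>)"
      using integral_law_at[OF \<mu> less_imp_le[OF h] fF] law[OF less_imp_le[OF h]] by simp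
    finally have "\<bar>h * (\<integral>x. gen Q X f x \<partial>\<mu>)\<bar> = \<bar>\<integral>x. P_op Q X h f x - f x - h * gen Q X f x \<partial>\<mu>\<bar>" by simp
    also have "\<dots> \<le> e * h"
      by (rule F_I_integral_abs_le[OF pr _ le]) (intro F_I_diff PF fF F_I_scale gF)
    finally have "h * \<bar>\<integral>x. gen Q X f x \<partial>\<mu>\<bar> \<le> h * e" using h by (simp add: abs_mult mult.commute)
    then show ?thesis using h by simp
  qed
  then have "\<bar>\<integral>x. gen Q X f x \<partial>\<mu>\<bar> \<le> 0" using field_le_epsilon[of _ "0::real"] by (metis add_0)
  then show ?thesis by simp
qed

lemma flux_centered:
  assumes g: "g \<in> F_I" shows "flux (\<lambda>x. g x - cum (\<lambda>y. p y * g y) 1) 1 = 0"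
proof -
  let ?k = "cum (\<lambda>y. p y * g y) 1"
  have kF: "(\<lambda>_. ?k) \<in> F_I" by (intro C_I_F_I const_C_I)
  have "cum (\<lambda>y. p y * (g y - ?k)) 1 = ?k - cum (\<lambda>y. p y * ?k) 1"
    using cum_diff[OF pf_integrable[OF g] pf_integrable[OF kF], of 1] by (simp add: right_diff_distrib)
  also have "cum (\<lambda>y. p y * ?k) 1 = ?k" 
    unfolding mult.commute[of "p _" ?k] cum_scale by simp
  finally show ?thesis using cum_m_pos by (simp add: cum_pf flux_def)
qed

lemma integral_invariant:
  assumes inv: "invariant_distribution Q X \<mu>" and g: "g \<in> C_I"
  shows "(\<integral>x. g x \<partial>\<mu>) = cum (\<lambda>y. p y * g y) 1"
proof -
  let ?k = "cum (\<lambda>y. p y * g y) 1"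
  have pr: "prob_space \<mu>" "sets \<mu> = sets I_borel"
    using inv by (auto simp: invariant_distribution_def space_prob_algebra)
  interpret \<mu>: prob_space \<mu> by fact
  have sp: "space \<mu> = {0..1}" using sets_eq_imp_space_eq[OF pr(2)] by simp
  have gk: "(\<lambda>x. g x - ?k) \<in> C_I" using g by (simp add: C_I_def continuous_on_diff)
  note fl = flux_centered[OF C_I_F_I[OF g]]
  have "0 = (\<integral>x. gen Q X (pot (\<lambda>x. g x - ?k)) x \<partial>\<mu>)"
    by (rule integral_gen_invariant[OF inv pot_gen_dom(1)[OF gk fl], symmetric])
  also have "\<dots> = (\<integral>x. g x - ?k \<partial>\<mu>)"
    by (rule Bochner_Integration.integral_cong[OF refl], rule pot_gen_dom(2)[OF gk fl], unfold sp)
  also have "\<dots> = (\<integral>x. g x \<partial>\<mu>) - ?k"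
    using F_I_integrable[OF pr C_I_F_I[OF g]] by (simp add: \<mu>.prob_space)
  finally show ?thesis by simp
qed

end

section \<open>Intertwined diffusions\<close>

locale intertwined_diffusions = diffusion a b c \<Omega> Q X + dual: feller_diffusion \<Omega>s Qs Xs
  for a b c and \<Omega> :: "'w measure" and Q X and \<Omega>s :: "'v measure" and Qs Xs +
  fixes \<mu> :: "real measure"
  assumes Lambda_dom: "f \<in> gen_dom Q X \<Longrightarrow> Lambda a b c f \<in> gen_dom Qs Xs"
    and Lambda_gen: "\<lbrakk>f \<in> gen_dom Q X; x \<in> {0..1}\<rbrakk> \<Longrightarrow>
      Lambda a b c (gen Q X f) x = gen Qs Xs (Lambda a b c f) x"
    and invariant: "invariant_distribution Q X \<mu>"
begin

abbreviation "\<Lambda> \<equiv> Lambda a b c"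
abbreviation "P \<equiv> P_op Q X"
abbreviation "Ps \<equiv> P_op Qs Xs"

section \<open>From intertwined generators to intertwined semigroups\<close>

lemma gen_dom_F_I: "f \<in> gen_dom Q X \<Longrightarrow> f \<in> F_I"
  by (intro C_I_F_I gen_dom_C_I)

lemma Lambda_gen_dom_F_I: "f \<in> gen_dom Q X \<Longrightarrow> \<Lambda> f \<in> F_I"
  by (intro C_I_F_I dual.gen_dom_C_I Lambda_dom)

text \<open>To first order both terms equal \<open>\<Lambda> f\<close> plus h times
  \<open>gen Qs Xs (\<Lambda> f)\<close>: the second by definition of the generator, the first
  because averaging is a contraction and carries A f to that function.\<close>

lemma intertwining_increment:
  assumes f: "f \<in> gen_dom Q X" and e: "0 < e"
  shows "eventually (\<lambda>h. \<forall>x\<in>{0..1}. \<bar>\<Lambda> (P h f) x - Ps h (\<Lambda> f) x\<bar> \<le> e * h) (at_right 0)"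
proof -
  have e2: "0 < e / 2" using e by simp
  note fF = gen_dom_F_I[OF f] and gF = C_I_F_I[OF gen_uniform_limit(1)[OF f]]
  show ?thesis
    using gen_increment_le[OF f e2] dual.gen_increment_le[OF Lambda_dom[OF f] e2] eventually_at_right_less[of "0::real"]
  proof (eventually_elim, intro ballI)
    fix h x :: real
    assume 1: "\<forall>x\<in>{0..1}. \<bar>P h f x - f x - h * gen Q X f x\<bar> \<le> e / 2 * h"
      and 2: "\<forall>x\<in>{0..1}. \<bar>Ps h (\<Lambda> f) x - \<Lambda> f x - h * gen Qs Xs (\<Lambda> f) x\<bar> \<le> e / 2 * h"
      and h: "0 < h" and x: "x \<in> {0..1}"
    have PF: "P h f \<in> F_I" using h by (intro P_op_F_I fF) simp
    have "\<bar>\<Lambda> (\<lambda>x. P h f x - f x - h * gen Q X f x) x\<bar> \<le> e / 2 * h"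
      by (rule Lambda_abs_le[OF F_I_diff[OF F_I_diff[OF PF fF] F_I_scale[OF gF]] _ x]) (use 1 in blast)
    also have "\<Lambda> (\<lambda>x. P h f x - f x - h * gen Q X f x) x = \<Lambda> (P h f) x - \<Lambda> f x - h * gen Qs Xs (\<Lambda> f) x"
      by (simp only: Lambda_diff[OF F_I_diff[OF PF fF] F_I_scale[OF gF] x] Lambda_diff[OF PF fF x] Lambda_scale[OF x]
          Lambda_gen[OF f x])
    finally have "\<bar>\<Lambda> (P h f) x - \<Lambda> f x - h * gen Qs Xs (\<Lambda> f) x\<bar> \<le> e / 2 * h" .
    moreover have "\<bar>Ps h (\<Lambda> f) x - \<Lambda> f x - h * gen Qs Xs (\<Lambda> f) x\<bar> \<le> e / 2 * h" using 2 x by blast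
    ultimately show "\<bar>\<Lambda> (P h f) x - Ps h (\<Lambda> f) x\<bar> \<le> e * h" by linarith
  qed
qed

text \<open>With g = P_r f, again in the domain, both terms share the outer operator
  \<open>Ps (t - (r + h))\<close>. It is a contraction, so the first-order comparison for g bounds
  the increment.\<close>

lemma intertwining_path_increment:
  assumes f: "f \<in> gen_dom Q X" and x: "x \<in> {0..1}" and r: "0 \<le> r" "r < t" and e: "0 < e"
  shows "eventually (\<lambda>h. \<bar>Ps (t - (r + h)) (\<Lambda> (P (r + h) f)) x - Ps (t - r) (\<Lambda> (P r f)) x\<bar> \<le> e * h) (at_right 0)"
proof -
  note g = gen_dom_P_op(1)[OF f r(1)]
  have "eventually (\<lambda>h. h < t - r) (at_right 0)"
    using r by (intro order_tendstoD(2)[OF tendsto_ident_at]) simp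
  with intertwining_increment[OF g e] eventually_at_right_less[of "0::real"]
  show ?thesis
  proof eventually_elim
    fix h
    assume le: "\<forall>x\<in>{0..1}. \<bar>\<Lambda> (P h (P r f)) x - Ps h (\<Lambda> (P r f)) x\<bar> \<le> e * h" and h: "0 < h" "h < t - r"
    have h0: "0 \<le> h" and u0: "0 \<le> t - (r + h)" using h by auto
    note LgF = Lambda_gen_dom_F_I[OF g] and LPF = Lambda_gen_dom_F_I[OF gen_dom_P_op(1)[OF g h0]]
    have "Ps (t - (r + h)) (\<Lambda> (P (r + h) f)) x = Ps (t - (r + h)) (\<Lambda> (P h (P r f))) x"
    proof (rule dual.P_op_cong[OF x u0], rule Lambda_cong)
      show "P (r + h) f y = P h (P r f) y" if "y \<in> {0..1}" for y
        using P_op_add[OF that h0 r(1) gen_dom_F_I[OF f]] by (simp add: add.commute)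
    qed
    moreover have "Ps (t - r) (\<Lambda> (P r f)) x = Ps (t - (r + h)) (Ps h (\<Lambda> (P r f))) x"
      using dual.P_op_add[OF x u0 h0 LgF] by simp
    ultimately have "Ps (t - (r + h)) (\<Lambda> (P (r + h) f)) x - Ps (t - r) (\<Lambda> (P r f)) x
        = Ps (t - (r + h)) (\<lambda>y. \<Lambda> (P h (P r f)) y - Ps h (\<Lambda> (P r f)) y) x"
      by (simp only: dual.P_op_diff[OF x u0 LPF dual.P_op_F_I[OF h0 LgF]])
    also have "\<bar>\<dots>\<bar> \<le> e * h"
      by (rule dual.P_op_abs_le[OF x u0 F_I_diff[OF LPF dual.P_op_F_I[OF h0 LgF]]]) (use le in blast)
    finally show "\<bar>Ps (t - (r + h)) (\<Lambda> (P (r + h) f)) x - Ps (t - r) (\<Lambda> (P r f)) x\<bar> \<le> e * h" .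
  qed
qed

text \<open>The time r occurs twice. The inner occurrence moves uniformly in the state, since
  averaging and the outer semigroup are contractions; the outer one then moves with a fixed
  continuous function inside.\<close>

lemma intertwining_path_continuous:
  assumes f: "f \<in> gen_dom Q X" and x: "x \<in> {0..1}"
  shows "continuous_on {0..t} (\<lambda>r. Ps (t - r) (\<Lambda> (P r f)) x)"
  unfolding continuous_on_iff
proof (intro ballI allI impI)
  fix r e :: real assume r: "r \<in> {0..t}" and e: "0 < e"
  then have e3: "0 < e / 3" and r0: "0 \<le> r" "0 \<le> t - r" by auto
  obtain \<delta>1 where \<delta>1: "0 < \<delta>1" "\<And>u u' x. \<lbrakk>0 \<le> u; 0 \<le> u'; \<bar>u - u'\<bar> < \<delta>1; x \<in> {0..1}\<rbrakk> \<Longrightarrow> \<bar>P u f x - P u' f x\<bar> \<le> e / 3"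
    using P_op_time_increment[OF gen_dom_C_I[OF f] e3] by blast
  note g = Lambda_dom[OF gen_dom_P_op(1)[OF f r0(1)]]
  obtain \<delta>2 where \<delta>2: "0 < \<delta>2" "\<And>u u' x. \<lbrakk>0 \<le> u; 0 \<le> u'; \<bar>u - u'\<bar> < \<delta>2; x \<in> {0..1}\<rbrakk> \<Longrightarrow>
      \<bar>Ps u (\<Lambda> (P r f)) x - Ps u' (\<Lambda> (P r f)) x\<bar> \<le> e / 3"
    using dual.P_op_time_increment[OF dual.gen_dom_C_I[OF g] e3] by blast
  show "\<exists>d>0. \<forall>r'\<in>{0..t}. dist r' r < d \<longrightarrow> dist (Ps (t - r') (\<Lambda> (P r' f)) x) (Ps (t - r) (\<Lambda> (P r f)) x) < e"
  proof (intro exI[of _ "min \<delta>1 \<delta>2"] conjI ballI impI)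
    show "0 < min \<delta>1 \<delta>2" using \<delta>1(1) \<delta>2(1) by simp
    fix r' assume r': "r' \<in> {0..t}" and d: "dist r' r < min \<delta>1 \<delta>2"
    then have r'0: "0 \<le> r'" "0 \<le> t - r'" and d1: "\<bar>r' - r\<bar> < \<delta>1" and d2: "\<bar>(t - r') - (t - r)\<bar> < \<delta>2"
      by (simp_all add: dist_real_def abs_minus_commute)
    note F1 = Lambda_gen_dom_F_I[OF gen_dom_P_op(1)[OF f r'0(1)]] and F2 = Lambda_gen_dom_F_I[OF gen_dom_P_op(1)[OF f r0(1)]]
    have "\<bar>\<Lambda> (P r' f) y - \<Lambda> (P r f) y\<bar> \<le> e / 3" if y: "y \<in> {0..1}" for y
    proof -
      note PF = P_op_F_I[OF r'0(1) gen_dom_F_I[OF f]] P_op_F_I[OF r0(1) gen_dom_F_I[OF f]]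
      have "\<bar>\<Lambda> (\<lambda>z. P r' f z - P r f z) y\<bar> \<le> e / 3"
        by (rule Lambda_abs_le[OF F_I_diff[OF PF] _ y]) (rule \<delta>1(2)[OF r'0(1) r0(1) d1])
      then show ?thesis by (simp only: Lambda_diff[OF PF y])
    qed
    then have "\<bar>Ps (t - r') (\<lambda>y. \<Lambda> (P r' f) y - \<Lambda> (P r f) y) x\<bar> \<le> e / 3"
      by (rule dual.P_op_abs_le[OF x r'0(2) F_I_diff[OF F1 F2]])
    then have "\<bar>Ps (t - r') (\<Lambda> (P r' f)) x - Ps (t - r') (\<Lambda> (P r f)) x\<bar> \<le> e / 3"
      by (simp only: dual.P_op_diff[OF x r'0(2) F1 F2])
    moreover have "\<bar>Ps (t - r') (\<Lambda> (P r f)) x - Ps (t - r) (\<Lambda> (P r f)) x\<bar> \<le> e / 3"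
      by (rule \<delta>2(2)[OF r'0(2) r0(2) d2 x])
    ultimately show "dist (Ps (t - r') (\<Lambda> (P r' f)) x) (Ps (t - r) (\<Lambda> (P r f)) x) < e"
      using e unfolding dist_real_def by linarith
  qed
qed

lemma intertwining:
  assumes f: "f \<in> gen_dom Q X" and x: "x \<in> {0..1}" and t: "0 \<le> t"
  shows "Ps t (\<Lambda> f) x = \<Lambda> (P t f) x"
proof -
  define w where "w r = Ps (t - r) (\<Lambda> (P r f)) x" for r
  have cont: "continuous_on {0..t} w"
    unfolding w_def by (rule intertwining_path_continuous[OF f x])
  have inc: "eventually (\<lambda>h. \<bar>w (r + h) - w r\<bar> \<le> e * h) (at_right 0)" if "0 \<le> r" "r < t" "0 < e" for r e
    unfolding w_def by (rule intertwining_path_increment[OF f x that])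
  have "w t - w 0 \<ge> 0 * t"
  proof (rule lower_right_derivative_bound[OF cont t])
    fix r e :: real assume "0 \<le> r" "r < t" "0 < e"
    from inc[OF this] show "eventually (\<lambda>h. w (r + h) - w r \<ge> (0 - e) * h) (at_right 0)"
      by eventually_elim (simp add: abs_le_iff)
  qed
  moreover have "- w t - - w 0 \<ge> 0 * t"
  proof (rule lower_right_derivative_bound[OF continuous_on_minus[OF cont] t])
    fix r e :: real assume "0 \<le> r" "r < t" "0 < e"
    from inc[OF this] show "eventually (\<lambda>h. - w (r + h) - - w r \<ge> (0 - e) * h) (at_right 0)"
      by eventually_elim (simp add: abs_le_iff)
  qed
  ultimately have "w 0 = w t" by simp
  moreover have "w 0 = Ps t (\<Lambda> f) x"
    unfolding w_def diff_zero
    by (rule dual.P_op_cong[OF x t], rule Lambda_cong) (rule P_op_0[OF _ gen_dom_F_I[OF f]])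
  moreover have "w t = \<Lambda> (P t f) x"
    unfolding w_def diff_self
    by (rule dual.P_op_0[OF x Lambda_gen_dom_F_I[OF gen_dom_P_op(1)[OF f t]]])
  ultimately show ?thesis by simp
qed

lemma cum_P_invariant:
  assumes f: "f \<in> C_I" and t: "0 \<le> t"
  shows "cum (\<lambda>y. p y * P t f y) 1 = cum (\<lambda>y. p y * f y) 1"
proof -
  have \<mu>: "\<mu> \<in> space (prob_algebra I_borel)" and law: "law_at Q X \<mu> t = \<mu>"
    using invariant t by (auto simp: invariant_distribution_def)
  have "cum (\<lambda>y. p y * P t f y) 1 = (\<integral>x. P t f x \<partial>\<mu>)"
    by (rule integral_invariant[OF invariant feller[OF t f], symmetric])
  also have "\<dots> = (\<integral>x. f x \<partial>\<mu>)"
    using integral_law_at[OF \<mu> t C_I_F_I[OF f]] by (simp only: law)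
  finally show ?thesis by (simp only: integral_invariant[OF invariant f])
qed

section \<open>No mass of the dual at 0\<close>

lemma zero_approx:
  assumes y: "y \<in> J"
  obtains k where "k \<in> gen_dom Q X" "\<And>x. x \<in> {0..1} \<Longrightarrow> 0 \<le> k x" "\<And>x. x \<in> {0..1} \<Longrightarrow> k x \<le> 1" "k 0 = 1"
    "cum (\<lambda>z. p z * k z) 1 \<le> F y"
proof -
  have y2: "0 < y / 2" "y / 2 < y" "y < 1" using y by auto
  obtain f where f: "f \<in> gen_dom Q X" "\<And>x. x \<in> {0..1} \<Longrightarrow> 0 \<le> f x" "\<And>x. x \<in> {0..1} \<Longrightarrow> f x \<le> 1"
    "\<And>x. x \<in> {0..y / 2} \<Longrightarrow> f x = 0" "\<And>x. x \<in> {y..1} \<Longrightarrow> f x = 1"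
    by (rule step_approx[OF y2]) (rule that)
  have ind: "indicator {y..1} \<in> F_I"
    by (rule F_I_I[of _ 1]) (auto intro!: measurable_I_borelI simp: indicator_def)
  have one: "(\<lambda>_. 1) \<in> F_I" by (intro C_I_F_I const_C_I)
  note kF = gen_dom_F_I[OF gen_dom_one_minus[OF f(1)]]
  have "cum (\<lambda>z. p z * (1 - f z)) 1 \<le> cum (\<lambda>z. p z * (1 - indicator {y..1} z)) 1"
  proof (rule cum_p_mono[OF kF F_I_diff[OF one ind]])
    fix z assume z: "z \<in> J"
    then have "indicator {y..1} z \<le> f z" using f(2,5)[of z] by (simp add: indicator_def)
    then show "1 - f z \<le> 1 - indicator {y..1} z" by simp
  qed simp
  also have "\<dots> = cum (\<lambda>z. p z * 1) 1 - cum (\<lambda>z. p z * indicator {y..1} z) 1"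
    using cum_diff[OF pf_integrable[OF one] pf_integrable[OF ind], of 1] by (simp add: right_diff_distrib)
  also have "\<dots> = F y" using F_le_1[of y] y by (simp add: cum_p_indicator)
  finally show thesis
    by (intro that[of "\<lambda>x. 1 - f x"] gen_dom_one_minus f(1)) (use f(2-4) y in simp_all)
qed

lemma zero_F_I: "indicator {0} \<in> F_I"
  by (rule F_I_I[of _ 1]) (auto intro!: measurable_I_borelI simp: indicator_def)

text \<open>Averaging is evaluation at 0, where k is 1, and keeps k nonnegative elsewhere. An atom
  of X* at 0 is thus bounded through a function to which the intertwining applies.\<close>

lemma indicator_zero_le:
  assumes "k \<in> gen_dom Q X" "\<And>x. x \<in> {0..1} \<Longrightarrow> 0 \<le> k x" "k 0 = 1" "y \<in> {0..1}"
  shows "indicator {0} y \<le> \<Lambda> k y"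
proof (cases "y = 0")
  case False
  have "\<Lambda> (\<lambda>_. 0) y \<le> \<Lambda> k y"
    by (rule Lambda_mono[OF C_I_F_I[OF const_C_I] gen_dom_F_I[OF assms(1)] assms(2,4)])
  then show ?thesis using False by (simp add: Lambda_const[OF assms(4)])
qed (simp add: assms(3))

lemma small_F: assumes "0 < e" obtains y where "y \<in> J" "F y < e"
proof -
  have "(F \<longlongrightarrow> F 0) (at 0 within {0..1})"
    using F_cont unfolding continuous_on_def by (rule bspec) simp
  then have "(F \<longlongrightarrow> F 0) (at_right 0)" by (simp add: at_within_Icc_at_right)
  then have "eventually (\<lambda>y. F y < e) (at_right 0)" using assms by (intro order_tendstoD(2)) simp_all
  with eventually_at_right_real[of 0 1] have "eventually (\<lambda>y. y \<in> J \<and> F y < e) (at_right 0)"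
    by (intro eventually_conj) simp_all
  then have "\<exists>y. y \<in> J \<and> F y < e"
    by (rule eventually_happens'[OF trivial_limit_at_right_real])
  then show thesis using that by blast
qed

text \<open>For a bump k the intertwining turns \<open>Ps t (\<Lambda> k)\<close> at x into the
  average of P_t k over (0,x), at most the full stationary mean divided by F x. That mean equals the
  one of k by invariance and is arbitrarily small. As x tends to 0 the bound is lost, so the start
  at 0 needs its own argument.\<close>

lemma Ps_zero_pos:
  assumes x: "0 < x" "x \<le> 1" and t: "0 \<le> t"
  shows "Ps t (indicator {0}) x = 0"
proof -
  have xI: "x \<in> {0..1}" using x by simp
  note Fx = F_pos[OF x]
  have "Ps t (indicator {0}) x \<le> e" if e: "0 < e" for e
  proof -
    have "0 < e * F x" using e Fx by simp
    then obtain y where y: "y \<in> J" "F y < e * F x" by (rule small_F)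
    obtain k where k: "k \<in> gen_dom Q X" "\<And>x. x \<in> {0..1} \<Longrightarrow> 0 \<le> k x" "\<And>x. x \<in> {0..1} \<Longrightarrow> k x \<le> 1" "k 0 = 1"
      "cum (\<lambda>z. p z * k z) 1 \<le> F y"
      by (rule zero_approx[OF y(1)]) (rule that)
    note PkF = P_op_F_I[OF t gen_dom_F_I[OF k(1)]]
    have nonneg: "0 \<le> P t k z" if "z \<in> {0..1}" for z
      using P_op_mono[OF that t C_I_F_I[OF const_C_I] gen_dom_F_I[OF k(1)] k(2)] by (simp add: P_op_const[OF that t])
    have "Ps t (indicator {0}) x \<le> Ps t (\<Lambda> k) x"
      by (rule dual.P_op_mono[OF xI t zero_F_I Lambda_gen_dom_F_I[OF k(1)] indicator_zero_le[OF k(1,2,4)]])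
    also have "\<dots> = cum (\<lambda>z. p z * P t k z) x / F x"
      by (simp only: intertwining[OF k(1) xI t] Lambda_eq[OF x])
    also have "\<dots> \<le> cum (\<lambda>z. p z * P t k z) 1 / F x"
    proof (rule divide_right_mono[OF cum_mono[OF pf_integrable[OF PkF]]])
      show "0 \<le> p z * P t k z" if "z \<in> J" for z
        using that p_pos[OF that] nonneg[of z] by simp
    qed (use x Fx in simp_all)
    also have "\<dots> \<le> F y / F x"
      using k(5) Fx by (simp only: cum_P_invariant[OF gen_dom_C_I[OF k(1)] t]) (simp add: divide_right_mono)
    also have "\<dots> \<le> e" using y(2) Fx by (simp add: pos_divide_le_eq)
    finally show ?thesis .
  qed
  then have "Ps t (indicator {0}) x \<le> 0" using field_le_epsilon[of _ "0::real"] by (metis add_0)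
  moreover have "Ps t (\<lambda>_. 0) x \<le> Ps t (indicator {0}) x"
    by (rule dual.P_op_mono[OF xI t C_I_F_I[OF const_C_I] zero_F_I]) simp
  ultimately show ?thesis by (simp add: dual.P_op_const[OF xI t])
qed

text \<open>Since 0 is not entered from positive states, being at 0 at time t + r forces being there
  at time t. Hence the probability of sitting at 0, started from 0, is multiplicative and decreasing
  in time.\<close>

lemma Ps_zero_mult:
  assumes "0 \<le> t" "0 \<le> r"
  shows "Ps (t + r) (indicator {0}) 0 = Ps r (indicator {0}) 0 * Ps t (indicator {0}) 0"
proof -
  have "Ps (t + r) (indicator {0}) 0 = Ps t (Ps r (indicator {0})) 0"
    by (rule dual.P_op_add[OF _ assms zero_F_I]) simp
  also have "\<dots> = Ps t (\<lambda>x. Ps r (indicator {0}) 0 * indicator {0} x) 0"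
  proof (rule dual.P_op_cong[OF _ assms(1)])
    fix y :: real assume "y \<in> {0..1}"
    then show "Ps r (indicator {0}) y = Ps r (indicator {0}) 0 * indicator {0} y"
      using Ps_zero_pos[of y r] assms(2) by (cases "y = 0") simp_all
  qed simp
  finally show ?thesis by (simp only: dual.P_op_scale)
qed

lemma Ps_zero_bounds:
  assumes "0 \<le> t" shows "0 \<le> Ps t (indicator {0}) 0" "Ps t (indicator {0}) 0 \<le> 1"
proof -
  have "Ps t (\<lambda>_. 0) 0 \<le> Ps t (indicator {0}) 0" "Ps t (indicator {0}) 0 \<le> Ps t (\<lambda>_. 1) 0"
    using assms by (auto intro!: dual.P_op_mono C_I_F_I[OF const_C_I] zero_F_I simp: indicator_def)
  then show "0 \<le> Ps t (indicator {0}) 0" "Ps t (indicator {0}) 0 \<le> 1"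
    using assms by (simp_all add: dual.P_op_const)
qed

text \<open>The start at 0 is excluded by occupation time. Let \<phi> r be the probability of
  sitting at 0 at time r. For bumps k n shrinking to 0, P_r (k n) at 0 is at least \<phi> r, hence
  at least \<phi> t for r < t. Dynkin's formula for the potentials of the centred bumps bounds t
  (\<phi> t - F (y n)) by twice their supremum, which tends to zero.\<close>

lemma Ps_zero:
  assumes t: "0 < t" and x: "x \<in> {0..1}"
  shows "Ps t (indicator {0}) x = 0"
proof (cases "x = 0")
  case False
  then show ?thesis using x t by (intro Ps_zero_pos) auto
next
  case True
  define \<phi> where "\<phi> r = Ps r (indicator {0}) 0" for r
  have antimono: "\<phi> t \<le> \<phi> r" if "0 \<le> r" "r \<le> t" for r
  proof -
    have "\<phi> t = \<phi> r * \<phi> (t - r)"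
      using Ps_zero_mult[of "t - r" r] that by (simp add: \<phi>_def)
    also have "\<dots> \<le> \<phi> r"
      unfolding \<phi>_def using that Ps_zero_bounds[of r] Ps_zero_bounds[of "t - r"] by (intro mult_left_le) auto
    finally show ?thesis .
  qed
  define y where "y n = inverse (real (Suc (Suc n)))" for n
  have y: "y n \<in> J" for n
    unfolding y_def greaterThanLessThan_iff by (intro conjI inverse_less_1_iff[THEN iffD2]) simp_all
  have "\<exists>k. k \<in> gen_dom Q X \<and> (\<forall>x\<in>{0..1}. 0 \<le> k x) \<and> (\<forall>x\<in>{0..1}. k x \<le> 1) \<and> k 0 = 1
      \<and> cum (\<lambda>z. p z * k z) 1 \<le> F (y n)" for n
    by (rule zero_approx[OF y[of n]]) blast
  then obtain k where k: "\<And>n. k n \<in> gen_dom Q X" "\<And>n x. x \<in> {0..1} \<Longrightarrow> 0 \<le> k n x"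
    "\<And>n x. x \<in> {0..1} \<Longrightarrow> k n x \<le> 1" "\<And>n. k n 0 = 1" "\<And>n. cum (\<lambda>z. p z * k n z) 1 \<le> F (y n)"
    by metis
  define \<kappa> where "\<kappa> n = cum (\<lambda>z. p z * k n z) 1" for n
  define g where "g n z = k n z - \<kappa> n" for n z
  note kF = gen_dom_F_I[OF k(1)]
  have const: "(\<lambda>_. r) \<in> F_I" for r by (intro C_I_F_I const_C_I)
  have g: "g n \<in> C_I" for n
    using gen_dom_C_I[OF k(1)[of n]] by (simp add: g_def[abs_def] C_I_def continuous_on_diff)
  have zero: "flux (g n) 1 = 0" for n
    using flux_centered[OF kF[of n]] by (simp add: g_def[abs_def] \<kappa>_def)
  have "cum (\<lambda>z. p z * k n z) 0 \<le> cum (\<lambda>z. p z * k n z) 1" for n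
    by (rule cum_mono[OF pf_integrable[OF kF]]) (use p_pos k(2) in \<open>simp_all add: less_imp_le\<close>)
  then have \<kappa>0: "0 \<le> \<kappa> n" for n by (simp add: \<kappa>_def)
  have \<kappa>F: "\<kappa> n \<le> F (y n)" for n using k(5) by (simp add: \<kappa>_def)
  have \<kappa>1: "\<kappa> n \<le> 1" for n using \<kappa>F[of n] F_le_1[of "y n"] y[of n] by simp
  have g1: "\<bar>g n z\<bar> \<le> 1" if "z \<in> {0..1}" for n z
    using k(2,3)[OF that, of n] \<kappa>0[of n] \<kappa>1[of n] by (simp add: g_def abs_le_iff)
  have "y \<longlonglongrightarrow> 0" unfolding y_def by (rule LIMSEQ_Suc[OF LIMSEQ_inverse_real_of_nat])
  then have Fy: "(\<lambda>n. F (y n)) \<longlonglongrightarrow> 0"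
    using continuous_on_tendsto_compose[OF F_cont, of y 0 sequentially] y by (simp add: less_imp_le)
  \<comment> \<open>A bound for the n-th potential that is uniform in the state. Its integrand tends
    to zero pointwise, since the flux at z is at most a multiple of F (y n), and the envelope
    dominates it because g n is bounded by 1.\<close>
  define B where "B n = (LINT z:J|lborel. \<bar>s z * flux (g n) z\<bar>)" for n
  have "B \<longlonglongrightarrow> (\<integral>z. (0::real) \<partial>(lborel :: real measure))"
    unfolding B_def set_lebesgue_integral_def
  proof (rule integral_dominated_convergence[where w = "\<lambda>z. indicator J z *\<^sub>R (2 * 1 * envelope z)"])
    show "integrable lborel (\<lambda>z. indicator J z *\<^sub>R (2 * 1 * envelope z))"
      using set_integrable_mult_right[of "2 * 1", OF envelope_integrable] by (simp only: set_integrable_def)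
    show "(\<lambda>z. indicator J z *\<^sub>R \<bar>s z * flux (g n) z\<bar>) \<in> borel_measurable lborel" for n
      using set_integrable_abs[OF s_flux_integrable[OF C_I_F_I[OF g] zero]] unfolding set_integrable_def
      by (rule borel_measurable_integrable)
    show "AE z in lborel. norm (indicator J z *\<^sub>R \<bar>s z * flux (g n) z\<bar>) \<le> indicator J z *\<^sub>R (2 * 1 * envelope z)" for n
    proof (rule AE_I2)
      fix z show "norm (indicator J z *\<^sub>R \<bar>s z * flux (g n) z\<bar>) \<le> indicator J z *\<^sub>R (2 * 1 * envelope z)"
      proof (cases "z \<in> J")
        case True
        from flux_bound[OF C_I_F_I[OF g] g1 zero True] True show ?thesis by simp
      qed simp
    qed
    show "AE z in lborel. (\<lambda>n. indicator J z *\<^sub>R \<bar>s z * flux (g n) z\<bar>) \<longlonglongrightarrow> 0"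
    proof (rule AE_I2)
      fix z show "(\<lambda>n. indicator J z *\<^sub>R \<bar>s z * flux (g n) z\<bar>) \<longlonglongrightarrow> 0"
      proof (cases "z \<in> J")
        case True
        then have z: "z \<in> {0..1}" by simp
        \<comment> \<open>The integral of a centred bump is a difference of two numbers in
          [0, \<kappa> n], so its modulus is at most \<kappa> n.\<close>
        have "\<bar>cum (\<lambda>x. p x * g n x) z\<bar> \<le> F (y n)" for n
        proof -
          have "cum (\<lambda>x. p x * g n x) z = cum (\<lambda>x. p x * k n x) z - \<kappa> n * F z"
            using cum_diff[OF pf_integrable[OF kF[of n]] pf_integrable[OF const[of "\<kappa> n"]] z] cum_scale[of "\<kappa> n" p z]
            by (simp add: g_def right_diff_distrib mult.commute)
          moreover have "0 \<le> cum (\<lambda>x. p x * k n x) z" "cum (\<lambda>x. p x * k n x) z \<le> \<kappa> n"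
          proof -
            have nn: "0 \<le> p x * k n x" if "x \<in> J" for x using p_pos[OF that] k(2)[of x n] that by simp
            have "cum (\<lambda>x. p x * k n x) 0 \<le> cum (\<lambda>x. p x * k n x) z" "cum (\<lambda>x. p x * k n x) z \<le> cum (\<lambda>x. p x * k n x) 1"
              by (rule cum_mono[OF pf_integrable[OF kF] nn]; use z in simp)+
            then show "0 \<le> cum (\<lambda>x. p x * k n x) z" "cum (\<lambda>x. p x * k n x) z \<le> \<kappa> n" by (simp_all add: \<kappa>_def)
          qed
          moreover have "0 \<le> \<kappa> n * F z" "\<kappa> n * F z \<le> \<kappa> n"
            using \<kappa>0[of n] F_nonneg[OF z] F_le_1[OF z] by (simp_all add: mult_left_le)
          ultimately show ?thesis using \<kappa>F[of n] by linarith
        qed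
        moreover have "\<bar>s z * flux (g n) z\<bar> = 2 * s z * cum m 1 * \<bar>cum (\<lambda>x. p x * g n x) z\<bar>" for n
          using s_pos[of z] cum_m_pos by (simp add: flux_def cum_pf abs_mult abs_divide)
        ultimately have le: "\<bar>s z * flux (g n) z\<bar> \<le> 2 * s z * cum m 1 * F (y n)" for n
          using s_pos[of z] cum_m_pos by (simp add: mult_left_mono)
        have "(\<lambda>n. \<bar>s z * flux (g n) z\<bar>) \<longlonglongrightarrow> 0"
        proof (rule tendsto_sandwich[OF _ _ tendsto_const])
          show "(\<lambda>n. 2 * s z * cum m 1 * F (y n)) \<longlonglongrightarrow> 0" using tendsto_mult_right_zero[OF Fy] .
        qed (use le in auto)
        then show ?thesis using True by simp
      qed simp
    qed
  qed simp
  then have B: "B \<longlonglongrightarrow> 0" by simp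
  \<comment> \<open>Here the generator applied to the potential is k n - \<kappa> n, and at 0, where
    averaging is evaluation, the intertwining reads P_r (k n) =
    \<open>Ps r (\<Lambda> (k n))\<close>.\<close>
  have ge: "(\<phi> t - F (y n)) * t \<le> 2 * B n" for n
  proof -
    note dom = pot_gen_dom[OF g[of n] zero[of n]]
    have "P t (pot (g n)) 0 - pot (g n) 0 \<ge> (\<phi> t - F (y n)) * t"
    proof (rule P_op_increment_ge[OF dom(1)])
      fix r assume r: "0 \<le> r" "r < t"
      have "P r (gen Q X (pot (g n))) 0 = P r (g n) 0"
        by (rule P_op_cong[OF _ r(1) dom(2)]) simp_all
      also have "\<dots> = P r (k n) 0 - \<kappa> n"
        using P_op_diff[OF _ r(1) kF const, of 0 n "\<kappa> n"] P_op_const[OF _ r(1), of 0 "\<kappa> n"] by (simp add: g_def[abs_def])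
      also have "P r (k n) 0 = Ps r (\<Lambda> (k n)) 0"
        using intertwining[OF k(1)[of n] _ r(1), of 0] by simp
      finally have eq: "P r (gen Q X (pot (g n))) 0 = Ps r (\<Lambda> (k n)) 0 - \<kappa> n" .
      have "\<phi> r \<le> Ps r (\<Lambda> (k n)) 0"
        unfolding \<phi>_def
        by (rule dual.P_op_mono[OF _ r(1) zero_F_I Lambda_gen_dom_F_I[OF k(1)] indicator_zero_le[OF k(1,2,4)]]) simp_all
      then show "P r (gen Q X (pot (g n))) 0 \<ge> \<phi> t - F (y n)"
        using antimono[of r] r \<kappa>F[of n] unfolding eq by simp
    qed (use t in simp_all)
    moreover have "\<bar>pot (g n) x\<bar> \<le> B n" if "x \<in> {0..1}" for x
      unfolding B_def by (rule pot_abs_le[OF C_I_F_I[OF g] zero that])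
    then have "\<bar>pot (g n) 0\<bar> \<le> B n" "\<bar>P t (pot (g n)) 0\<bar> \<le> B n"
      using t by (auto intro!: P_op_abs_le gen_dom_F_I dom(1))
    ultimately show ?thesis by linarith
  qed
  have "(\<lambda>n. (\<phi> t - F (y n)) * t) \<longlonglongrightarrow> (\<phi> t - 0) * t" by (intro tendsto_intros Fy)
  moreover have "(\<lambda>n. 2 * B n) \<longlonglongrightarrow> 2 * 0" by (intro tendsto_intros B)
  ultimately have "(\<phi> t - 0) * t \<le> 2 * 0" by (rule LIMSEQ_le) (use ge in blast)
  then have "\<phi> t \<le> 0" using t by (simp add: mult_le_0_iff)
  then show ?thesis using Ps_zero_bounds(1)[of t] t True by (simp add: \<phi>_def)
qed

section \<open>Absorption of the dual at 1\<close>

lemma indicator_F_I: "indicator {y..1} \<in> F_I"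
  by (rule F_I_I[of _ 1]) (auto intro!: measurable_I_borelI simp: indicator_def)

lemma Lambda_indicator_tendsto:
  assumes f: "\<And>n. f n \<in> F_I" "\<And>n x. x \<in> {0..1} \<Longrightarrow> \<bar>f n x\<bar> \<le> 1"
    "\<And>x. x \<in> {0..1} \<Longrightarrow> (\<lambda>n. f n x) \<longlonglongrightarrow> indicator {y..1} x" and x: "x \<in> {0..1}"
  shows "(\<lambda>n. \<Lambda> (f n) x) \<longlonglongrightarrow> \<Lambda> (indicator {y..1}) x"
proof (cases "x = 0")
  case True then show ?thesis using f(3)[of 0] by simp
next
  case False
  then have x': "0 < x" "x \<le> 1" using x by auto
  have "(\<lambda>n. cum (\<lambda>z. p z * f n z) x / F x) \<longlonglongrightarrow> cum (\<lambda>z. p z * indicator {y..1} z) x / F x"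
    using F_pos[OF x'] by (intro tendsto_divide cum_p_tendsto[of f _ 1] f indicator_F_I x tendsto_const) auto
  then show ?thesis by (simp only: Lambda_eq[OF x'])
qed

text \<open>Measurability is inherited from the approximating functions, whose averages lie in the
  domain of the dual generator and so are continuous.\<close>

lemma Lambda_indicator_F_I:
  assumes y: "y \<in> J" shows "\<Lambda> (indicator {y..1}) \<in> F_I"
proof -
  obtain f where f: "\<And>n. f n \<in> gen_dom Q X" "\<And>n x. x \<in> {0..1} \<Longrightarrow> \<bar>f n x\<bar> \<le> 1"
    "\<And>x. x \<in> {0..1} \<Longrightarrow> (\<lambda>n. f n x) \<longlonglongrightarrow> indicator {y..1} x"
    by (rule indicator_approx[OF y]) (rule that)
  have "\<Lambda> (indicator {y..1}) \<in> borel_measurable I_borel"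
    by (rule borel_measurable_LIMSEQ_real[OF Lambda_indicator_tendsto[OF gen_dom_F_I[OF f(1)] f(2,3)]
          F_I_measurable[OF Lambda_gen_dom_F_I[OF f(1)]]]) simp_all
  then show ?thesis
    by (rule F_I_I[of _ 1]) (rule Lambda_abs_le[OF indicator_F_I], simp_all add: indicator_def)
qed

lemma integral_indicator_tendsto:
  assumes \<nu>: "prob_space \<nu>" "sets \<nu> = sets I_borel"
    and f: "\<And>n. f n \<in> F_I" "\<And>n x. x \<in> {0..1} \<Longrightarrow> \<bar>f n x\<bar> \<le> 1"
    and g: "g \<in> F_I" "\<And>x. x \<in> {0..1} \<Longrightarrow> (\<lambda>n. f n x) \<longlonglongrightarrow> g x"
  shows "(\<lambda>n. \<integral>x. f n x \<partial>\<nu>) \<longlonglongrightarrow> (\<integral>x. g x \<partial>\<nu>)"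
proof -
  interpret prob_space \<nu> by fact
  have sp: "space \<nu> = {0..1}" using sets_eq_imp_space_eq[OF \<nu>(2)] by simp
  show ?thesis
  proof (rule integral_dominated_convergence[where w = "\<lambda>_. 1"])
    show "AE x in \<nu>. (\<lambda>n. f n x) \<longlonglongrightarrow> g x" by (rule AE_I2) (simp only: sp g(2))
    show "AE x in \<nu>. norm (f n x) \<le> 1" for n by (rule AE_I2) (simp only: sp f(2) real_norm_def)
  qed (use F_I_integrable[OF \<nu> g(1)] F_I_integrable[OF \<nu> f(1)] in \<open>simp_all add: borel_measurable_integrable\<close>)
qed

text \<open>Averaging evaluated at 1 is the stationary mean, which P_u preserves; hence the
  expectation of \<open>\<Lambda> (indicator {y..1})\<close> under the dual started from 1 stays at
  1 - F y. This is the maximum of that function and is attained at 1 only, which leaves no other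
  state.\<close>

lemma absorbing: assumes u: "0 \<le> u" shows "Ps u (\<lambda>y. y) 1 = 1"
proof -
  have I1: "1 \<in> {0..1::real}" by simp
  \<comment> \<open>Any interior point would serve.\<close>
  define y :: real where "y = 1 / 2"
  have y: "y \<in> J" by (simp add: y_def)
  obtain f where f: "\<And>n. f n \<in> gen_dom Q X" "\<And>n x. x \<in> {0..1} \<Longrightarrow> \<bar>f n x\<bar> \<le> 1"
    "\<And>x. x \<in> {0..1} \<Longrightarrow> (\<lambda>n. f n x) \<longlonglongrightarrow> indicator {y..1} x"
    by (rule indicator_approx[OF y]) (rule that)
  have lim: "(\<lambda>n. \<Lambda> (f n) x) \<longlonglongrightarrow> \<Lambda> (indicator {y..1}) x" if "x \<in> {0..1}" for x
    by (rule Lambda_indicator_tendsto[OF gen_dom_F_I[OF f(1)] f(2,3) that])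
  have eq: "Ps u (\<Lambda> (f n)) 1 = \<Lambda> (f n) 1" for n
  proof -
    have "Ps u (\<Lambda> (f n)) 1 = cum (\<lambda>z. p z * P u (f n) z) 1"
      by (simp add: intertwining[OF f(1) I1 u] Lambda_eq)
    also have "\<dots> = \<Lambda> (f n) 1"
      by (simp add: cum_P_invariant[OF gen_dom_C_I[OF f(1)] u] Lambda_eq)
    finally show ?thesis .
  qed
  have "(\<lambda>n. Ps u (\<Lambda> (f n)) 1) \<longlonglongrightarrow> Ps u (\<Lambda> (indicator {y..1})) 1"
    by (rule dual.P_op_tendsto[OF I1 u Lambda_gen_dom_F_I[OF f(1)] F_I_measurable[OF Lambda_indicator_F_I[OF y]]
          Lambda_abs_le[OF gen_dom_F_I[OF f(1)] f(2)] lim])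
  then have "Ps u (\<Lambda> (indicator {y..1})) 1 = \<Lambda> (indicator {y..1}) 1"
    unfolding eq using LIMSEQ_unique[OF _ lim[OF I1]] by blast
  then have Ps1: "Ps u (\<Lambda> (indicator {y..1})) 1 = 1 - F y"
    using F_le_1[of y] y by (simp add: Lambda_indicator[OF y I1])
  \<comment> \<open>The distance to the maximum: nonnegative, zero only at 1, and of mean zero under
    the law of the dual started from 1.\<close>
  define G where "G x = (1 - F y) - \<Lambda> (indicator {y..1}) x" for x
  have Fy: "0 < F y" "F y < 1" using F_pos[of y] F_strict_mono[of y 1] y by simp_all
  have G: "G \<in> F_I" unfolding G_def[abs_def] by (intro F_I_diff C_I_F_I[OF const_C_I] Lambda_indicator_F_I y)
  have Gpos: "0 < G x" if "x \<in> {0..1}" "x \<noteq> 1" for x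
  proof (cases "x = 0")
    case True then show ?thesis using Fy y by (simp add: G_def)
  next
    case False
    then have x: "0 < x" "x < 1" using that by auto
    have "F x < 1" "0 < F x" using F_strict_mono[of x 1] F_pos[of x] x by simp_all
    then have "F y < F y / F x" using Fy by (simp add: pos_less_divide_eq)
    then show ?thesis using Fy False by (simp add: G_def Lambda_indicator[OF y that(1)])
  qed
  have G1: "G 1 = 0" using Fy by (simp add: G_def Lambda_indicator[OF y I1])
  interpret T: prob_space "dual.trans_law u 1" by (rule dual.trans_law[OF I1 u])
  note sT = dual.trans_law(2)[OF I1 u]
  have spT: "space (dual.trans_law u 1) = {0..1}" using sets_eq_imp_space_eq[OF sT] by simp
  have "(\<integral>x. G x \<partial>dual.trans_law u 1) = Ps u G 1"
    by (rule dual.P_op_eq[OF I1 u F_I_measurable[OF G], symmetric])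
  also have "\<dots> = Ps u (\<lambda>_. 1 - F y) 1 - Ps u (\<Lambda> (indicator {y..1})) 1"
    unfolding G_def[abs_def] by (rule dual.P_op_diff[OF I1 u C_I_F_I[OF const_C_I] Lambda_indicator_F_I[OF y]])
  also have "\<dots> = 0" by (simp only: dual.P_op_const[OF I1 u] Ps1 diff_self)
  finally have int0: "(\<integral>x. G x \<partial>dual.trans_law u 1) = 0" .
  have nn: "AE x in dual.trans_law u 1. 0 \<le> G x"
  proof (rule AE_I2)
    fix x assume "x \<in> space (dual.trans_law u 1)"
    then show "0 \<le> G x" using Gpos[of x] G1 by (cases "x = 1") (simp_all add: spT)
  qed
  from integral_nonneg_eq_0_iff_AE[OF F_I_integrable[OF dual.trans_law[OF I1 u] G] nn, THEN iffD1, OF int0]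
  have AE1: "AE x in dual.trans_law u 1. x = 1"
  proof (rule AE_mp, intro AE_I2 impI)
    fix x assume "x \<in> space (dual.trans_law u 1)" "G x = 0"
    then show "x = 1" using Gpos[of x] by (cases "x = 1") (simp_all add: spT)
  qed
  have id: "(\<lambda>x. x) \<in> F_I" by (rule C_I_F_I) (simp add: C_I_def)
  have "Ps u (\<lambda>y. y) 1 = (\<integral>x. x \<partial>dual.trans_law u 1)"
    by (rule dual.P_op_eq[OF I1 u F_I_measurable[OF id]])
  also have "\<dots> = (\<integral>x. 1 \<partial>dual.trans_law u 1)"
    using F_I_integrable[OF dual.trans_law[OF I1 u] id, THEN borel_measurable_integrable] AE1
    by (intro integral_cong_AE) simp_all
  finally show ?thesis by (simp add: T.prob_space)
qed

section \<open>The distribution function of the invariant law\<close>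

lemma \<mu>_prob: "prob_space \<mu>" "sets \<mu> = sets I_borel" "space \<mu> = {0..1}"
proof -
  show "prob_space \<mu>" and s: "sets \<mu> = sets I_borel"
    using invariant by (auto simp: invariant_distribution_def space_prob_algebra)
  show "space \<mu> = {0..1}" using sets_eq_imp_space_eq[OF s] by simp
qed

lemma Icc_sets: "0 \<le> y \<Longrightarrow> {y..1} \<in> sets I_borel"
  by (simp add: sets_I_borel_iff)

lemma measure_eq_integral_indicator:
  assumes "sets \<nu> = sets I_borel" "0 \<le> y"
  shows "(\<integral>x. indicator {y..1} x \<partial>\<nu>) = measure \<nu> {y..1}"
proof -
  have "{y..1} \<inter> space \<nu> = {y..1}"
    using assms sets_eq_imp_space_eq[OF assms(1)] by auto
  then show ?thesis by simp
qed

text \<open>Interior points are reached through domain functions, on which the invariant law is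
  already known. At y = 1 the mass is at most 1 - F z for every z < 1, and continuity of F excludes
  an atom.\<close>

lemma measure_\<mu>_Icc:
  assumes y: "y \<in> {0..1}" shows "measure \<mu> {y..1} = 1 - F y"
proof -
  interpret \<mu>: prob_space \<mu> by (rule \<mu>_prob)
  have J: "measure \<mu> {y..1} = 1 - F y" if y: "y \<in> J" for y
  proof -
    obtain f where f: "\<And>n. f n \<in> gen_dom Q X" "\<And>n x. x \<in> {0..1} \<Longrightarrow> \<bar>f n x\<bar> \<le> 1"
      "\<And>x. x \<in> {0..1} \<Longrightarrow> (\<lambda>n. f n x) \<longlonglongrightarrow> indicator {y..1} x"
      by (rule indicator_approx[OF y]) (rule that)
    have "(\<lambda>n. \<integral>x. f n x \<partial>\<mu>) \<longlonglongrightarrow> (\<integral>x. indicator {y..1} x \<partial>\<mu>)"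
      by (rule integral_indicator_tendsto[OF \<mu>_prob(1,2) gen_dom_F_I[OF f(1)] f(2) indicator_F_I f(3)])
    moreover have "(\<lambda>n. \<integral>x. f n x \<partial>\<mu>) \<longlonglongrightarrow> 1 - F y"
    proof -
      have "(\<lambda>n. cum (\<lambda>z. p z * f n z) 1) \<longlonglongrightarrow> cum (\<lambda>z. p z * indicator {y..1} z) 1"
        by (rule cum_p_tendsto[of f _ 1]) (use gen_dom_F_I[OF f(1)] f(2,3) indicator_F_I in simp_all)
      then show ?thesis
        using F_le_1[of y] y by (simp add: integral_invariant[OF invariant gen_dom_C_I[OF f(1)]] cum_p_indicator)
    qed
    ultimately have "(\<integral>x. indicator {y..1} x \<partial>\<mu>) = 1 - F y" by (rule LIMSEQ_unique)
    then show ?thesis using y by (simp only: measure_eq_integral_indicator[OF \<mu>_prob(2)] greaterThanLessThan_iff less_imp_le)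
  qed
  consider "y = 0" | "y \<in> J" | "y = 1" using y by fastforce
  then show ?thesis
  proof cases
    case 1 then show ?thesis using \<mu>.prob_space by (simp add: \<mu>_prob(3))
  next
    case 2 then show ?thesis by (rule J)
  next
    case 3
    have "measure \<mu> {1..1} \<le> 1 - F z" if z: "z \<in> J" for z
      unfolding J[OF z, symmetric]
      using z Icc_sets[of z] \<mu>_prob(2) by (intro \<mu>.finite_measure_mono) auto
    then have ev: "eventually (\<lambda>z. measure \<mu> {1..1} \<le> 1 - F z) (at_left 1)"
      by (intro eventually_mono[OF eventually_at_left_real[of 0 1]]) simp_all
    have "(F \<longlongrightarrow> F 1) (at 1 within {0..1})"
      using F_cont unfolding continuous_on_def by (rule bspec) simp
    then have "(F \<longlongrightarrow> 1) (at_left 1)" by (simp add: at_within_Icc_at_left)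
    then have "((\<lambda>z. 1 - F z) \<longlongrightarrow> 1 - 1) (at_left 1)" by (intro tendsto_intros)
    from tendsto_lowerbound[OF this ev trivial_limit_at_left_real]
    have "measure \<mu> {1..1} \<le> 1 - 1" .
    then show ?thesis using 3 by (simp add: measure_le_0_iff)
  qed
qed

lemma emeasure_\<mu>_Ico:
  assumes "0 \<le> y" "y \<le> x" "x \<le> 1"
  shows "emeasure \<mu> {y..<x} = ennreal (F x - F y)"
proof -
  interpret \<mu>: prob_space \<mu> by (rule \<mu>_prob)
  have "{y..<x} = {y..1} - {x..1}" using assms by auto
  moreover have "measure \<mu> ({y..1} - {x..1}) = measure \<mu> {y..1} - measure \<mu> {x..1}"
    using assms Icc_sets[of y] Icc_sets[of x] \<mu>_prob(2) by (intro \<mu>.finite_measure_Diff) auto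
  ultimately show ?thesis
    using assms by (simp add: \<mu>.emeasure_eq_measure measure_\<mu>_Icc)
qed

end

section \<open>The law at a positive time\<close>

locale strong_stationary_duality = intertwined_diffusions a b c \<Omega> Q X \<Omega>s Qs Xs \<mu>
  for a b c and \<Omega> :: "'w measure" and Q X and \<Omega>s :: "'v measure" and Qs Xs \<mu> +
  fixes \<mu>0 \<mu>0s :: "real measure" and t :: real
  assumes \<mu>0: "\<mu>0 \<in> space (prob_algebra I_borel)" and \<mu>0s: "\<mu>0s \<in> space (prob_algebra I_borel)"
    and initial: "f \<in> F_I \<Longrightarrow> (\<integral>x. f x \<partial>\<mu>0) = (\<integral>x. Lambda a b c f x \<partial>\<mu>0s)"
    and t: "0 < t"
begin

abbreviation "\<nu> \<equiv> law_at Q X \<mu>0 t"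
abbreviation "\<nu>s \<equiv> law_at Qs Xs \<mu>0s t"

lemma t0: "0 \<le> t" using t by simp

lemma \<mu>0s_prob: "prob_space \<mu>0s" "sets \<mu>0s = sets I_borel" "space \<mu>0s = {0..1}"
  using \<mu>0s sets_eq_imp_space_eq[of \<mu>0s I_borel] by (simp_all add: space_prob_algebra)

lemma \<nu>_prob: "prob_space \<nu>" "sets \<nu> = sets I_borel" "space \<nu> = {0..1}"
  by (rule law_at[OF \<mu>0 t0])+

lemma \<nu>s_prob: "prob_space \<nu>s" "sets \<nu>s = sets I_borel" "space \<nu>s = {0..1}"
  by (rule dual.law_at[OF \<mu>0s t0])+

text \<open>The relation between the initial laws is applied to the test function P_t f, after which
  the intertwining moves the semigroup to the other side.\<close>

lemma law_duality:
  assumes f: "f \<in> gen_dom Q X"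
  shows "(\<integral>x. f x \<partial>\<nu>) = (\<integral>x. \<Lambda> f x \<partial>\<nu>s)"
proof -
  note PF = P_op_F_I[OF t0 gen_dom_F_I[OF f]]
  have "(\<integral>x. f x \<partial>\<nu>) = (\<integral>x. P t f x \<partial>\<mu>0)" by (rule integral_law_at[OF \<mu>0 t0 gen_dom_F_I[OF f]])
  also have "\<dots> = (\<integral>x. \<Lambda> (P t f) x \<partial>\<mu>0s)" by (rule initial[OF PF])
  also have "\<dots> = (\<integral>x. Ps t (\<Lambda> f) x \<partial>\<mu>0s)"
    by (rule Bochner_Integration.integral_cong[OF refl]) (simp only: \<mu>0s_prob(3) intertwining[OF f _ t0])
  also have "\<dots> = (\<integral>x. \<Lambda> f x \<partial>\<nu>s)"
    by (rule dual.integral_law_at[OF \<mu>0s t0 Lambda_gen_dom_F_I[OF f], symmetric])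
  finally show ?thesis .
qed

lemma measure_\<nu>_Icc:
  assumes y: "y \<in> J" shows "measure \<nu> {y..1} = (\<integral>x. \<Lambda> (indicator {y..1}) x \<partial>\<nu>s)"
proof -
  obtain f where f: "\<And>n. f n \<in> gen_dom Q X" "\<And>n x. x \<in> {0..1} \<Longrightarrow> \<bar>f n x\<bar> \<le> 1"
    "\<And>x. x \<in> {0..1} \<Longrightarrow> (\<lambda>n. f n x) \<longlonglongrightarrow> indicator {y..1} x"
    by (rule indicator_approx[OF y]) (rule that)
  have lim: "(\<lambda>n. \<Lambda> (f n) x) \<longlonglongrightarrow> \<Lambda> (indicator {y..1}) x" if "x \<in> {0..1}" for x
    by (rule Lambda_indicator_tendsto[OF gen_dom_F_I[OF f(1)] f(2,3) that])
  have "(\<lambda>n. \<integral>x. f n x \<partial>\<nu>) \<longlonglongrightarrow> (\<integral>x. indicator {y..1} x \<partial>\<nu>)"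
    by (rule integral_indicator_tendsto[OF \<nu>_prob(1,2) gen_dom_F_I[OF f(1)] f(2) indicator_F_I f(3)])
  moreover have "(\<lambda>n. \<integral>x. f n x \<partial>\<nu>) \<longlonglongrightarrow> (\<integral>x. \<Lambda> (indicator {y..1}) x \<partial>\<nu>s)"
    unfolding law_duality[OF f(1)]
    by (rule integral_indicator_tendsto[OF \<nu>s_prob(1,2) Lambda_gen_dom_F_I[OF f(1)]
          Lambda_abs_le[OF gen_dom_F_I[OF f(1)] f(2)] Lambda_indicator_F_I[OF y] lim])
  ultimately have "(\<integral>x. indicator {y..1} x \<partial>\<nu>) = (\<integral>x. \<Lambda> (indicator {y..1}) x \<partial>\<nu>s)" by (rule LIMSEQ_unique)
  then show ?thesis using y by (simp only: measure_eq_integral_indicator[OF \<nu>_prob(2)] greaterThanLessThan_iff less_imp_le)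
qed

lemma \<nu>s_no_atom_0: "AE x in \<nu>s. x \<noteq> 0"
proof -
  interpret \<nu>s: prob_space \<nu>s by (rule \<nu>s_prob)
  have "(\<integral>x. indicator {0} x \<partial>\<nu>s) = (\<integral>x. Ps t (indicator {0}) x \<partial>\<mu>0s)"
    by (rule dual.integral_law_at[OF \<mu>0s t0 zero_F_I])
  also have "\<dots> = (\<integral>x. 0 \<partial>\<mu>0s)"
    by (rule Bochner_Integration.integral_cong[OF refl]) (simp only: \<mu>0s_prob(3) Ps_zero[OF t])
  finally have "measure \<nu>s {0} = 0" by (simp add: \<nu>s_prob(3))
  moreover have "{0} \<in> sets \<nu>s" by (simp add: \<nu>s_prob(2) sets_I_borel_iff)
  moreover have "{x \<in> space \<nu>s. \<not> x \<noteq> 0} = {0}" by (auto simp: \<nu>s_prob(3))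
  ultimately show ?thesis by (simp add: AE_iff_measurable \<nu>s.emeasure_eq_measure)
qed

section \<open>The density of the law with respect to the stationary law\<close>

definition R :: "real \<Rightarrow> ennreal" where
  "R z = (\<integral>\<^sup>+x. indicator {z<..1} x * ennreal (inverse (F x)) \<partial>\<nu>s)"

lemma id_measurable: "sets K = sets I_borel \<Longrightarrow> (\<lambda>x. x) \<in> borel_measurable K"
  using measurable_I_borelI[of "\<lambda>x. x"] by (simp cong: measurable_cong_sets)

lemma integrand_measurable [measurable]:
  "(\<lambda>(z, x). indicator {z<..1} x * ennreal (inverse (F x))) \<in> borel_measurable (\<mu> \<Otimes>\<^sub>M \<nu>s)"
proof -
  have [measurable]: "(\<lambda>x. x) \<in> borel_measurable \<mu>" "(\<lambda>x. x) \<in> borel_measurable \<nu>s" "F \<in> borel_measurable \<nu>s"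
    using id_measurable[OF \<mu>_prob(2)] id_measurable[OF \<nu>s_prob(2)] F_I_measurable[OF F_F_I] \<nu>s_prob(2)
    by (simp_all cong: measurable_cong_sets)
  have "(\<lambda>w. if fst w < snd w \<and> snd w \<le> 1 then ennreal (inverse (F (snd w))) else 0) \<in> borel_measurable (\<mu> \<Otimes>\<^sub>M \<nu>s)"
    by measurable
  then show ?thesis by (rule measurable_cong[THEN iffD1, rotated]) (auto simp: indicator_def)
qed

lemma R_measurable [measurable]: "R \<in> borel_measurable \<mu>"
proof -
  interpret \<nu>s: prob_space \<nu>s by (rule \<nu>s_prob)
  show ?thesis unfolding R_def[abs_def]
    by (rule \<nu>s.borel_measurable_nn_integral[OF integrand_measurable])
qed

text \<open>Tonelli exchanges the stationary integral with the mixture over x; for fixed x > 0 the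
  inner integral is the stationary mass of [y,x) divided by F x.\<close>

lemma density_Icc:
  assumes y: "y \<in> {0..<1}"
  shows "emeasure (density \<mu> R) {y..1} = (\<integral>\<^sup>+x. ennreal (max 0 (1 - F y / F x)) \<partial>\<nu>s)"
proof -
  interpret \<mu>: prob_space \<mu> by (rule \<mu>_prob)
  interpret \<nu>s: prob_space \<nu>s by (rule \<nu>s_prob)
  interpret pair_sigma_finite \<mu> \<nu>s ..
  have ys: "{y..1} \<in> sets \<mu>" using Icc_sets[of y] y by (simp add: \<mu>_prob(2))
  note [measurable] = ys
  have "emeasure (density \<mu> R) {y..1} = (\<integral>\<^sup>+z. R z * indicator {y..1} z \<partial>\<mu>)"
    by (rule emeasure_density[OF R_measurable ys])
  also have "\<dots> = (\<integral>\<^sup>+z. (\<integral>\<^sup>+x. (indicator {z<..1} x * ennreal (inverse (F x))) * indicator {y..1} z \<partial>\<nu>s) \<partial>\<mu>)"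
    unfolding R_def
  proof (intro nn_integral_cong nn_integral_multc[symmetric])
    fix z assume "z \<in> space \<mu>"
    from measurable_compose[OF measurable_Pair1'[OF this] integrand_measurable]
    show "(\<lambda>x. indicator {z<..1} x * ennreal (inverse (F x))) \<in> borel_measurable \<nu>s" by simp
  qed
  also have "\<dots> = (\<integral>\<^sup>+x. (\<integral>\<^sup>+z. (indicator {z<..1} x * ennreal (inverse (F x))) * indicator {y..1} z \<partial>\<mu>) \<partial>\<nu>s)"
  proof (rule Fubini'[symmetric])
    have "(\<lambda>w. (case w of (z, x) \<Rightarrow> indicator {z<..1} x * ennreal (inverse (F x))) * indicator {y..1} (fst w))
        \<in> borel_measurable (\<mu> \<Otimes>\<^sub>M \<nu>s)" by measurable
    then show "(\<lambda>(z, x). (indicator {z<..1} x * ennreal (inverse (F x))) * indicator {y..1} z) \<in> borel_measurable (\<mu> \<Otimes>\<^sub>M \<nu>s)"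
      by (simp add: case_prod_beta')
  qed
  also have "\<dots> = (\<integral>\<^sup>+x. ennreal (max 0 (1 - F y / F x)) \<partial>\<nu>s)"
  \<comment> \<open>At x = 0 the inner integral is 0 but the right-hand side is 1, as division by
    zero yields 0. The missing atom of the dual at 0 reconciles them.\<close>
  proof (rule nn_integral_cong_AE, rule AE_mp[OF \<nu>s_no_atom_0], intro AE_I2 impI)
    fix x assume x: "x \<in> space \<nu>s" "x \<noteq> 0"
    then have x': "0 < x" "x \<le> 1" by (auto simp: \<nu>s_prob(3))
    note Fx = F_pos[OF x']
    have "(\<integral>\<^sup>+z. (indicator {z<..1} x * ennreal (inverse (F x))) * indicator {y..1} z \<partial>\<mu>)
        = (\<integral>\<^sup>+z. ennreal (inverse (F x)) * indicator {y..<x} z \<partial>\<mu>)"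
      using x' by (intro nn_integral_cong) (simp add: indicator_def)
    also have "\<dots> = ennreal (inverse (F x)) * emeasure \<mu> {y..<x}"
      using y x' by (intro nn_integral_cmult_indicator) (auto simp: \<mu>_prob(2) sets_I_borel_iff)
    also have "\<dots> = ennreal (max 0 (1 - F y / F x))"
    proof (cases "y \<le> x")
      case True
      have "F y \<le> F x" using True y x' by (intro F_mono) auto
      then have "ennreal (inverse (F x)) * ennreal (F x - F y) = ennreal (inverse (F x) * (F x - F y))"
        using Fx by (intro ennreal_mult[symmetric]) simp_all
      also have "inverse (F x) * (F x - F y) = max 0 (1 - F y / F x)"
        using Fx \<open>F y \<le> F x\<close> by (simp add: field_simps max_def)
      finally show ?thesis using True y x' by (simp add: emeasure_\<mu>_Ico)
    next
      case False
      then have "F x \<le> F y" using y x' by (intro F_mono) auto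
      then have "max 0 (1 - F y / F x) = 0" using Fx by (simp add: field_simps)
      then show ?thesis using False by simp
    qed
    finally show "(\<integral>\<^sup>+z. (indicator {z<..1} x * ennreal (inverse (F x))) * indicator {y..1} z \<partial>\<mu>)
        = ennreal (max 0 (1 - F y / F x))" .
  qed
  finally show ?thesis .
qed

lemma density_R: "density \<mu> R = \<nu>"
proof (rule measure_I_eqI[symmetric])
  interpret \<nu>: prob_space \<nu> by (rule \<nu>_prob)
  interpret \<nu>s: prob_space \<nu>s by (rule \<nu>s_prob)
  show "finite_measure \<nu>" by unfold_locales
  show "sets \<nu> = sets I_borel" by (rule \<nu>_prob)
  show "sets (density \<mu> R) = sets I_borel" by (simp add: \<mu>_prob(2))
  fix y :: real assume y: "y \<in> {0..<1}"
  show "emeasure \<nu> {y..1} = emeasure (density \<mu> R) {y..1}"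
  \<comment> \<open>The formula for averaged indicators covers interior y; at y = 0 both sides are
    total masses.\<close>
  proof (cases "y = 0")
    case True
    then show ?thesis
      using density_Icc[of 0] \<nu>.emeasure_space_1 \<nu>s.emeasure_space_1 by (simp add: \<nu>_prob(3))
  next
    case False
    then have yJ: "y \<in> J" using y by auto
    have eq: "\<Lambda> (indicator {y..1}) x = max 0 (1 - F y / F x)" if "x \<in> {0..1}" "x \<noteq> 0" for x
      using that by (simp add: Lambda_indicator[OF yJ])
    have "emeasure (density \<mu> R) {y..1} = (\<integral>\<^sup>+x. ennreal (\<Lambda> (indicator {y..1}) x) \<partial>\<nu>s)"
      unfolding density_Icc[OF y]
    proof (rule nn_integral_cong_AE, rule AE_mp[OF \<nu>s_no_atom_0], intro AE_I2 impI)
      fix x assume "x \<in> space \<nu>s" "x \<noteq> 0"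
      then show "ennreal (max 0 (1 - F y / F x)) = ennreal (\<Lambda> (indicator {y..1}) x)"
        using eq[of x] by (simp only: \<nu>s_prob(3) simp_thms)
    qed
    also have "\<dots> = ennreal (\<integral>x. \<Lambda> (indicator {y..1}) x \<partial>\<nu>s)"
    proof (rule nn_integral_eq_integral[OF F_I_integrable[OF \<nu>s_prob(1,2) Lambda_indicator_F_I[OF yJ]]])
      show "AE x in \<nu>s. 0 \<le> \<Lambda> (indicator {y..1}) x"
        by (rule AE_I2) (simp add: \<nu>s_prob(3) Lambda_indicator[OF yJ] del: Lambda_0)
    qed
    also have "\<dots> = emeasure \<nu> {y..1}"
      by (simp only: measure_\<nu>_Icc[OF yJ, symmetric] \<nu>.emeasure_eq_measure)
    finally show ?thesis by simp
  qed
qed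

section \<open>The essential infimum of the density\<close>

lemma R_ge: assumes "z < 1" shows "ennreal (measure \<nu>s {1}) \<le> R z"
proof -
  interpret \<nu>s: prob_space \<nu>s by (rule \<nu>s_prob)
  have "ennreal (measure \<nu>s {1}) = (\<integral>\<^sup>+x. indicator {1} x \<partial>\<nu>s)"
    by (simp add: \<nu>s.emeasure_eq_measure[symmetric] \<nu>s_prob(2) sets_I_borel_iff)
  \<comment> \<open>The state x = 1 counts for every z < 1, with weight 1 / F 1 = 1.\<close>
  also have "\<dots> \<le> R z"
    unfolding R_def using assms by (intro nn_integral_mono) (simp add: indicator_def)
  finally show ?thesis .
qed

text \<open>The weight 1 / F x is at most 1 / F y for x \<ge> y. With the lower bound this squeezes
  the density on [y,1) between the dual mass at 1 and a quantity that tends to this mass as y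
  approaches 1.\<close>

lemma R_le:
  assumes "0 < y" "y \<le> z"
  shows "R z \<le> ennreal (measure \<nu>s {y..1} / F y)"
proof (cases "y \<le> 1")
  case True
  interpret \<nu>s: prob_space \<nu>s by (rule \<nu>s_prob)
  have ys: "{y..1} \<in> sets \<nu>s" using Icc_sets[of y] assms by (simp add: \<nu>s_prob(2))
  have Fy: "0 < F y" using F_pos[of y] assms True by simp
  have "R z \<le> (\<integral>\<^sup>+x. ennreal (inverse (F y)) * indicator {y..1} x \<partial>\<nu>s)"
    unfolding R_def
  proof (rule nn_integral_mono)
    fix x
    show "indicator {z<..1} x * ennreal (inverse (F x)) \<le> ennreal (inverse (F y)) * indicator {y..1} x"
    proof (cases "x \<in> {z<..1}")
      case True
      have "F y \<le> F x" using True assms by (intro F_mono) auto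
      then show ?thesis using True assms Fy by (simp add: ennreal_leI le_imp_inverse_le)
    qed simp
  qed
  also have "\<dots> = ennreal (inverse (F y)) * emeasure \<nu>s {y..1}"
    by (rule nn_integral_cmult_indicator[OF ys])
  also have "\<dots> = ennreal (measure \<nu>s {y..1} / F y)"
    using Fy by (simp add: \<nu>s.emeasure_eq_measure ennreal_mult[symmetric] divide_inverse mult.commute)
  finally show ?thesis .
next
  case False
  then have "R z = (\<integral>\<^sup>+x. 0 \<partial>\<nu>s)"
    unfolding R_def using assms by (intro nn_integral_cong) (simp add: indicator_def)
  then show ?thesis by simp
qed

lemma ess_inf_eq: "ess_inf \<mu> (RN_deriv \<mu> \<nu>) = measure \<nu>s {1}"
proof -
  interpret \<mu>: prob_space \<mu> by (rule \<mu>_prob)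
  interpret \<nu>s: prob_space \<nu>s by (rule \<nu>s_prob)
  define \<alpha> where "\<alpha> = measure \<nu>s {1}"
  have RN: "AE z in \<mu>. R z = RN_deriv \<mu> \<nu> z"
    by (rule \<mu>.RN_deriv_unique[OF R_measurable density_R])
  have meas: "{z \<in> space \<mu>. RN_deriv \<mu> \<nu> z < ennreal r} \<in> sets \<mu>" for r by measurable
  \<comment> \<open>The lower bound on \<open>R\<close> holds for z < 1 and \<open>R 1 = 0\<close>,
    so it matters that the stationary law has no atom at 1.\<close>
  have "{1} \<in> sets \<mu>" by (simp add: \<mu>_prob(2) sets_I_borel_iff)
  moreover have "measure \<mu> {1} = 0" using measure_\<mu>_Icc[of 1] by simp
  moreover have "{z \<in> space \<mu>. \<not> z \<noteq> 1} = {1}" by (auto simp: \<mu>_prob(3))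
  ultimately have AE1: "AE z in \<mu>. z \<noteq> 1" by (simp add: AE_iff_measurable \<mu>.emeasure_eq_measure)
  have "emeasure \<mu> {z \<in> space \<mu>. RN_deriv \<mu> \<nu> z < ennreal r} = 0 \<longleftrightarrow> r \<le> \<alpha>" for r
  proof
    assume r: "r \<le> \<alpha>"
    have "AE z in \<mu>. \<not> RN_deriv \<mu> \<nu> z < ennreal r"
      using RN AE1 AE_space
    proof eventually_elim
      case (elim z)
      then have "z < 1" by (auto simp: \<mu>_prob(3))
      from R_ge[OF this] have "ennreal r \<le> R z" using r unfolding \<alpha>_def by (meson ennreal_leI order_trans)
      then show ?case using elim(1) by (simp add: not_less)
    qed
    then show "emeasure \<mu> {z \<in> space \<mu>. RN_deriv \<mu> \<nu> z < ennreal r} = 0"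
      using meas[of r] by (simp add: AE_iff_measurable[OF _ refl])
  next
    assume zero: "emeasure \<mu> {z \<in> space \<mu>. RN_deriv \<mu> \<nu> z < ennreal r} = 0"
    show "r \<le> \<alpha>"
    proof (rule ccontr)
      assume "\<not> r \<le> \<alpha>"
      then have r: "\<alpha> < r" by simp
      \<comment> \<open>If r exceeds the dual mass at 1, the upper bound falls below r for some y n
        < 1. The density is then below r on the whole of [y n, 1], a set of positive stationary
        mass.\<close>
      define y where "y n = 1 - inverse (real (Suc (Suc n)))" for n
      have inv: "inverse (real (Suc (Suc n))) < 1" "0 < inverse (real (Suc (Suc n)))" for n
        by (rule inverse_less_1_iff[THEN iffD2]) simp_all
      have yJ: "y n \<in> J" for n using inv[of n] by (simp add: y_def)
      have "decseq (\<lambda>n. {y n..1})"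
      proof (rule decseq_SucI)
        fix n
        have "inverse (real (Suc (Suc (Suc n)))) \<le> inverse (real (Suc (Suc n)))" by (rule le_imp_inverse_le) simp_all
        then show "{y (Suc n)..1} \<le> {y n..1}" by (auto simp: y_def)
      qed
      moreover have "range (\<lambda>n. {y n..1}) \<subseteq> sets \<nu>s"
        using Icc_sets[OF less_imp_le] yJ by (auto simp: \<nu>s_prob(2))
      ultimately have "(\<lambda>n. measure \<nu>s {y n..1}) \<longlonglongrightarrow> measure \<nu>s (\<Inter>n. {y n..1})"
        by (intro \<nu>s.finite_Lim_measure_decseq)
      moreover have y1: "y \<longlonglongrightarrow> 1"
      proof -
        have "y \<longlonglongrightarrow> 1 - 0" unfolding y_def by (intro tendsto_intros LIMSEQ_Suc[OF LIMSEQ_inverse_real_of_nat])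
        then show ?thesis by simp
      qed
      moreover have "(\<Inter>n. {y n..1}) = {1}"
      proof (intro equalityI subsetI)
        fix z assume "z \<in> (\<Inter>n. {y n..1})"
        then have "\<And>n. y n \<le> z" "z \<le> 1" by auto
        moreover from this have "1 \<le> z" by (intro LIMSEQ_le_const2[OF y1]) auto
        ultimately show "z \<in> {1}" by simp
      qed (use yJ in \<open>simp add: less_imp_le\<close>)
      ultimately have l1: "(\<lambda>n. measure \<nu>s {y n..1}) \<longlonglongrightarrow> \<alpha>" by (simp add: \<alpha>_def)
      have l2: "(\<lambda>n. F (y n)) \<longlonglongrightarrow> F 1"
        by (rule continuous_on_tendsto_compose[OF F_cont y1]) (use yJ in \<open>simp_all add: less_imp_le\<close>)
      have "(\<lambda>n. measure \<nu>s {y n..1} / F (y n)) \<longlonglongrightarrow> \<alpha> / F 1"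
        by (intro tendsto_divide l1 l2) simp
      then have "eventually (\<lambda>n. measure \<nu>s {y n..1} / F (y n) < r) sequentially"
        by (rule order_tendstoD(2)) (use r in simp)
      then obtain n where n: "measure \<nu>s {y n..1} / F (y n) < r"
        using eventually_happens'[OF sequentially_bot] by blast
      have y0: "0 < y n" "y n < 1" using yJ[of n] by simp_all
      have "AE z in \<mu>. \<not> RN_deriv \<mu> \<nu> z < ennreal r"
        using zero meas[of r] by (simp add: AE_iff_measurable[OF _ refl])
      with RN have "AE z in \<mu>. z \<notin> {y n..1}"
      proof eventually_elim
        case (elim z)
        have "R z < ennreal r" if "y n \<le> z"
        proof -
          have "0 \<le> measure \<nu>s {y n..1} / F (y n)"
            using F_pos[of "y n"] y0 by (simp add: less_imp_le)
          then show ?thesis using R_le[OF y0(1) that] n by (meson ennreal_lessI le_less_trans)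
        qed
        then show ?case using elim by auto
      qed
      moreover have "{y n..1} \<in> sets \<mu>" using Icc_sets[of "y n"] y0 by (simp add: \<mu>_prob(2))
      ultimately have "measure \<mu> {y n..1} = 0"
        using \<mu>.prob_eq_0[of "{y n..1}"] by simp
      moreover have "measure \<mu> {y n..1} = 1 - F (y n)" using y0 by (intro measure_\<mu>_Icc) simp
      moreover have "F (y n) < F 1" using y0 by (intro F_strict_mono) simp_all
      ultimately show False by simp
    qed
  qed
  \<comment> \<open>Negative r are included, since \<open>ennreal r\<close> is then 0; the set is a
    full closed ray and its supremum is the right end.\<close>
  then have "{r. emeasure \<mu> {z \<in> space \<mu>. RN_deriv \<mu> \<nu> z < ennreal r} = 0} = {..\<alpha>}" by auto
  then show ?thesis by (simp add: ess_inf_def \<alpha>_def)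
qed

lemma separation_eq: "separation \<mu> \<nu> = 1 - measure (\<mu>0s \<bind> Qs) {\<omega> \<in> space \<Omega>s. Xs t \<omega> = 1}"
proof -
  have "measure \<nu>s {1} = measure (\<mu>0s \<bind> Qs) (Xs t -` {1} \<inter> space (\<mu>0s \<bind> Qs))"
    unfolding law_at_def
  proof (rule measure_distr)
    show "Xs t \<in> (\<mu>0s \<bind> Qs) \<rightarrow>\<^sub>M I_borel"
      using dual.X_measurable[OF t0] dual.bind_prob_space[OF \<mu>0s] by (simp cong: measurable_cong_sets)
  qed (simp add: sets_I_borel_iff)
  also have "Xs t -` {1} \<inter> space (\<mu>0s \<bind> Qs) = {\<omega> \<in> space \<Omega>s. Xs t \<omega> = 1}"
    unfolding dual.bind_prob_space(3)[OF \<mu>0s] by blast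
  finally show ?thesis by (simp only: separation_def ess_inf_eq)
qed

end

theorem lemma5p2:
  fixes \<Omega> :: "'w measure" and Q :: "real \<Rightarrow> 'w measure" and X :: "real \<Rightarrow> 'w \<Rightarrow> real"
    and \<Omega>s :: "'v measure" and Qs :: "real \<Rightarrow> 'v measure" and Xs :: "real \<Rightarrow> 'v \<Rightarrow> real"
    and a b :: "real \<Rightarrow> real" and c t :: real
    and \<mu> \<mu>0 \<mu>0s :: "real measure"
  assumes a_cont: "continuous_on {0<..<1} a"
    and b_cont: "continuous_on {0<..<1} b"
    and b_pos: "\<And>x. x \<in> {0<..<1} \<Longrightarrow> b x > 0"
    and c: "c \<in> {0<..<1}"
    and X: "feller_diffusion \<Omega> Q X"
    and X_gen: "has_diffusion_generator Q X a b c"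
    and X_regular: "regular_process \<Omega> Q X"
    and bdry0: "reflecting0 a b c (gen_dom Q X) \<or> entrance0 a b c"
    and bdry1: "reflecting1 a b c (gen_dom Q X) \<or> entrance1 a b c"
    and init: "\<mu>0 \<in> space (prob_algebra I_borel)"
    and stationary: "invariant_distribution Q X \<mu>"
    and Xs: "feller_diffusion \<Omega>s Qs Xs"
    and inits: "\<mu>0s \<in> space (prob_algebra I_borel)"
    and dual: "strong_stationary_dual a b c Q X \<mu>0 Qs Xs \<mu>0s"
    and t: "t > 0"
  shows "separation \<mu> (law_at Q X \<mu>0 t)
           = measure (\<mu>0s \<bind> Qs) {\<omega> \<in> space \<Omega>s. hitting_time Xs 1 \<omega> > ereal t}
       \<and> measure (\<mu>0s \<bind> Qs) {\<omega> \<in> space \<Omega>s. hitting_time Xs 1 \<omega> > ereal t}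
           = 1 - measure (\<mu>0s \<bind> Qs) {\<omega> \<in> space \<Omega>s. Xs t \<omega> = 1}"
proof -
  have N: "N0 a b c < \<infinity>" "N1 a b c < \<infinity>"
    using bdry0 bdry1 by (auto simp: reflecting0_def reflecting1_def entrance0_def entrance1_def)
  interpret X: feller_diffusion \<Omega> Q X by (rule X)
  interpret Xs: feller_diffusion \<Omega>s Qs Xs by (rule Xs)
  interpret strong_stationary_duality a b c \<Omega> Q X \<Omega>s Qs Xs \<mu> \<mu>0 \<mu>0s t
    by unfold_locales
      (use a_cont b_cont b_pos c N X_gen stationary init inits t dual in \<open>simp_all add: strong_stationary_dual_def\<close>)
  show ?thesis
    using separation_eq Xs.measure_hitting_time_gt[OF absorbing inits t] by simp
qed

end
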